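(* Let $F$ be a distribution function on $\mathbb{R}^+$ with $\inf \operatorname{supp} F = 1$ and $F(1) = p > p^{\rightarrow}_{c}$, and let the passage times $\{t(e) : e \in \mathcal{E}^2\}$ be i.i.d. with distribution function $F$. Then almost surely for any $\theta \in [\theta^-_p, \theta^+_p]$, there exists a collection $\{\gamma_{\mathbf{x}} : \mathbf{x} \in \mathbb{Z}^2\}$ of infinite geodesics such that the following are true: (1) for every $\mathbf{x}\in\mathbb{Z}^2$, $\gamma_{\mathbf{x}}$ starts from $\mathbf{x}$ and has asymptotic direction $\theta$; (2) for all $\mathbf{x}, \mathbf{y} \in \mathbb{Z}^2$, the infinite geodesics $\gamma_{\mathbf{x}}$ and $\gamma_{\mathbf{y}}$ coalesce.
   Context: First passage percolation on the lattice $(\mathbb{Z}^2,\mathcal{E}^2)$: two vertices $\mathbf{x},\mathbf{y}\in\mathbb{Z}^2$ are neighbours if $\|\mathbf{x}-\mathbf{y}\|_1=1$, and $\mathcal{E}^2$ is the set of line segments (edges) between neighbouring vertices. Each edge $e$ carries a strictly positive random passage time $t(e)$. A lattice path is a sequence of successively neighbouring vertices $\{\gamma(i): i\in I\}$; it is finite or infinite (semi-infinite, $I=\mathbb{N}$) according to $I$. For a finite path $\gamma$, $\tau(\gamma)$ is the sum of $t(e)$ over the edges along $\gamma$; $\tau(\mathbf{x},\mathbf{y})=\inf_{\gamma}\tau(\gamma)$ over finite paths from $\mathbf{x}$ to $\mathbf{y}$. A geodesic from $\mathbf{x}$ to $\mathbf{y}$ is a finite path $\gamma$ from $\mathbf{x}$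 to $\mathbf{y}$ with $\tau(\gamma)=\tau(\mathbf{x},\mathbf{y})$. An infinite geodesic is an infinite path each of whose finite subpaths is a geodesic. An infinite path $\gamma$ has asymptotic direction $\theta$ if $\lim_{n\to\infty}\arg\bigl(\gamma(n)/\|\gamma(n)\|_1\bigr)=\theta$. Two infinite paths $\gamma_1,\gamma_2$ coalesce if there exist $i_1,i_2\in\mathbb{N}$ with $\gamma_1(i_1+k)=\gamma_2(i_2+k)$ for all $k\ge0$. Oriented percolation: in oriented bond percolation on $\mathbb{Z}^2$ each vertex $\mathbf{x}$ has two oriented edges, to $\mathbf{x}+(1,0)$ and $\mathbf{x}+(0,1)$, and edges are open independently with probability $p$. $p^{\rightarrow}_c$ is the critical value: the probability that there is an infinite oriented open path from the origin is $0$ for $p\le p^{\rightarrow}_c$ and positive for $p>p^{\rightarrow}_c$. In the present model an edge $e$ is open if $t(e)=1$. For $p>p^{\rightarrow}_c$, $\alpha_p>0$ denotes the asymptotic speed of the rightmost infinite oriented open path: conditionally on the existence of an infinite oriented open path from the origin, if $r$ is the rightmost such path (the one that always is closest to the horizontal axis direction, i.e. maximizing $\mathbf{x}(1)-\mathbf{x}(2)$ at each level among infinite oriented open paths from the origin), with $r(n)$ its $n$-th vertex, then almost surely $\frac{r(n)(1)-r(n)(2)}{\sqrt{2}\,n}\to\alpha_p$. Let $M_p=(1/2+\alpha_p/\sqrt2,\,1/2-\alpha_p/\sqrt2)$ and $N_p=(1/2-\alpha_p/\sqrt2,\,1/2+\alpha_p/\sqrt2)$. $\theta^-_p$ and $\theta^+_p$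 are the arguments of $M_p$ and $N_p$ respectively. *)

theory Defs
  imports "HOL-Probability.Probability"
begin

type_synonym vertex = "int \<times> int"

type_synonym edge = "vertex set"

definition neighbours :: "vertex \<Rightarrow> vertex \<Rightarrow> bool" where
  "neighbours x y \<longleftrightarrow> \<bar>fst x - fst y\<bar> + \<bar>snd x - snd y\<bar> = 1"

text \<open>The segment between two neighbouring vertices is encoded as the set of its end points.\<close>

definition lattice_edges :: "edge set" where
  "lattice_edges = {{x, y} | x y. neighbours x y}"

definition finite_lattice_path :: "vertex list \<Rightarrow> bool" where
  "finite_lattice_path vs \<longleftrightarrow>
     vs \<noteq> [] \<and> (\<forall>i. Suc i < length vs \<longrightarrow> neighbours (vs ! i) (vs ! Suc i))"

definition path_from_to :: "vertex list \<Rightarrow> vertex \<Rightarrow> vertex \<Rightarrow> bool" where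
  "path_from_to vs x y \<longleftrightarrow> finite_lattice_path vs \<and> hd vs = x \<and> last vs = y"

definition infinite_lattice_path :: "(nat \<Rightarrow> vertex) \<Rightarrow> bool" where
  "infinite_lattice_path \<gamma> \<longleftrightarrow> (\<forall>i. neighbours (\<gamma> i) (\<gamma> (Suc i)))"

definition path_time :: "(edge \<Rightarrow> real) \<Rightarrow> vertex list \<Rightarrow> real" where
  "path_time w vs = (\<Sum>i<length vs - 1. w {vs ! i, vs ! Suc i})"

definition passage_time :: "(edge \<Rightarrow> real) \<Rightarrow> vertex \<Rightarrow> vertex \<Rightarrow> real" where
  "passage_time w x y = (INF vs\<in>{vs. path_from_to vs x y}. path_time w vs)"

definition geodesic :: "(edge \<Rightarrow> real) \<Rightarrow> vertex list \<Rightarrow> vertex \<Rightarrow> vertex \<Rightarrow> bool" where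
  "geodesic w vs x y \<longleftrightarrow> path_from_to vs x y \<and> path_time w vs = passage_time w x y"

definition infinite_geodesic :: "(edge \<Rightarrow> real) \<Rightarrow> (nat \<Rightarrow> vertex) \<Rightarrow> bool" where
  "infinite_geodesic w \<gamma> \<longleftrightarrow> infinite_lattice_path \<gamma> \<and>
     (\<forall>i j. i \<le> j \<longrightarrow> geodesic w (map \<gamma> [i..<Suc j]) (\<gamma> i) (\<gamma> j))"

text \<open>
  The argument is the principal one, in \<open>(-\<pi>, \<pi>]\<close>. The directions considered below lie in
  \<open>[0, \<pi>/2]\<close>, away from the branch cut.
\<close>

definition plane_arg :: "real \<times> real \<Rightarrow> real" where
  "plane_arg v = Arg (Complex (fst v) (snd v))"

definition norm1 :: "vertex \<Rightarrow> real" where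
  "norm1 x = \<bar>real_of_int (fst x)\<bar> + \<bar>real_of_int (snd x)\<bar>"

definition has_asymptotic_direction :: "(nat \<Rightarrow> vertex) \<Rightarrow> real \<Rightarrow> bool" where
  "has_asymptotic_direction \<gamma> \<theta> \<longleftrightarrow>
     (\<lambda>n. plane_arg (real_of_int (fst (\<gamma> n)) / norm1 (\<gamma> n), real_of_int (snd (\<gamma> n)) / norm1 (\<gamma> n)))
       \<longlonglongrightarrow> \<theta>"

definition coalesce :: "(nat \<Rightarrow> vertex) \<Rightarrow> (nat \<Rightarrow> vertex) \<Rightarrow> bool" where
  "coalesce \<gamma>1 \<gamma>2 \<longleftrightarrow> (\<exists>i1 i2. \<forall>k. \<gamma>1 (i1 + k) = \<gamma>2 (i2 + k))"

text \<open>
  Oriented bond percolation. Every lattice edge carries exactly one orientation (to the right or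
  upwards), so a configuration is a map on \<^const>\<open>lattice_edges\<close>, with \<^const>\<open>True\<close> meaning open.
\<close>

definition open_oriented_path_from :: "(edge \<Rightarrow> bool) \<Rightarrow> vertex \<Rightarrow> (nat \<Rightarrow> vertex) \<Rightarrow> bool" where
  "open_oriented_path_from \<omega> x r \<longleftrightarrow> r 0 = x \<and>
     (\<forall>n. (r (Suc n) = r n + (1, 0) \<or> r (Suc n) = r n + (0, 1)) \<and> \<omega> {r n, r (Suc n)})"

definition oriented_percolation :: "real \<Rightarrow> (edge \<Rightarrow> bool) measure" where
  "oriented_percolation p = (\<Pi>\<^sub>M e\<in>lattice_edges. measure_pmf (bernoulli_pmf p))"

definition percolation_probability :: "real \<Rightarrow> real" where
  "percolation_probability p =
     measure (oriented_percolation p)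
       {\<omega> \<in> space (oriented_percolation p). \<exists>r. open_oriented_path_from \<omega> (0, 0) r}"

definition oriented_critical :: real where
  "oriented_critical = Sup {p \<in> {0..1}. percolation_probability p = 0}"

definition rightmost_open_path :: "(edge \<Rightarrow> bool) \<Rightarrow> (nat \<Rightarrow> vertex) \<Rightarrow> bool" where
  "rightmost_open_path \<omega> r \<longleftrightarrow> open_oriented_path_from \<omega> (0, 0) r \<and>
     (\<forall>s. open_oriented_path_from \<omega> (0, 0) s \<longrightarrow>
        (\<forall>n. fst (s n) - snd (s n) \<le> fst (r n) - snd (r n)))"

text \<open>
  A rightmost path is unique, and it exists whenever there is an infinite open oriented path from
  the origin. For \<open>p > oriented_critical\<close> the latter event has positive probability, so that a
  statement about all rightmost paths that holds almost surely is a statement holding almost surely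
  conditionally on this event; it determines the speed uniquely.
\<close>

definition is_rightmost_speed :: "real \<Rightarrow> real \<Rightarrow> bool" where
  "is_rightmost_speed p a \<longleftrightarrow>
     (AE \<omega> in oriented_percolation p. \<forall>r. rightmost_open_path \<omega> r \<longrightarrow>
        (\<lambda>n. real_of_int (fst (r n) - snd (r n)) / (sqrt 2 * real n)) \<longlonglongrightarrow> a)"

text \<open>Meaningful for \<open>oriented_critical < p \<le> 1\<close> only.\<close>

definition rightmost_speed :: "real \<Rightarrow> real" where
  "rightmost_speed p = (THE a. is_rightmost_speed p a)"

definition cone_M :: "real \<Rightarrow> real \<times> real" where
  "cone_M p = (1/2 + rightmost_speed p / sqrt 2, 1/2 - rightmost_speed p / sqrt 2)"

definition cone_N :: "real \<Rightarrow> real \<times> real" where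
  "cone_N p = (1/2 - rightmost_speed p / sqrt 2, 1/2 + rightmost_speed p / sqrt 2)"

definition theta_minus :: "real \<Rightarrow> real" where
  "theta_minus p = plane_arg (cone_M p)"

definition theta_plus :: "real \<Rightarrow> real" where
  "theta_plus p = plane_arg (cone_N p)"

definition nonneg_distribution_function :: "(real \<Rightarrow> real) \<Rightarrow> bool" where
  "nonneg_distribution_function F \<longleftrightarrow>
     mono F \<and> (\<forall>x. continuous (at_right x) F) \<and> (F \<longlongrightarrow> 0) at_bot \<and> (F \<longlongrightarrow> 1) at_top \<and>
     (\<forall>x<0. F x = 0)"

definition dist_supp :: "(real \<Rightarrow> real) \<Rightarrow> real set" where
  "dist_supp F = {x. \<forall>\<epsilon>>0. F (x - \<epsilon>) < F (x + \<epsilon>)}"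

end

theory Submission
  imports Defs "HOL-Real_Asymp.Real_Asymp"
begin

text \<open>
  Oriented paths of edges with passage time 1 are geodesics, because all passage times are at least 1.
  Given an infinite open oriented path \<open>\<Gamma>\<close>, the map \<open>n \<mapsto> \<tau>(x, \<Gamma>(n)) - n\<close> is nonincreasing. It is even
  eventually constant if two open oriented paths, started far to the left and far to the right of \<open>x\<close>, run
  into \<open>\<Gamma>\<close>: a geodesic from \<open>x\<close> to \<open>\<Gamma>(n)\<close> cannot avoid these guards, and from a guard on it can follow
  open edges to \<open>\<Gamma>\<close>. Hence a geodesic from \<open>x\<close> to a late point of \<open>\<Gamma>\<close>, prolonged by \<open>\<Gamma>\<close>, is an infinite
  geodesic, and all these geodesics coalesce.

  Such a guarded \<open>\<Gamma>\<close> exists almost surely for all slopes in the cone at once. Moving the origin to the first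
  level at which the right edge of the cluster percolates preserves the law conditioned on percolation,
  with a displacement of finite mean that is independent of the new configuration. This gives the speed
  of the rightmost path and, by alternating with the mirror image, paths for a dense set of slopes;
  rightmost paths join these to paths of every slope. Coalescence of the rightmost paths, which follows
  from a Burton--Keane argument, is needed only if the cone degenerates to a ray.
\<close>

section \<open>Oriented percolation in a half-plane\<close>

text \<open>The rightmost infinite path looks into the future, because it avoids sites that die out;
  the right edge of the cluster is determined by the levels explored so far. They meet at breaks,
  and "the first break is at \<open>v\<close>" splits into an event below the level of
  \<open>v\<close> and percolation from \<open>v\<close>. This is why recentring there preserves the
  conditioned law. The mean of the break level is bounded by a renewal identity (decompose according
  to the last break), without any estimate on the percolation process. The strong law is obtained
  without ergodicity: \<open>renewing\<close> asks only that the increment have constant conditional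
  mean given the recentred configuration. This survives reflection and composition, so mixing breaks
  with mirrored breaks reaches every rational convex combination, with positive weights, of the two
  extreme slopes. For passage times the level acts as a potential: an edge costs at least 1 and
  changes the level by one, so time minus gain of level is nonnegative, and it is 0 along open
  oriented paths.\<close>

text \<open>
  The site \<open>(n, i)\<close> on level \<open>n\<close> is the vertex \<open>(i, n - i)\<close>; \<open>(n, i, True)\<close> and \<open>(n, i, False)\<close> are the edges
  from it to the right and upwards. Levels start at 0: edges of the lower half-plane are never needed.
\<close>

type_synonym config = "nat \<times> int \<times> bool \<Rightarrow> bool"

fun conn :: "config \<Rightarrow> nat \<Rightarrow> nat \<Rightarrow> int \<Rightarrow> int \<Rightarrow> bool" where
  "conn \<eta> 0 n i j \<longleftrightarrow> i = j"
| "conn \<eta> (Suc k) n i j \<longleftrightarrow>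
     (\<eta> (n, i, True) \<and> conn \<eta> k (Suc n) (i + 1) j) \<or> (\<eta> (n, i, False) \<and> conn \<eta> k (Suc n) i j)"

text \<open>Finite connections of every length instead of an infinite path: in this form the event
  is visibly measurable. The infinite path is recovered by compactness in \<open>perc_step\<close>
  and \<open>rpath_opath\<close>.\<close>

definition perc :: "config \<Rightarrow> nat \<Rightarrow> int \<Rightarrow> bool" where
  "perc \<eta> n i \<longleftrightarrow> (\<forall>k. \<exists>j. conn \<eta> k n i j)"

definition step :: "config \<Rightarrow> nat \<Rightarrow> int \<Rightarrow> int \<Rightarrow> bool" where
  "step \<eta> n i j \<longleftrightarrow> (j = i + 1 \<and> \<eta> (n, i, True)) \<or> (j = i \<and> \<eta> (n, i, False))"

text \<open>Paths are indexed by level. Below the level of the starting point their values are irrelevant.\<close>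

definition opath :: "config \<Rightarrow> nat \<Rightarrow> (nat \<Rightarrow> int) \<Rightarrow> bool" where
  "opath \<eta> n h \<longleftrightarrow> (\<forall>k\<ge>n. step \<eta> k (h k) (h (Suc k)))"

text \<open>A greedy rule: go right whenever the edge is open and its end still percolates. Keeping
  the value stands for the step upwards, which is open and leads to a percolating site if the start
  percolates; for other starts the values are meaningless.\<close>

primrec rpath :: "config \<Rightarrow> nat \<Rightarrow> int \<Rightarrow> nat \<Rightarrow> int" where
  "rpath \<eta> n i 0 = i"
| "rpath \<eta> n i (Suc k) =
     (if n \<le> k \<and> \<eta> (k, rpath \<eta> n i k, True) \<and> perc \<eta> (Suc k) (rpath \<eta> n i k + 1)
      then rpath \<eta> n i k + 1 else rpath \<eta> n i k)"

text \<open>The configuration seen from \<open>v\<close>, which becomes the origin.\<close>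

definition sh :: "nat \<times> int \<Rightarrow> config \<Rightarrow> config" where
  "sh v \<eta> = (\<lambda>(n, i, b). \<eta> (n + fst v, i + snd v, b))"

text \<open>Reflection of the lattice in the main diagonal: the vertex \<open>(i, n - i)\<close>
  goes to \<open>(n - i, i)\<close>, and the two orientations are exchanged.\<close>

definition mir :: "config \<Rightarrow> config" where
  "mir \<eta> = (\<lambda>(n, i, b). \<eta> (n, int n - i, \<not> b))"

section \<open>Open connections, percolating sites and crossing paths\<close>

lemma conn_bounds: "conn \<eta> k n i j \<Longrightarrow> i \<le> j \<and> j \<le> i + int k"
  by (induction k arbitrary: n i) fastforce+

lemma conn_add: "conn \<eta> (k + l) n i j \<longleftrightarrow> (\<exists>m. conn \<eta> k n i m \<and> conn \<eta> l (n + k) m j)"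
  by (induction k arbitrary: n i) auto

lemma conn_Suc_step: "conn \<eta> (Suc k) n i j \<longleftrightarrow> (\<exists>m. step \<eta> n i m \<and> conn \<eta> k (Suc n) m j)"
  by (auto simp: step_def)

lemma step_bounds: "step \<eta> n i j \<Longrightarrow> i \<le> j \<and> j \<le> i + 1"
  by (auto simp: step_def)

text \<open>Planarity. Each step moves by 0 or 1, so two paths cannot exchange their order without
  meeting; from the meeting point on, the path from \<open>i'\<close> can follow the one that ends
  at \<open>j\<close>.\<close>

lemma conn_cross:
  assumes "conn \<eta> k n i j" "conn \<eta> k n i' j'" "i \<le> i'" "j' \<le> j"
  shows "conn \<eta> k n i' j"
  using assms
proof (induction k arbitrary: n i i')
  case 0
  then show ?case by simp
next
  case (Suc k)
  show ?case
  proof (cases "i = i'")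
    case False
    obtain m where m: "step \<eta> n i m" "conn \<eta> k (Suc n) m j"
      using Suc.prems(1) unfolding conn_Suc_step by blast
    obtain m' where m': "step \<eta> n i' m'" "conn \<eta> k (Suc n) m' j'"
      using Suc.prems(2) unfolding conn_Suc_step by blast
    have "m \<le> m'" using step_bounds[OF m(1)] step_bounds[OF m'(1)] False Suc.prems(3) by linarith
    then have "conn \<eta> k (Suc n) m' j" using Suc.IH[OF m(2) m'(2)] Suc.prems(4) by blast
    then show ?thesis using m'(1) unfolding conn_Suc_step by blast
  qed (use Suc.prems in simp)
qed

lemma finite_conn: "finite {j. conn \<eta> k n i j}"
  by (rule finite_subset[of _ "{i..i + int k}"]) (auto dest: conn_bounds)

lemma perc_conn: "conn \<eta> k n i m \<Longrightarrow> perc \<eta> (n + k) m \<Longrightarrow> perc \<eta> n i"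
  unfolding perc_def
proof
  fix l assume c: "conn \<eta> k n i m" and p: "\<forall>l. \<exists>j. conn \<eta> l (n + k) m j"
  obtain j where "conn \<eta> (k + l) n i j"
    using c p unfolding conn_add by blast
  then show "\<exists>j. conn \<eta> l n i j"
    by (subst (asm) add.commute) (auto simp: conn_add)
qed

text \<open>Compactness for two successors: if they die out after \<open>a\<close> and
  \<open>b\<close> levels, no connection of length \<open>a + b + 1\<close> leaves the site.\<close>

lemma perc_step:
  "perc \<eta> n i \<longleftrightarrow> (\<exists>j. step \<eta> n i j \<and> perc \<eta> (Suc n) j)"
proof
  assume p: "perc \<eta> n i"
  show "\<exists>j. step \<eta> n i j \<and> perc \<eta> (Suc n) j"
  proof (rule ccontr)
    assume "\<not> ?thesis"
    then have "\<forall>j\<in>{i, i + 1}. \<exists>k. step \<eta> n i j \<longrightarrow> (\<forall>m. \<not> conn \<eta> k (Suc n) j m)"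
      unfolding perc_def by blast
    then obtain a b where a: "step \<eta> n i i \<Longrightarrow> \<not> conn \<eta> a (Suc n) i m"
      and b: "step \<eta> n i (i + 1) \<Longrightarrow> \<not> conn \<eta> b (Suc n) (i + 1) m" for m by blast
    obtain m where "conn \<eta> (Suc (a + b)) n i m" using p unfolding perc_def by blast
    then obtain j where j: "step \<eta> n i j" "conn \<eta> (a + b) (Suc n) j m" unfolding conn_Suc_step by blast
    then have "conn \<eta> (b + a) (Suc n) j m" by (simp add: add.commute)
    with j a b show False unfolding conn_add by (auto simp: step_def)
  qed
next
  assume "\<exists>j. step \<eta> n i j \<and> perc \<eta> (Suc n) j"
  then obtain j where "conn \<eta> (Suc 0) n i j" "perc \<eta> (n + Suc 0) j"
    by (auto simp: conn_Suc_step simp del: conn.simps(2))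
  then show "perc \<eta> n i" by (rule perc_conn)
qed

lemma opath_conn: "opath \<eta> n h \<Longrightarrow> n \<le> k \<Longrightarrow> conn \<eta> l k (h k) (h (k + l))"
proof (induction l arbitrary: k)
  case (Suc l)
  then have "conn \<eta> l (Suc k) (h (Suc k)) (h (Suc k + l))" by (metis le_SucI)
  moreover have "step \<eta> k (h k) (h (Suc k))" using Suc.prems by (simp add: opath_def)
  ultimately show ?case unfolding conn_Suc_step by auto
qed simp

lemma opath_perc: "opath \<eta> n h \<Longrightarrow> n \<le> k \<Longrightarrow> perc \<eta> k (h k)"
  unfolding perc_def using opath_conn by blast

lemma opath_mono: "opath \<eta> n h \<Longrightarrow> n \<le> k \<Longrightarrow> opath \<eta> k h"
  by (auto simp: opath_def)

lemma rpath_start: "k \<le> n \<Longrightarrow> rpath \<eta> n i k = i"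
  by (induction k) auto

lemma rpath_next:
  assumes "n \<le> k" "perc \<eta> k (rpath \<eta> n i k)"
  shows "step \<eta> k (rpath \<eta> n i k) (rpath \<eta> n i (Suc k)) \<and> perc \<eta> (Suc k) (rpath \<eta> n i (Suc k))"
  using assms perc_step[of \<eta> k "rpath \<eta> n i k"] by (auto simp: step_def)

lemma rpath_perc: "perc \<eta> n i \<Longrightarrow> n \<le> k \<Longrightarrow> perc \<eta> k (rpath \<eta> n i k)"
proof (induction k)
  case (Suc k)
  show ?case
  proof (cases "n \<le> k")
    case True
    then show ?thesis using rpath_next Suc by blast
  next
    case False
    then have "Suc k = n" using Suc by simp
    then show ?thesis using Suc rpath_start by simp
  qed
qed simp

lemma rpath_opath: "perc \<eta> n i \<Longrightarrow> opath \<eta> n (rpath \<eta> n i)"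
  unfolding opath_def using rpath_next rpath_perc by blast

text \<open>\<open>h\<close> cannot pass the greedy path without meeting it. At a meeting point
  every step of \<open>h\<close> to the right leads to a percolating site, so the greedy rule takes
  it as well.\<close>

lemma rpath_max:
  assumes "opath \<eta> m h" "n \<le> m" "h m \<le> rpath \<eta> n i m" "m \<le> k"
  shows "h k \<le> rpath \<eta> n i k"
  using assms(4)
proof (induction k rule: dec_induct)
  case (step k)
  have s: "step \<eta> k (h k) (h (Suc k))" and p: "perc \<eta> (Suc k) (h (Suc k))"
    using assms(1) step.hyps opath_perc[OF assms(1), of "Suc k"] by (auto simp: opath_def)
  show ?case
  proof (cases "h k = rpath \<eta> n i k")
    case True
    then show ?thesis using s p step.hyps assms(2) by (auto simp: step_def)
  next
    case False
    then have "h k + 1 \<le> rpath \<eta> n i k" using step.IH by simp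
    moreover have "h (Suc k) \<le> h k + 1" using step_bounds[OF s] by simp
    ultimately show ?thesis by auto
  qed
qed (use assms in auto)

lemma rpath_compose:
  assumes "n \<le> m" "m \<le> k"
  shows "rpath \<eta> m (rpath \<eta> n i m) k = rpath \<eta> n i k"
  using assms(2)
proof (induction k rule: dec_induct)
  case base
  show ?case by (rule rpath_start) simp
next
  case (step k)
  then show ?case using assms(1) by simp
qed

lemma opath_splice:
  assumes "opath \<eta> n g" "opath \<eta> m h" "n \<le> m" "g m = h m"
  shows "opath \<eta> n (\<lambda>k. if k \<le> m then g k else h k)"
  unfolding opath_def
proof (intro allI impI)
  fix k assume "n \<le> k"
  consider "Suc k \<le> m" | "k = m" | "m < k" by linarith
  then show "step \<eta> k (if k \<le> m then g k else h k) (if Suc k \<le> m then g (Suc k) else h (Suc k))"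
    using assms \<open>n \<le> k\<close> by cases (auto simp: opath_def)
qed

text \<open>A discrete intermediate value theorem: \<open>g - h\<close> changes by at most 1 per
  level.\<close>

lemma cross_meet:
  fixes g h :: "nat \<Rightarrow> int"
  assumes "\<And>k. m \<le> k \<Longrightarrow> g k \<le> g (Suc k) \<and> g (Suc k) \<le> g k + 1"
    and "\<And>k. m \<le> k \<Longrightarrow> h k \<le> h (Suc k) \<and> h (Suc k) \<le> h k + 1"
    and "g m \<le> h m" "h M \<le> g M" "m \<le> M"
  shows "\<exists>k\<ge>m. k \<le> M \<and> g k = h k"
proof (rule ccontr)
  assume c: "\<not> ?thesis"
  have "g k < h k" if "m \<le> k" "k \<le> M" for k
    using that
  proof (induction k rule: dec_induct)
    case base
    then show ?case using c assms(3) by force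
  next
    case (step k)
    have "g (Suc k) \<noteq> h (Suc k)" using c step by auto
    then show ?case using step assms(1,2)[of k] by force
  qed
  then show False using assms(4,5) by force
qed

lemma opath_steps: "opath \<eta> n h \<Longrightarrow> n \<le> k \<Longrightarrow> h k \<le> h (Suc k) \<and> h (Suc k) \<le> h k + 1"
  unfolding opath_def using step_bounds by blast

lemma opath_meet:
  assumes "opath \<eta> n g" "opath \<eta> n' h" "n \<le> m" "n' \<le> m" "g m \<le> h m" "m \<le> M" "h M \<le> g M"
  shows "\<exists>k\<ge>m. k \<le> M \<and> g k = h k"
proof (rule cross_meet)
  fix k assume k: "m \<le> k"
  show "g k \<le> g (Suc k) \<and> g (Suc k) \<le> g k + 1"
    using assms(3) k by (intro opath_steps[OF assms(1)]) simp
  show "h k \<le> h (Suc k) \<and> h (Suc k) \<le> h k + 1"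
    using assms(4) k by (intro opath_steps[OF assms(2)]) simp
qed (use assms in auto)

section \<open>Translations and the reflection\<close>

lemma conn_sh: "conn (sh v \<eta>) k n i j \<longleftrightarrow> conn \<eta> k (n + fst v) (i + snd v) (j + snd v)"
  by (induction k arbitrary: n i) (auto simp: sh_def algebra_simps)

lemma ex_shift_int: "(\<exists>j. P (j + c)) \<longleftrightarrow> (\<exists>j::int. P j)"
  by (metis diff_add_cancel)

lemma perc_sh: "perc (sh v \<eta>) n i \<longleftrightarrow> perc \<eta> (n + fst v) (i + snd v)"
  by (simp add: perc_def conn_sh ex_shift_int[of "\<lambda>j. conn \<eta> _ _ _ j"])

lemma step_sh: "step (sh v \<eta>) n i j \<longleftrightarrow> step \<eta> (n + fst v) (i + snd v) (j + snd v)"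
  by (auto simp: step_def sh_def)

lemma opath_sh:
  "opath (sh v \<eta>) n (\<lambda>k. h (k + fst v) - snd v) \<longleftrightarrow> opath \<eta> (n + fst v) h"
proof -
  have "(\<forall>k\<ge>n. step \<eta> (k + fst v) (h (k + fst v)) (h (Suc k + fst v))) \<longleftrightarrow>
        (\<forall>k\<ge>n + fst v. step \<eta> k (h k) (h (Suc k)))"
    (is "?L \<longleftrightarrow> ?R")
  proof
    assume l: ?L
    show ?R
    proof (intro allI impI)
      fix k assume "n + fst v \<le> k"
      then show "step \<eta> k (h k) (h (Suc k))" using l[rule_format, of "k - fst v"] by simp
    qed
  qed simp
  then show ?thesis by (simp add: opath_def step_sh)
qed

lemma rpath_sh: "rpath (sh v \<eta>) n i k = rpath \<eta> (n + fst v) (i + snd v) (k + fst v) - snd v"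
proof (induction k)
  case 0
  then show ?case by (simp add: rpath_start)
next
  case (Suc k)
  then show ?case by (auto simp: perc_sh) (auto simp: sh_def algebra_simps)
qed

lemma sh_sh: "sh v (sh w \<eta>) = sh (v + w) \<eta>"
  by (auto simp: sh_def fun_eq_iff algebra_simps)

lemma mir_apply: "mir \<eta> (n, i, b) = \<eta> (n, int n - i, \<not> b)"
  by (simp add: mir_def)

lemma conn_mir:
  "conn (mir \<eta>) k n i j \<longleftrightarrow> conn \<eta> k n (int n - i) (int n + int k - j)"
proof (induction k arbitrary: n i)
  case (Suc k)
  have "int (Suc n) - (i + 1) = int n - i" "int (Suc n) - i = int n - i + 1"
    "int (Suc n) + int k - j = int n + int (Suc k) - j" by auto
  then show ?case by (auto simp only: Suc.IH mir_apply conn.simps simp_thms)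
qed auto

lemma perc_mir: "perc (mir \<eta>) n i \<longleftrightarrow> perc \<eta> n (int n - i)"
proof -
  have "(\<exists>j. conn \<eta> k n a (int n + int k - j)) \<longleftrightarrow> (\<exists>j. conn \<eta> k n a j)" for k a
  proof
    assume "\<exists>j. conn \<eta> k n a j"
    then obtain j where "conn \<eta> k n a j" ..
    then have "conn \<eta> k n a (int n + int k - (int n + int k - j))" by simp
    then show "\<exists>j. conn \<eta> k n a (int n + int k - j)" by blast
  qed blast
  then show ?thesis by (simp add: perc_def conn_mir)
qed

lemma step_mir: "step (mir \<eta>) n i j \<longleftrightarrow> step \<eta> n (int n - i) (int (Suc n) - j)"
  by (auto simp: step_def mir_def)

lemma opath_mir: "opath (mir \<eta>) n h \<longleftrightarrow> opath \<eta> n (\<lambda>k. int k - h k)"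
  by (simp add: opath_def step_mir)

lemma mir_mir: "mir (mir \<eta>) = \<eta>"
  by (auto simp: mir_def fun_eq_iff)

lemma mir_sh_mir: "mir (sh (k, j) (mir \<eta>)) = sh (k, int k - j) \<eta>"
  by (auto simp: mir_def sh_def fun_eq_iff algebra_simps)

section \<open>Laws of large numbers for renewing functions\<close>

text \<open>\<open>g\<close> has constant conditional mean given \<open>\<Theta> x\<close>. This
  substitute for independence makes the limit of the averages a constant without ergodicity of
  \<open>\<Theta>\<close>, and it is stable under linear combinations and compositions.\<close>

definition renewing :: "'a measure \<Rightarrow> ('a \<Rightarrow> 'a) \<Rightarrow> ('a \<Rightarrow> real) \<Rightarrow> bool" where
  "renewing Q \<Theta> g \<longleftrightarrow> integrable Q g \<and>
     (\<forall>B\<in>sets Q. (\<integral>x. g x * indicator B (\<Theta> x) \<partial>Q) = measure Q B * (\<integral>x. g x \<partial>Q))"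

text \<open>The maximum of the partial sums with at most \<open>n\<close> terms along the orbit, the
  empty sum included, in the recursive form that compares \<open>x\<close> with
  \<open>\<Theta> x\<close>.\<close>

primrec drift_max :: "('a \<Rightarrow> 'a) \<Rightarrow> ('a \<Rightarrow> real) \<Rightarrow> nat \<Rightarrow> 'a \<Rightarrow> real" where
  "drift_max \<Theta> g 0 x = 0"
| "drift_max \<Theta> g (Suc n) x = max 0 (g x + drift_max \<Theta> g n (\<Theta> x))"

lemma drift_max_nonneg: "0 \<le> drift_max \<Theta> g n x"
  by (cases n) auto

lemma drift_max_Suc: "drift_max \<Theta> g n x \<le> drift_max \<Theta> g (Suc n) x"
proof (induction n arbitrary: x)
  case (Suc n)
  have "drift_max \<Theta> g (Suc n) x = max 0 (g x + drift_max \<Theta> g n (\<Theta> x))"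
    "drift_max \<Theta> g (Suc (Suc n)) x = max 0 (g x + drift_max \<Theta> g (Suc n) (\<Theta> x))"
    by (simp_all only: drift_max.simps)
  then show ?case using Suc[of "\<Theta> x"] by linarith
qed simp

lemma drift_max_mono: "n \<le> m \<Longrightarrow> drift_max \<Theta> g n x \<le> drift_max \<Theta> g m x"
  by (rule lift_Suc_mono_le[of "\<lambda>n. drift_max \<Theta> g n x", OF drift_max_Suc])

lemma sum_le_drift_max: "(\<Sum>i<n. g ((\<Theta> ^^ i) x)) \<le> drift_max \<Theta> g n x"
proof (induction n arbitrary: x)
  case (Suc n)
  have "(\<Sum>i<Suc n. g ((\<Theta> ^^ i) x)) = g x + (\<Sum>i<n. g ((\<Theta> ^^ i) (\<Theta> x)))"
    by (subst sum.lessThan_Suc_shift) (simp add: funpow_swap1)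
  then show ?case using Suc[of "\<Theta> x"] by simp
qed simp

text \<open>Garsia's proof of the maximal ergodic theorem: on the invariant event \<open>A\<close> where the maxima of
  the partial sums are unbounded, the increments of the maxima have nonnegative mean and converge
  to \<open>g\<close>.\<close>

lemma partial_sums_bounded_above:
  assumes "prob_space Q" and \<Theta>[measurable]: "\<Theta> \<in> measurable Q Q" and inv: "distr Q Q \<Theta> = Q"
    and ren: "renewing Q \<Theta> g" and neg: "(\<integral>x. g x \<partial>Q) < 0"
  shows "AE x in Q. \<exists>C. \<forall>n. (\<Sum>i<n. g ((\<Theta> ^^ i) x)) \<le> C"
proof -
  interpret prob_space Q by fact
  have ig: "integrable Q g" using ren by (simp add: renewing_def)
  then have mg[measurable]: "g \<in> borel_measurable Q" by (rule borel_measurable_integrable)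
  let ?M = "drift_max \<Theta> g"
  have iM: "integrable Q (?M n)" for n
  proof (induction n)
    case 0
    have "?M 0 = (\<lambda>_. 0)" by auto
    then show ?case by simp
  next
    case (Suc n)
    have "integrable (distr Q Q \<Theta>) (?M n)" using Suc by (simp only: inv)
    then have "integrable Q (\<lambda>x. ?M n (\<Theta> x))" by (rule integrable_distr[OF \<Theta>])
    then have "integrable Q (\<lambda>x. max 0 (g x + ?M n (\<Theta> x)))" using ig by simp
    then show ?case by (simp only: drift_max.simps)
  qed
  then have mM[measurable]: "?M n \<in> borel_measurable Q" for n by (rule borel_measurable_integrable)
  have iM\<Theta>: "integrable Q (\<lambda>x. ?M n (\<Theta> x))" for n
    using integrable_distr[OF \<Theta>, of "?M n"] iM by (simp only: inv)
  define A where "A = {x \<in> space Q. \<forall>c::nat. \<exists>n. ?M n x > real c}"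
  have A[measurable]: "A \<in> sets Q" unfolding A_def by measurable
  have A\<Theta>: "\<Theta> x \<in> A \<longleftrightarrow> x \<in> A" if x: "x \<in> space Q" for x
  proof -
    have sp: "\<Theta> x \<in> space Q" using x \<Theta> by (rule measurable_space[rotated])
    have "x \<in> A" if a: "\<Theta> x \<in> A"
      unfolding A_def
    proof (intro CollectI conjI allI)
      fix c :: nat
      obtain n where n: "?M n (\<Theta> x) > real (c + nat \<lceil>\<bar>g x\<bar>\<rceil>)" using a unfolding A_def by blast
      have "real (nat \<lceil>\<bar>g x\<bar>\<rceil>) \<ge> \<bar>g x\<bar>" by linarith
      then have "g x + ?M n (\<Theta> x) > real c" using n by linarith
      then have "?M (Suc n) x > real c" by simp
      then show "\<exists>n. ?M n x > real c" by blast
    qed (rule x)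
    moreover have "\<Theta> x \<in> A" if "x \<in> A"
      unfolding A_def
    proof (intro CollectI conjI allI)
      fix c :: nat
      obtain n where n: "?M n x > real (c + nat \<lceil>\<bar>g x\<bar>\<rceil>)" using \<open>x \<in> A\<close> unfolding A_def by blast
      have "n \<noteq> 0"
      proof
        assume "n = 0"
        then have "real (c + nat \<lceil>\<bar>g x\<bar>\<rceil>) < 0" using n by (simp only: drift_max.simps)
        then show False by linarith
      qed
      then obtain m where m: "n = Suc m" using not0_implies_Suc by blast
      have "real (nat \<lceil>\<bar>g x\<bar>\<rceil>) \<ge> \<bar>g x\<bar>" by linarith
      then have "?M m (\<Theta> x) > real c" using n unfolding m drift_max.simps by linarith
      then show "\<exists>n. ?M n (\<Theta> x) > real c" by blast
    qed (rule sp)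
    ultimately show ?thesis by blast
  qed
  \<comment> \<open>On \<open>A\<close> this is the larger of \<open>g x\<close> and
    \<open>- ?M n (\<Theta> x)\<close>. Its absolute value is thus at most that of
    \<open>g x\<close>, which gives the dominating function.\<close>
  define f where "f n x = indicator A x * (?M (Suc n) x - ?M n (\<Theta> x))" for n x
  have f_int: "(\<integral>x. f n x \<partial>Q) \<ge> 0" for n
  proof -
    have *: "integrable Q (\<lambda>x. indicator A x * ?M k x)" for k
      by (rule Bochner_Integration.integrable_bound[OF iM[of k]]) (auto simp: indicator_def)
    have **: "integrable Q (\<lambda>x. indicator A x * ?M k (\<Theta> x))" for k
      by (rule Bochner_Integration.integrable_bound[OF iM\<Theta>[of k]]) (auto simp: indicator_def)
    have "(\<integral>x. indicator A x * ?M n x \<partial>Q) = (\<integral>x. indicator A x * ?M n x \<partial>distr Q Q \<Theta>)"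
      by (simp add: inv)
    also have "\<dots> = (\<integral>x. indicator A (\<Theta> x) * ?M n (\<Theta> x) \<partial>Q)"
      by (rule integral_distr) measurable
    also have "\<dots> = (\<integral>x. indicator A x * ?M n (\<Theta> x) \<partial>Q)"
      using A\<Theta> by (intro Bochner_Integration.integral_cong) (auto simp: indicator_def)
    finally have e: "(\<integral>x. indicator A x * ?M n x \<partial>Q) = (\<integral>x. indicator A x * ?M n (\<Theta> x) \<partial>Q)" .
    have "(\<integral>x. f n x \<partial>Q) = (\<integral>x. indicator A x * ?M (Suc n) x - indicator A x * ?M n (\<Theta> x) \<partial>Q)"
      unfolding f_def by (simp add: algebra_simps)
    also have "\<dots> = (\<integral>x. indicator A x * ?M (Suc n) x \<partial>Q) - (\<integral>x. indicator A x * ?M n (\<Theta> x) \<partial>Q)"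
      by (rule Bochner_Integration.integral_diff[OF * **])
    also have "\<dots> = (\<integral>x. indicator A x * ?M (Suc n) x \<partial>Q) - (\<integral>x. indicator A x * ?M n x \<partial>Q)"
      by (simp add: e)
    also have "\<dots> \<ge> 0"
    proof -
      have "(\<integral>x. indicator A x * ?M n x \<partial>Q) \<le> (\<integral>x. indicator A x * ?M (Suc n) x \<partial>Q)"
        using * drift_max_Suc by (intro integral_mono) (auto intro!: mult_left_mono simp del: drift_max.simps)
      then show ?thesis by simp
    qed
    finally show ?thesis .
  qed
  have "(\<lambda>n. \<integral>x. f n x \<partial>Q) \<longlonglongrightarrow> (\<integral>x. indicator A x * g x \<partial>Q)"
  proof (rule integral_dominated_convergence[where w="\<lambda>x. \<bar>g x\<bar>"])
    show "AE x in Q. (\<lambda>n. f n x) \<longlonglongrightarrow> indicator A x * g x"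
    proof (intro AE_I2)
      fix x assume x: "x \<in> space Q"
      show "(\<lambda>n. f n x) \<longlonglongrightarrow> indicator A x * g x"
      proof (cases "x \<in> A")
        case True
        then have "\<Theta> x \<in> A" using A\<Theta>[OF x] by simp
        then obtain N where N: "?M N (\<Theta> x) > real (nat \<lceil>\<bar>g x\<bar>\<rceil>)" unfolding A_def by blast
        have ceil: "real (nat \<lceil>\<bar>g x\<bar>\<rceil>) \<ge> \<bar>g x\<bar>" by linarith
        have "eventually (\<lambda>n. f n x = indicator A x * g x) sequentially"
        proof (rule eventually_sequentiallyI)
          fix n assume "N \<le> n"
          then have "?M N (\<Theta> x) \<le> ?M n (\<Theta> x)" by (rule drift_max_mono)
          then have "0 \<le> g x + ?M n (\<Theta> x)" using N ceil by linarith
          then show "f n x = indicator A x * g x" by (simp add: f_def)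
        qed
        then show ?thesis by (rule tendsto_eventually)
      qed (simp add: f_def)
    qed
    show "AE x in Q. norm (f n x) \<le> \<bar>g x\<bar>" for n
      using drift_max_nonneg[of \<Theta> g n] by (intro AE_I2) (auto simp: f_def indicator_def max_def)
  qed (use ig in \<open>auto simp: f_def[abs_def]\<close>)
  then have "0 \<le> (\<integral>x. indicator A x * g x \<partial>Q)"
    by (rule LIMSEQ_le_const) (use f_int in auto)
  \<comment> \<open>Invariance of \<open>A\<close> moves the indicator to \<open>\<Theta> x\<close>,
    where \<open>renewing\<close> factorizes the integral. As the mean of \<open>g\<close> is
    negative, \<open>A\<close> must be a null event.\<close>
  also have "\<dots> = (\<integral>x. g x * indicator A (\<Theta> x) \<partial>Q)"
    using A\<Theta> by (intro Bochner_Integration.integral_cong) (auto simp: indicator_def)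
  also have "\<dots> = measure Q A * (\<integral>x. g x \<partial>Q)" using ren A by (simp add: renewing_def)
  finally have "prob A = 0" using neg measure_nonneg[of Q A]
    by (smt (verit, best) mult_pos_neg)
  then have "AE x in Q. x \<notin> A" using prob_eq_0[OF A] by simp
  with AE_space show ?thesis
  proof eventually_elim
    case (elim x)
    then obtain c :: nat where "\<And>n. ?M n x \<le> real c" unfolding A_def by (auto simp: not_less)
    then show ?case using sum_le_drift_max order_trans by metis
  qed
qed

lemma renewing_const: "prob_space Q \<Longrightarrow> \<Theta> \<in> measurable Q Q \<Longrightarrow> distr Q Q \<Theta> = Q \<Longrightarrow> renewing Q \<Theta> (\<lambda>_. c)"
proof -
  assume Q: "prob_space Q" and \<Theta>[measurable]: "\<Theta> \<in> measurable Q Q" and inv: "distr Q Q \<Theta> = Q"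
  interpret prob_space Q by fact
  have "(\<integral>x. c * indicator B (\<Theta> x) \<partial>Q) = measure Q B * c" if [measurable]: "B \<in> sets Q" for B
  proof -
    have "(\<integral>x. indicator B x \<partial>distr Q Q \<Theta>) = (\<integral>x. indicator B (\<Theta> x) \<partial>Q :: real)"
      by (rule integral_distr) measurable
    then have "(\<integral>x. indicator B (\<Theta> x) \<partial>Q) = (\<integral>x. indicator B x \<partial>Q :: real)" by (simp only: inv)
    also have "\<dots> = measure Q B" by simp
    finally have "(\<integral>x. indicator B (\<Theta> x) \<partial>Q) = measure Q B" .
    then show ?thesis by simp
  qed
  then show ?thesis by (simp add: renewing_def prob_space)
qed

lemma renewing_lincomb:
  assumes f: "renewing Q \<Theta> f" and g: "renewing Q \<Theta> g" and \<Theta>[measurable]: "\<Theta> \<in> measurable Q Q"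
  shows "renewing Q \<Theta> (\<lambda>x. a * f x + b * g x)"
proof -
  have i: "integrable Q f" "integrable Q g" using f g by (auto simp: renewing_def)
  then have [measurable]: "f \<in> borel_measurable Q" "g \<in> borel_measurable Q" by auto
  have "(\<integral>x. (a * f x + b * g x) * indicator B (\<Theta> x) \<partial>Q) = measure Q B * (\<integral>x. a * f x + b * g x \<partial>Q)"
    if B[measurable]: "B \<in> sets Q" for B
  proof -
    have "integrable Q (\<lambda>x. f x * indicator B (\<Theta> x))" "integrable Q (\<lambda>x. g x * indicator B (\<Theta> x))"
      by (rule Bochner_Integration.integrable_bound[OF i(1)] Bochner_Integration.integrable_bound[OF i(2)],
          auto simp: indicator_def)+
    then have "(\<integral>x. a * (f x * indicator B (\<Theta> x)) + b * (g x * indicator B (\<Theta> x)) \<partial>Q) =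
      a * (\<integral>x. f x * indicator B (\<Theta> x) \<partial>Q) + b * (\<integral>x. g x * indicator B (\<Theta> x) \<partial>Q)"
      by simp
    then show ?thesis using f g B i by (simp add: renewing_def algebra_simps)
  qed
  then show ?thesis using i by (simp add: renewing_def)
qed

text \<open>After centring, \<open>g\<close> and \<open>- g\<close> minus \<open>1 / (k + 1)\<close>
  have negative mean, so their partial sums are bounded above. This confines the averages to within
  \<open>1 / (k + 1)\<close> of the mean, up to an error of order \<open>1 / n\<close>; countably
  many \<open>k\<close> share one null set.\<close>

lemma renewing_average:
  assumes Q: "prob_space Q" and \<Theta>[measurable]: "\<Theta> \<in> measurable Q Q" and inv: "distr Q Q \<Theta> = Q"
    and ren: "renewing Q \<Theta> g"
  shows "AE x in Q. (\<lambda>n. (\<Sum>i<n. g ((\<Theta> ^^ i) x)) / real n) \<longlonglongrightarrow> (\<integral>x. g x \<partial>Q)"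
proof -
  interpret prob_space Q by fact
  let ?m = "\<integral>x. g x \<partial>Q"
  have ig: "integrable Q g" using ren by (simp add: renewing_def)
  have ub: "AE x in Q. \<forall>k::nat. \<exists>C. \<forall>n. (\<Sum>i<n. s * g ((\<Theta> ^^ i) x) + (- s * ?m - 1 / real (Suc k)) * 1) \<le> C" for s
    unfolding AE_all_countable
  proof
    fix k :: nat
    show "AE x in Q. \<exists>C. \<forall>n. (\<Sum>i<n. s * g ((\<Theta> ^^ i) x) + (- s * ?m - 1 / real (Suc k)) * 1) \<le> C"
      using ig prob_space
      by (intro partial_sums_bounded_above[OF Q \<Theta> inv renewing_lincomb[OF ren renewing_const[OF Q \<Theta> inv] \<Theta>]])
        (simp add: field_simps)
  qed
  show ?thesis using ub[of 1] ub[of "-1"]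
  proof eventually_elim
    case (elim x)
    let ?S = "\<lambda>n. \<Sum>i<n. g ((\<Theta> ^^ i) x)"
    show ?case
    proof (rule LIMSEQ_I)
      fix e :: real assume e: "e > 0"
      obtain k where k: "1 / real (Suc k) < e / 2" using nat_approx_posE[of "e / 2"] e by auto
      define K where "K = 1 / real (Suc k)"
      obtain C where C: "\<And>n. ?S n + real n * (- ?m - K) \<le> C"
        using elim(1)[rule_format, of k] by (auto simp: sum.distrib K_def)
      obtain D where D: "\<And>n. - ?S n + real n * (?m - K) \<le> D"
      proof -
        obtain D where "\<forall>n. (\<Sum>i<n. - 1 * g ((\<Theta> ^^ i) x) + (- (- 1) * ?m - 1 / real (Suc k)) * 1) \<le> D"
          using elim(2) by blast
        then have "- ?S n + real n * (?m - K) \<le> D" for n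
          unfolding K_def by (simp only: sum.distrib sum_constant sum_distrib_left[symmetric]) simp
        then show ?thesis using that by blast
      qed
      obtain N0 :: nat where N0: "2 * (\<bar>C\<bar> + \<bar>D\<bar>) / e < real N0" using reals_Archimedean2 by blast
      define N where "N = Suc N0"
      have N: "real N > 2 * (\<bar>C\<bar> + \<bar>D\<bar>) / e" "N > 0" using N0 by (auto simp: N_def)
      have "norm (?S n / real n - ?m) < e" if n: "n \<ge> N" for n
      proof -
        have n0: "real n > 0" using n N by simp
        have "2 * (\<bar>C\<bar> + \<bar>D\<bar>) / e < real n" using N n by linarith
        then have b: "\<bar>C\<bar> + \<bar>D\<bar> < real n * (e / 2)" using e by (simp add: field_simps)
        have "real n * K \<le> real n * (e / 2)" using k by (intro mult_left_mono) (auto simp: K_def)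
        moreover have "real n * (e / 2) = e * real n / 2" by simp
        moreover have "?S n - real n * ?m - real n * K \<le> C"
          using C[of n] by (simp add: right_diff_distrib)
        moreover have "real n * ?m - ?S n - real n * K \<le> D"
          using D[of n] by (simp add: right_diff_distrib)
        ultimately have "\<bar>?S n - real n * ?m\<bar> < e * real n" using b by linarith
        moreover have "?S n / real n - ?m = (?S n - real n * ?m) / real n" using n0 by (simp add: field_simps)
        ultimately show ?thesis using n0 by (simp add: abs_divide pos_divide_less_eq)
      qed
      then show "\<exists>N. \<forall>n\<ge>N. norm (?S n / real n - ?m) < e" by blast
    qed
  qed
qed

section \<open>The product measure on configurations\<close>

definition P0 :: "real \<Rightarrow> config measure" where
  "P0 p = (\<Pi>\<^sub>M e\<in>UNIV. measure_pmf (bernoulli_pmf p))"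

lemma prob_space_P0: "prob_space (P0 p)"
  unfolding P0_def by (intro prob_space_PiM measure_pmf.prob_space_axioms)

lemma space_P0[simp]: "space (P0 p) = UNIV"
  by (simp add: P0_def space_PiM PiE_UNIV_domain)

lemma measurable_coord[measurable]: "(\<lambda>\<eta>. \<eta> e) \<in> measurable (P0 p) (count_space UNIV)"
proof -
  have "(\<lambda>\<eta>. \<eta> e) \<in> measurable (P0 p) (measure_pmf (bernoulli_pmf p))"
    unfolding P0_def by (rule measurable_component_singleton) simp
  then show ?thesis by (simp cong: measurable_cong_sets)
qed

lemma measurable_conn[measurable]: "Measurable.pred (P0 p) (\<lambda>\<eta>. conn \<eta> k n i j)"
  by (induction k arbitrary: n i) simp_all

lemma measurable_perc[measurable]: "Measurable.pred (P0 p) (\<lambda>\<eta>. perc \<eta> n i)"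
  unfolding perc_def by measurable

lemma measurable_rpath[measurable]: "(\<lambda>\<eta>. rpath \<eta> n i k) \<in> measurable (P0 p) (count_space UNIV)"
proof -
  have "Measurable.pred (P0 p) (\<lambda>\<eta>. rpath \<eta> n i k = j)" for j
  proof (induction k arbitrary: j)
    case (Suc k)
    note [measurable] = Suc
    have "rpath \<eta> n i (Suc k) = j \<longleftrightarrow> (\<exists>m. rpath \<eta> n i k = m \<and>
      ((n \<le> k \<and> \<eta> (k, m, True) \<and> perc \<eta> (Suc k) (m + 1)) \<and> j = m + 1 \<or>
       \<not> (n \<le> k \<and> \<eta> (k, m, True) \<and> perc \<eta> (Suc k) (m + 1)) \<and> j = m))" for \<eta>
      by auto
    then show ?case by (simp only:) measurable
  qed simp
  then show ?thesis
    by (subst measurable_count_space_eq2_countable) (auto simp: pred_def vimage_def)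
qed

lemma distr_P0_reindex:
  assumes "inj f"
  shows "distr (P0 p) (P0 p) (\<lambda>\<eta> e. \<eta> (f e)) = P0 p"
  using distr_PiM_reindex[of UNIV "\<lambda>_. measure_pmf (bernoulli_pmf p)" f UNIV] assms
  by (simp add: P0_def measure_pmf.prob_space_axioms restrict_UNIV)

lemma measurable_reindex: "(\<lambda>\<eta> e. \<eta> (f e)) \<in> measurable (P0 p) (P0 p)"
  unfolding P0_def
  by (rule measurable_PiM_single'[OF measurable_component_singleton[of _ _ "\<lambda>_. measure_pmf (bernoulli_pmf p)"]])
    (auto simp: space_PiM)

lemma sh_eq_reindex: "sh v = (\<lambda>\<eta> e. \<eta> ((\<lambda>(n, i, b). (n + fst v, i + snd v, b)) e))"
  by (auto simp: sh_def fun_eq_iff)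

lemma mir_eq_reindex: "mir = (\<lambda>\<eta> e. \<eta> ((\<lambda>(n, i, b). (n, int n - i, \<not> b)) e))"
  by (auto simp: mir_def fun_eq_iff)

lemma measurable_sh[measurable]: "sh v \<in> measurable (P0 p) (P0 p)"
  unfolding sh_eq_reindex by (rule measurable_reindex)

lemma measurable_mir[measurable]: "mir \<in> measurable (P0 p) (P0 p)"
  unfolding mir_eq_reindex by (rule measurable_reindex)

lemma distr_sh: "distr (P0 p) (P0 p) (sh v) = P0 p"
  unfolding sh_eq_reindex by (rule distr_P0_reindex) (auto simp: inj_def)

lemma distr_mir: "distr (P0 p) (P0 p) mir = P0 p"
  unfolding mir_eq_reindex by (rule distr_P0_reindex) (auto simp: inj_def)

lemma measure_sh:
  assumes [measurable]: "Measurable.pred (P0 p) E"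
  shows "measure (P0 p) {\<eta>. E (sh v \<eta>)} = measure (P0 p) {\<eta>. E \<eta>}"
proof -
  have "measure (distr (P0 p) (P0 p) (sh v)) {\<eta>. E \<eta>} = measure (P0 p) (sh v -` {\<eta>. E \<eta>} \<inter> space (P0 p))"
    using assms by (intro measure_distr) (auto simp: pred_def)
  then show ?thesis by (simp add: distr_sh vimage_def)
qed

lemma AE_sh: "AE \<eta> in P0 p. E \<eta> \<Longrightarrow> AE \<eta> in P0 p. E (sh v \<eta>)"
  by (rule AE_distrD[OF measurable_sh[of v p]]) (simp only: distr_sh)

lemma AE_mir: "AE \<eta> in P0 p. E \<eta> \<Longrightarrow> AE \<eta> in P0 p. E (mir \<eta>)"
  by (rule AE_distrD[OF measurable_mir[of p]]) (simp only: distr_mir)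

lemma indep_vars_P0:
  "prob_space.indep_vars (P0 p) (\<lambda>_. measure_pmf (bernoulli_pmf p)) (\<lambda>e \<eta>. \<eta> e) UNIV"
proof -
  interpret prob_space "P0 p" by (rule prob_space_P0)
  have rv: "random_variable (measure_pmf (bernoulli_pmf p)) (\<lambda>\<eta>. \<eta> e)" for e
    unfolding P0_def by (rule measurable_component_singleton) simp
  have "distr (P0 p) (measure_pmf (bernoulli_pmf p)) (\<lambda>\<eta>. \<eta> e) = measure_pmf (bernoulli_pmf p)" for e
    unfolding P0_def by (rule distr_PiM_component) (auto intro: measure_pmf.prob_space_axioms)
  then have "distr (P0 p) (\<Pi>\<^sub>M i\<in>UNIV. measure_pmf (bernoulli_pmf p)) (\<lambda>x. \<lambda>i\<in>UNIV. x i) =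
    (\<Pi>\<^sub>M e\<in>UNIV. distr (P0 p) (measure_pmf (bernoulli_pmf p)) (\<lambda>\<eta>. \<eta> e))"
    by (simp add: restrict_UNIV P0_def[symmetric] distr_id)
  then show ?thesis by (subst indep_vars_iff_distr_eq_PiM) (use rv in auto)
qed

text \<open>That an event depends only on a set of edges is expressed by its invariance under
  changes of all other edges, a form in which it can be checked by unfolding.\<close>

lemma measure_indep:
  assumes E[measurable]: "Measurable.pred (P0 p) E" and F[measurable]: "Measurable.pred (P0 p) F"
    and A: "\<And>\<eta> \<eta>'. (\<And>e. e \<in> A \<Longrightarrow> \<eta> e = \<eta>' e) \<Longrightarrow> E \<eta> = E \<eta>'"
    and B: "\<And>\<eta> \<eta>'. (\<And>e. e \<in> B \<Longrightarrow> \<eta> e = \<eta>' e) \<Longrightarrow> F \<eta> = F \<eta>'"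
    and AB: "A \<inter> B = {}"
  shows "measure (P0 p) {\<eta>. E \<eta> \<and> F \<eta>} = measure (P0 p) {\<eta>. E \<eta>} * measure (P0 p) {\<eta>. F \<eta>}"
proof -
  interpret prob_space "P0 p" by (rule prob_space_P0)
  let ?M = "\<lambda>_::nat \<times> int \<times> bool. measure_pmf (bernoulli_pmf p)"
  \<comment> \<open>Completing a partial configuration by closed edges turns each event into a
    function of the restriction to its edge set, and restrictions to disjoint sets are
    independent.\<close>
  define ext where "ext = (\<lambda>(A::(nat \<times> int \<times> bool) set) \<zeta> e. if e \<in> A then \<zeta> e else False)"
  have ext[measurable]: "ext C \<in> measurable (PiM C ?M) (P0 p)" for C
    unfolding P0_def
  proof (rule measurable_PiM_single')
    fix e :: "nat \<times> int \<times> bool"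
    show "(\<lambda>\<zeta>. ext C \<zeta> e) \<in> measurable (PiM C ?M) (?M e)"
    proof (cases "e \<in> C")
      case True
      then have "(\<lambda>\<zeta>. ext C \<zeta> e) = (\<lambda>\<zeta>. \<zeta> e)" by (auto simp: ext_def)
      then show ?thesis using measurable_component_singleton[OF True, of ?M] by metis
    next
      case False
      then have "(\<lambda>\<zeta>. ext C \<zeta> e) = (\<lambda>\<zeta>. False)" by (auto simp: ext_def)
      then show ?thesis by simp
    qed
  qed (auto simp: space_PiM)
  have EA: "E (ext A (restrict \<eta> A)) = E \<eta>" and FB: "F (ext B (restrict \<eta> B)) = F \<eta>" for \<eta>
    by (auto intro!: A B simp: ext_def)
  have iv: "indep_var (PiM A ?M) (\<lambda>\<eta>. restrict (\<lambda>i. \<eta> i) A) (PiM B ?M) (\<lambda>\<eta>. restrict (\<lambda>i. \<eta> i) B)"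
    by (rule indep_var_restrict[OF indep_vars_P0 AB]) auto
  let ?E = "{\<zeta> \<in> space (PiM A ?M). E (ext A \<zeta>)}" and ?F = "{\<zeta> \<in> space (PiM B ?M). F (ext B \<zeta>)}"
  have sets: "?E \<in> sets (PiM A ?M)" "?F \<in> sets (PiM B ?M)" by measurable
  have sp: "restrict \<eta> C \<in> space (PiM C ?M)" for C \<eta> by (simp add: space_PiM)
  have "prob ((\<lambda>\<eta>. (restrict \<eta> A, restrict \<eta> B)) -` (?E \<times> ?F) \<inter> space (P0 p)) =
    prob ((\<lambda>\<eta>. restrict \<eta> A) -` ?E \<inter> space (P0 p)) * prob ((\<lambda>\<eta>. restrict \<eta> B) -` ?F \<inter> space (P0 p))"
    using indep_varD[OF iv sets] by simp
  then show ?thesis using sp by (simp add: vimage_def EA FB)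
qed

section \<open>Break points of the right edge\<close>

definition right_edge :: "config \<Rightarrow> nat \<Rightarrow> int \<Rightarrow> bool" where
  "right_edge \<eta> k a \<longleftrightarrow> conn \<eta> k 0 0 a \<and> (\<forall>j. conn \<eta> k 0 0 j \<longrightarrow> j \<le> a)"

definition first_break :: "config \<Rightarrow> nat \<times> int \<Rightarrow> bool" where
  "first_break \<eta> v \<longleftrightarrow> 1 \<le> fst v \<and> right_edge \<eta> (fst v) (snd v) \<and> perc \<eta> (fst v) (snd v) \<and>
     (\<forall>k a. 1 \<le> k \<and> k < fst v \<and> right_edge \<eta> k a \<longrightarrow> \<not> perc \<eta> k a)"

definition local_break :: "config \<Rightarrow> nat \<times> int \<Rightarrow> bool" where
  "local_break \<eta> v \<longleftrightarrow> 1 \<le> fst v \<and> right_edge \<eta> (fst v) (snd v) \<and>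
     (\<forall>k a. 1 \<le> k \<and> k < fst v \<and> right_edge \<eta> k a \<longrightarrow> \<not> conn \<eta> (fst v - k) k a (snd v))"

text \<open>The first break, if any, comes after level \<open>m\<close>. Percolation of the origin
  is included so that, applied to the configuration seen from a right edge, the event says that this
  site is a break and the last one for a while.\<close>

definition no_break :: "config \<Rightarrow> nat \<Rightarrow> bool" where
  "no_break \<eta> m \<longleftrightarrow> perc \<eta> 0 0 \<and> (\<forall>l a. 1 \<le> l \<and> l \<le> m \<and> right_edge \<eta> l a \<longrightarrow> \<not> perc \<eta> l a)"

text \<open>Without a break, an event of probability 0, the value \<open>(1, 0)\<close> is arbitrary.\<close>

definition break_step :: "config \<Rightarrow> nat \<times> int" where
  "break_step \<eta> = (if \<exists>v. first_break \<eta> v then SOME v. first_break \<eta> v else (1, 0))"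

lemma right_edge_unique: "right_edge \<eta> k a \<Longrightarrow> right_edge \<eta> k b \<Longrightarrow> a = b"
  by (auto simp: right_edge_def intro: antisym)

lemma right_edge_ex: "conn \<eta> k 0 0 j \<Longrightarrow> \<exists>a. right_edge \<eta> k a"
proof
  assume j: "conn \<eta> k 0 0 j"
  let ?S = "{j. conn \<eta> k 0 0 j}"
  have "Max ?S \<in> ?S" by (rule Max_in[OF finite_conn]) (use j in auto)
  moreover have "j \<le> Max ?S" if "conn \<eta> k 0 0 j" for j
    by (rule Max_ge[OF finite_conn]) (use that in auto)
  ultimately show "right_edge \<eta> k (Max ?S)" by (simp add: right_edge_def)
qed

lemma right_edge_bounds: "right_edge \<eta> k a \<Longrightarrow> 0 \<le> a \<and> a \<le> int k"
  using conn_bounds[of \<eta> k 0 0 a] by (auto simp: right_edge_def)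

lemma conn_sh0: "conn (sh (k, a) \<eta>) l 0 0 j \<longleftrightarrow> conn \<eta> l k a (j + a)"
  by (simp add: conn_sh)

lemma perc_sh0: "perc (sh (k, a) \<eta>) 0 0 \<longleftrightarrow> perc \<eta> k a"
  by (simp add: perc_sh)

text \<open>A connection that starts left of \<open>a\<close> and ends beyond the right edge of the
  cluster of \<open>a\<close> would cross a connection from \<open>a\<close>, and its end would
  belong to that cluster. So a percolating right edge takes over the role of the origin.\<close>

lemma right_edge_after:
  assumes a: "right_edge \<eta> k a" "perc \<eta> k a"
  shows "right_edge \<eta> (k + l) (c + a) \<longleftrightarrow> right_edge (sh (k, a) \<eta>) l c"
proof -
  obtain j where "conn \<eta> l k a j" using a(2)[unfolded perc_def, rule_format, of l] ..
  then have "conn (sh (k, a) \<eta>) l 0 0 (j - a)" by (simp add: conn_sh0)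
  then obtain b where b: "right_edge (sh (k, a) \<eta>) l b" using right_edge_ex by blast
  have "right_edge \<eta> (k + l) (b + a)"
    unfolding right_edge_def
  proof (intro conjI allI impI)
    have ba: "conn \<eta> l k a (b + a)" using b by (simp add: right_edge_def conn_sh0)
    moreover have "conn \<eta> k 0 0 a" using a(1) by (simp add: right_edge_def)
    ultimately show "conn \<eta> (k + l) 0 0 (b + a)" unfolding conn_add add_0 by blast
    fix y assume "conn \<eta> (k + l) 0 0 y"
    then obtain m where m: "conn \<eta> k 0 0 m" "conn \<eta> l k m y" unfolding conn_add add_0 by blast
    have ma: "m \<le> a" using m(1) a(1) by (simp add: right_edge_def)
    show "y \<le> b + a"
    proof (rule ccontr)
      assume c: "\<not> y \<le> b + a"
      then have "conn \<eta> l k a y" using conn_cross[OF m(2) ba ma] by simp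
      then have "conn (sh (k, a) \<eta>) l 0 0 (y - a)" by (simp add: conn_sh0)
      then have "y - a \<le> b" using b by (simp add: right_edge_def)
      then show False using c by simp
    qed
  qed
  note ba = this
  show ?thesis
  proof
    assume c: "right_edge \<eta> (k + l) (c + a)"
    have "c = b" using right_edge_unique[OF ba c] by simp
    then show "right_edge (sh (k, a) \<eta>) l c" using b by simp
  next
    assume c: "right_edge (sh (k, a) \<eta>) l c"
    have "c = b" using right_edge_unique[OF b c] by simp
    then show "right_edge \<eta> (k + l) (c + a)" using ba by simp
  qed
qed

text \<open>This separates the edges below the level of a first break from those above it.\<close>

lemma first_break_iff_local_break: "first_break \<eta> v \<longleftrightarrow> local_break \<eta> v \<and> perc \<eta> (fst v) (snd v)"
proof (intro iffI conjI)
  assume f: "first_break \<eta> v"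
  then show p: "perc \<eta> (fst v) (snd v)" by (simp add: first_break_def)
  have "\<not> conn \<eta> (fst v - k) k a (snd v)" if k: "1 \<le> k" "k < fst v" "right_edge \<eta> k a" for k a
  proof
    assume "conn \<eta> (fst v - k) k a (snd v)"
    moreover have "perc \<eta> (k + (fst v - k)) (snd v)" using p k by simp
    ultimately have "perc \<eta> k a" by (rule perc_conn)
    then show False using f k unfolding first_break_def by blast
  qed
  then show "local_break \<eta> v" using f unfolding first_break_def local_break_def by blast
next
  assume l: "local_break \<eta> v \<and> perc \<eta> (fst v) (snd v)"
  have "\<not> perc \<eta> k a" if k: "1 \<le> k" "k < fst v" "right_edge \<eta> k a" for k a
  proof
    assume p: "perc \<eta> k a"
    \<comment> \<open>A percolating earlier right edge would have \<open>v\<close> as a right edge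
      of its own cluster; this connection to \<open>v\<close> contradicts
      \<open>local_break\<close>.\<close>
    have "right_edge \<eta> (k + (fst v - k)) ((snd v - a) + a)" using l k by (simp add: local_break_def)
    then have "right_edge (sh (k, a) \<eta>) (fst v - k) (snd v - a)"
      using right_edge_after[OF k(3) p] by blast
    then have "conn \<eta> (fst v - k) k a (snd v)" by (simp add: right_edge_def conn_sh0)
    then show False using l k unfolding local_break_def by blast
  qed
  then show "first_break \<eta> v" using l unfolding first_break_def local_break_def by blast
qed

lemma first_break_perc: "first_break \<eta> v \<Longrightarrow> perc \<eta> 0 0"
  by (rule perc_conn[of \<eta> "fst v" 0 0 "snd v"]) (simp_all add: first_break_def right_edge_def)

lemma first_break_unique: "first_break \<eta> v \<Longrightarrow> first_break \<eta> w \<Longrightarrow> v = w"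
proof -
  assume v: "first_break \<eta> v" and w: "first_break \<eta> w"
  have lt: "\<not> fst v < fst w" if "first_break \<eta> v" "first_break \<eta> w" for v w
    using that unfolding first_break_def by blast
  have e: "fst v = fst w" using lt[OF v w] lt[OF w v] by simp
  then have "snd v = snd w"
    using v w right_edge_unique[of \<eta> "fst v" "snd v" "snd w"] by (simp add: first_break_def)
  with e show "v = w" by (rule prod_eqI)
qed

lemma break_step_eq: "break_step \<eta> = v \<longleftrightarrow> first_break \<eta> v \<or> (\<forall>w. \<not> first_break \<eta> w) \<and> v = (1, 0)"
proof (cases "\<exists>v. first_break \<eta> v")
  case True
  then obtain w where w: "first_break \<eta> w" by blast
  have iff: "first_break \<eta> v \<longleftrightarrow> w = v" for v
  proof
    assume "first_break \<eta> v"
    with w show "w = v" by (rule first_break_unique)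
  qed (use w in simp)
  then have "(SOME v. first_break \<eta> v) = w" by simp
  then have "break_step \<eta> = w" using True by (simp add: break_step_def)
  then show ?thesis using True by (simp add: iff)
next
  case False
  then show ?thesis unfolding break_step_def by (metis (full_types))
qed

lemma conn_cong:
  "(\<And>e. n \<le> fst e \<Longrightarrow> fst e < n + k \<Longrightarrow> \<eta> e = \<eta>' e) \<Longrightarrow> conn \<eta> k n i j = conn \<eta>' k n i j"
proof (induction k arbitrary: n i)
  case (Suc k)
  have "conn \<eta> k (Suc n) i j = conn \<eta>' k (Suc n) i j" for i by (rule Suc.IH) (use Suc.prems in auto)
  moreover have "\<eta> (n, i, b) = \<eta>' (n, i, b)" for b by (rule Suc.prems) auto
  ultimately show ?case by simp
qed simp

lemma right_edge_cong: "(\<And>e. fst e < k \<Longrightarrow> \<eta> e = \<eta>' e) \<Longrightarrow> right_edge \<eta> k a = right_edge \<eta>' k a"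
proof -
  assume e: "\<And>e. fst e < k \<Longrightarrow> \<eta> e = \<eta>' e"
  have "conn \<eta> k 0 0 j = conn \<eta>' k 0 0 j" for j by (rule conn_cong) (simp add: e)
  then show ?thesis by (simp add: right_edge_def)
qed

lemma local_break_cong:
  assumes "\<And>e. fst e < fst v \<Longrightarrow> \<eta> e = \<eta>' e"
  shows "local_break \<eta> v = local_break \<eta>' v"
proof -
  have "right_edge \<eta> k a = right_edge \<eta>' k a" if "k \<le> fst v" for k a
    by (rule right_edge_cong) (use assms that in auto)
  moreover have "conn \<eta> (fst v - k) k a (snd v) = conn \<eta>' (fst v - k) k a (snd v)" if "k \<le> fst v" for k a
    by (rule conn_cong) (use assms that in auto)
  ultimately show ?thesis unfolding local_break_def by auto
qed

lemma sh_cong: "(\<And>e. fst v \<le> fst e \<Longrightarrow> \<eta> e = \<eta>' e) \<Longrightarrow> sh v \<eta> = sh v \<eta>'"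
  by (auto simp: sh_def fun_eq_iff)

lemma measurable_right_edge[measurable]: "Measurable.pred (P0 p) (\<lambda>\<eta>. right_edge \<eta> k a)"
  unfolding right_edge_def by measurable

lemma measurable_first_break[measurable]: "Measurable.pred (P0 p) (\<lambda>\<eta>. first_break \<eta> v)"
  unfolding first_break_def by measurable

lemma measurable_local_break[measurable]: "Measurable.pred (P0 p) (\<lambda>\<eta>. local_break \<eta> v)"
  unfolding local_break_def by measurable

lemma measurable_no_break[measurable]: "Measurable.pred (P0 p) (\<lambda>\<eta>. no_break \<eta> m)"
  unfolding no_break_def by measurable

lemma measurable_break_step[measurable]: "break_step \<in> measurable (P0 p) (count_space UNIV)"
proof (subst measurable_count_space_eq2_countable, intro conjI ballI)
  fix v
  have "Measurable.pred (P0 p) (\<lambda>\<eta>. break_step \<eta> = v)" unfolding break_step_eq by measurable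
  then show "break_step -` {v} \<inter> space (P0 p) \<in> sets (P0 p)" by (simp add: pred_def vimage_def)
qed auto

lemma setsP: "Measurable.pred (P0 p) E \<Longrightarrow> {\<eta>. E \<eta>} \<in> sets (P0 p)"
  by (simp add: pred_def)

text \<open>The shifted configuration uses only edges from the level of \<open>v\<close> on, hence
  is independent of the past; stationarity then removes the shift.\<close>

lemma measure_past_future:
  assumes [measurable]: "Measurable.pred (P0 p) E" "Measurable.pred (P0 p) F"
    and E: "\<And>\<eta> \<eta>'. (\<And>e. fst e < fst v \<Longrightarrow> \<eta> e = \<eta>' e) \<Longrightarrow> E \<eta> = E \<eta>'"
  shows "measure (P0 p) {\<eta>. E \<eta> \<and> F (sh v \<eta>)} = measure (P0 p) {\<eta>. E \<eta>} * measure (P0 p) {\<eta>. F \<eta>}"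
proof -
  have "measure (P0 p) {\<eta>. E \<eta> \<and> F (sh v \<eta>)} = measure (P0 p) {\<eta>. E \<eta>} * measure (P0 p) {\<eta>. F (sh v \<eta>)}"
  proof (rule measure_indep[where A="{e. fst e < fst v}" and B="{e. fst v \<le> fst e}"])
    show "F (sh v \<eta>) = F (sh v \<eta>')" if "\<And>e. e \<in> {e. fst v \<le> fst e} \<Longrightarrow> \<eta> e = \<eta>' e" for \<eta> \<eta>'
      using sh_cong[of v \<eta> \<eta>'] that by simp
    show "E \<eta> = E \<eta>'" if "\<And>e. e \<in> {e. fst e < fst v} \<Longrightarrow> \<eta> e = \<eta>' e" for \<eta> \<eta>'
      by (rule E) (use that in simp)
    show "Measurable.pred (P0 p) (\<lambda>\<eta>. F (sh v \<eta>))" by measurable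
  qed auto
  then show ?thesis by (simp add: measure_sh)
qed

section \<open>The law conditioned on percolation from the origin\<close>

locale supercritical =
  fixes p :: real
  assumes survival: "measure (P0 p) {\<eta>. perc \<eta> 0 0} > 0"
begin

sublocale P: prob_space "P0 p" by (rule prob_space_P0)

abbreviation "\<rho> \<equiv> measure (P0 p) {\<eta>. perc \<eta> 0 0}"

definition Q :: "config measure" where
  "Q = uniform_measure (P0 p) {\<eta>. perc \<eta> 0 0}"

lemma sets_Q[simp, measurable_cong]: "sets Q = sets (P0 p)" by (simp add: Q_def)

lemma space_Q[simp]: "space Q = UNIV" by (simp add: Q_def)

lemma emeasure_perc: "emeasure (P0 p) {\<eta>. perc \<eta> 0 0} \<noteq> 0" "emeasure (P0 p) {\<eta>. perc \<eta> 0 0} \<noteq> \<infinity>"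
  using survival by (auto simp: measure_def)

lemma prob_space_Q: "prob_space Q"
  unfolding Q_def by (rule prob_space_uniform_measure[OF emeasure_perc])

sublocale Q: prob_space Q by (rule prob_space_Q)

lemma measure_Q:
  assumes "Measurable.pred (P0 p) E"
  shows "measure Q {\<eta>. E \<eta>} = measure (P0 p) {\<eta>. perc \<eta> 0 0 \<and> E \<eta>} / \<rho>"
  unfolding Q_def using measure_uniform_measure[OF emeasure_perc setsP[OF assms]]
  by (simp add: Int_def)

lemma AE_Q: "(AE \<eta> in Q. E \<eta>) \<longleftrightarrow> (AE \<eta> in P0 p. perc \<eta> 0 0 \<longrightarrow> E \<eta>)"
proof -
  have "emeasure (P0 p) {\<eta>. perc \<eta> 0 0} < \<infinity>"
    by (metis P.emeasure_finite less_top infinity_ennreal_def)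
  from AE_uniform_measure[OF emeasure_perc(1) this, of E] show ?thesis unfolding Q_def by simp
qed

text \<open>The events \<open>D k\<close> that the last break up to level \<open>n\<close> is at level \<open>k\<close> are disjoint.\<close>

lemma sum_no_break_le: "(\<Sum>m\<le>n. measure (P0 p) {\<eta>. no_break \<eta> m}) \<le> 1"
proof -
  define D where "D = (\<lambda>k. {\<eta>. \<exists>a\<in>{0..int k}. right_edge \<eta> k a \<and> no_break (sh (k, a) \<eta>) (n - k)})"
  have Dm: "D k \<in> sets (P0 p)" for k
    unfolding D_def by (rule setsP) measurable
  have decomp: "measure (P0 p) {\<eta>. \<exists>a\<in>{0..int k}. right_edge \<eta> k a \<and> E a \<eta>} =
      (\<Sum>a\<in>{0..int k}. measure (P0 p) {\<eta>. right_edge \<eta> k a \<and> E a \<eta>})"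
    if [measurable]: "\<And>a. Measurable.pred (P0 p) (E a)" for E k
  proof -
    have "{\<eta>. \<exists>a\<in>{0..int k}. right_edge \<eta> k a \<and> E a \<eta>} = (\<Union>a\<in>{0..int k}. {\<eta>. right_edge \<eta> k a \<and> E a \<eta>})"
      by blast
    moreover have "disjoint_family_on (\<lambda>a. {\<eta>. right_edge \<eta> k a \<and> E a \<eta>}) {0..int k}"
      unfolding disjoint_family_on_def using right_edge_unique by blast
    moreover have "{\<eta>. right_edge \<eta> k a \<and> E a \<eta>} \<in> sets (P0 p)" for a by (rule setsP) measurable
    ultimately show ?thesis by (simp add: P.finite_measure_finite_Union image_subset_iff)
  qed
  \<comment> \<open>The position of the right edge at level \<open>k\<close> is independent of the
    configuration above. The factor \<open>\<rho>\<close> bounds the probability that level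
    \<open>k\<close> is reached at all.\<close>
  have D: "measure (P0 p) (D k) \<ge> \<rho> * measure (P0 p) {\<eta>. no_break \<eta> (n - k)}" for k
  proof -
    have "measure (P0 p) (D k) = (\<Sum>a\<in>{0..int k}. measure (P0 p) {\<eta>. right_edge \<eta> k a \<and> no_break (sh (k, a) \<eta>) (n - k)})"
      unfolding D_def by (rule decomp) measurable
    also have "\<dots> = (\<Sum>a\<in>{0..int k}. measure (P0 p) {\<eta>. right_edge \<eta> k a} * measure (P0 p) {\<eta>. no_break \<eta> (n - k)})"
    proof (intro sum.cong refl measure_past_future)
      show "right_edge \<eta> k a = right_edge \<eta>' k a" if "\<And>e. fst e < fst (k, a) \<Longrightarrow> \<eta> e = \<eta>' e" for a \<eta> \<eta>'
        by (rule right_edge_cong) (use that in simp)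
    qed measurable
    also have "\<dots> = measure (P0 p) {\<eta>. \<exists>a\<in>{0..int k}. right_edge \<eta> k a \<and> True} * measure (P0 p) {\<eta>. no_break \<eta> (n - k)}"
      by (subst decomp) (auto simp: sum_distrib_right)
    also have "\<dots> \<ge> \<rho> * measure (P0 p) {\<eta>. no_break \<eta> (n - k)}"
    proof (intro mult_right_mono P.finite_measure_mono)
      show "{\<eta>. perc \<eta> 0 0} \<subseteq> {\<eta>. \<exists>a\<in>{0..int k}. right_edge \<eta> k a \<and> True}"
      proof (intro Collect_mono impI)
        fix \<eta> assume "perc \<eta> 0 0"
        then obtain j where "conn \<eta> k 0 0 j" unfolding perc_def by blast
        then obtain a where "right_edge \<eta> k a" using right_edge_ex by blast
        then show "\<exists>a\<in>{0..int k}. right_edge \<eta> k a \<and> True" using right_edge_bounds[of \<eta> k a] by auto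
      qed
      show "{\<eta>. \<exists>a\<in>{0..int k}. right_edge \<eta> k a \<and> True} \<in> sets (P0 p)" by (rule setsP) measurable
    qed simp
    finally show ?thesis .
  qed
  have disj: "disjoint_family_on D {..n}"
    unfolding disjoint_family_on_def
  proof (intro ballI impI)
    \<comment> \<open>A break at the later level \<open>k'\<close> would be a break, at level
      \<open>k' - k\<close>, of the configuration seen from \<open>(k, a)\<close>, which has none up
      to level \<open>n - k\<close>.\<close>
    have *: "D k \<inter> D k' = {}" if "k < k'" "k' \<le> n" for k k'
    proof (rule ccontr)
      assume "D k \<inter> D k' \<noteq> {}"
      then obtain \<eta> a a' where a: "right_edge \<eta> k a" "no_break (sh (k, a) \<eta>) (n - k)"
        and a': "right_edge \<eta> k' a'" "no_break (sh (k', a') \<eta>) (n - k')" unfolding D_def by blast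
      have p: "perc \<eta> k a" "perc \<eta> k' a'" using a a' by (auto simp: no_break_def perc_sh0)
      have "right_edge \<eta> (k + (k' - k)) ((a' - a) + a)" using a'(1) that by simp
      then have "right_edge (sh (k, a) \<eta>) (k' - k) (a' - a)" using right_edge_after[OF a(1) p(1)] by blast
      moreover have "perc (sh (k, a) \<eta>) (k' - k) (a' - a)" using p(2) that by (simp add: perc_sh)
      ultimately show False using a(2) that unfolding no_break_def by (metis Suc_leI diff_le_mono One_nat_def zero_less_diff)
    qed
    show "D k \<inter> D k' = {}" if "k \<in> {..n}" "k' \<in> {..n}" "k \<noteq> k'" for k k'
      using *[of k k'] *[of k' k] that by (cases "k < k'") auto
  qed
  have "(\<Sum>m\<le>n. \<rho> * measure (P0 p) {\<eta>. no_break \<eta> m}) = (\<Sum>k\<le>n. \<rho> * measure (P0 p) {\<eta>. no_break \<eta> (n - k)})"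
    by (rule sum.reindex_bij_witness[of _ "\<lambda>k. n - k" "\<lambda>k. n - k"]) auto
  also have "\<dots> \<le> (\<Sum>k\<le>n. measure (P0 p) (D k))" by (rule sum_mono) (rule D)
  also have "\<dots> = measure (P0 p) (\<Union>k\<le>n. D k)"
    using Dm disj by (subst P.finite_measure_finite_Union) auto
  also have "\<dots> \<le> \<rho>"
  proof (rule P.finite_measure_mono)
    \<comment> \<open>A percolating right edge is reached from the origin, which then percolates
      too. Bounding the union by \<open>\<rho>\<close>, not by 1, cancels the factor
      \<open>\<rho>\<close> of the lower bounds.\<close>
    show "(\<Union>k\<le>n. D k) \<subseteq> {\<eta>. perc \<eta> 0 0}"
      unfolding D_def right_edge_def no_break_def perc_sh0
      using perc_conn[of _ _ 0 0] by fastforce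
  qed (rule setsP, measurable)
  finally have "\<rho> * (\<Sum>m\<le>n. measure (P0 p) {\<eta>. no_break \<eta> m}) \<le> \<rho> * 1"
    by (simp add: sum_distrib_left)
  then show ?thesis using survival by (simp only: mult_le_cancel_left_pos)
qed

end

section \<open>Recentring steps that preserve the conditioned law\<close>

definition move :: "(config \<Rightarrow> nat \<times> int) \<Rightarrow> config \<Rightarrow> config" where
  "move V \<eta> = sh (V \<eta>) \<eta>"

lemma measurable_move[measurable]:
  assumes [measurable]: "V \<in> measurable (P0 p) (count_space UNIV)"
  shows "move V \<in> measurable (P0 p) (P0 p)"
  unfolding move_def[abs_def]
  by (rule measurable_compose_countable[where f="\<lambda>v. sh v"]) measurable

definition mirror_step :: "(config \<Rightarrow> nat \<times> int) \<Rightarrow> config \<Rightarrow> nat \<times> int" where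
  "mirror_step V \<eta> = (fst (V (mir \<eta>)), int (fst (V (mir \<eta>))) - snd (V (mir \<eta>)))"

definition seq_step :: "(config \<Rightarrow> nat \<times> int) \<Rightarrow> (config \<Rightarrow> nat \<times> int) \<Rightarrow> config \<Rightarrow> nat \<times> int" where
  "seq_step V W \<eta> = V \<eta> + W (move V \<eta>)"

lemma move_mirror_step: "move (mirror_step V) \<eta> = mir (move V (mir \<eta>))"
  using mir_sh_mir[of "fst (V (mir \<eta>))" "snd (V (mir \<eta>))" \<eta>] by (simp add: move_def mirror_step_def)

lemma move_seq_step: "move (seq_step V W) \<eta> = move W (move V \<eta>)"
  by (simp add: move_def seq_step_def sh_sh add.commute)

context supercritical
begin

lemma measurable_Q_iff: "f \<in> measurable Q N \<longleftrightarrow> f \<in> measurable (P0 p) N"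
  "f \<in> measurable N Q \<longleftrightarrow> f \<in> measurable N (P0 p)"
  by (rule arg_cong[where f="\<lambda>S. f \<in> S"], rule measurable_cong_sets, simp_all)+

lemma measurable_of_V:
  "V \<in> measurable (P0 p) (count_space UNIV) \<Longrightarrow> range f \<subseteq> space N \<Longrightarrow> (\<lambda>\<eta>. f (V \<eta>)) \<in> measurable Q N"
  unfolding measurable_Q_iff by (rule measurable_compose[of V _ "count_space UNIV"]) auto

text \<open>The properties of the break step that survive reflection and composition; the
  independence of step and recentred configuration is kept only through mean values.\<close>

definition renewal_step :: "(config \<Rightarrow> nat \<times> int) \<Rightarrow> bool" where
  "renewal_step V \<longleftrightarrow> V \<in> measurable (P0 p) (count_space UNIV) \<and>
     (AE \<eta> in Q. 1 \<le> fst (V \<eta>) \<and> conn \<eta> (fst (V \<eta>)) 0 0 (snd (V \<eta>))) \<and>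
     distr Q Q (move V) = Q \<and>
     renewing Q (move V) (\<lambda>\<eta>. real (fst (V \<eta>))) \<and>
     renewing Q (move V) (\<lambda>\<eta>. real_of_int (snd (V \<eta>)))"

text \<open>Percolation without any break implies \<open>no_break \<eta> m\<close> for every
  \<open>m\<close>. Since those probabilities have partial sums at most 1, \<open>n + 1\<close>
  times its probability is at most 1 for all \<open>n\<close>.\<close>

lemma AE_first_break: "AE \<eta> in Q. first_break \<eta> (break_step \<eta>)"
proof -
  have fz: "measure (P0 p) {\<eta>. perc \<eta> 0 0 \<and> (\<forall>v. \<not> first_break \<eta> v)} \<le> e" if "e > 0" for e
  proof -
    let ?c = "measure (P0 p) {\<eta>. perc \<eta> 0 0 \<and> (\<forall>v. \<not> first_break \<eta> v)}"
    obtain n :: nat where n: "1 / e < real n" using reals_Archimedean2 by blast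
    have "?c \<le> measure (P0 p) {\<eta>. no_break \<eta> m}" for m
    proof (intro P.finite_measure_mono Collect_mono impI)
      fix \<eta> assume h: "perc \<eta> 0 0 \<and> (\<forall>v. \<not> first_break \<eta> v)"
      have "\<forall>a. 1 \<le> l \<and> right_edge \<eta> l a \<longrightarrow> \<not> perc \<eta> l a" for l
      proof (induction l rule: less_induct)
        case (less l)
        show ?case
        proof (intro allI impI notI)
          fix a assume la: "1 \<le> l \<and> right_edge \<eta> l a" "perc \<eta> l a"
          then have "first_break \<eta> (l, a)" using less by (auto simp: first_break_def)
          then show False using h by blast
        qed
      qed
      then show "no_break \<eta> m" using h by (auto simp: no_break_def)
    qed (rule setsP, measurable)
    then have "(\<Sum>m\<le>n. ?c) \<le> (\<Sum>m\<le>n. measure (P0 p) {\<eta>. no_break \<eta> m})" by (intro sum_mono) auto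
    also have "\<dots> \<le> 1" by (rule sum_no_break_le)
    finally have c: "real (Suc n) * ?c \<le> 1" by simp
    show ?thesis
    proof (rule ccontr)
      assume "\<not> ?c \<le> e"
      then have "real n * e < real (Suc n) * ?c" using that by (intro mult_strict_mono) auto
      moreover have "1 < real n * e" using n that by (simp add: field_simps)
      ultimately show False using c by simp
    qed
  qed
  then have "measure (P0 p) {\<eta>. perc \<eta> 0 0 \<and> (\<forall>v. \<not> first_break \<eta> v)} \<le> 0" by (rule field_le_epsilon[of _ 0, simplified])
  then have "measure (P0 p) {\<eta>. perc \<eta> 0 0 \<and> (\<forall>v. \<not> first_break \<eta> v)} = 0" by (simp add: measure_le_0_iff)
  moreover have "{\<eta>. perc \<eta> 0 0 \<and> (\<forall>v. \<not> first_break \<eta> v)} \<in> sets (P0 p)" by (rule setsP) measurable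
  ultimately have "AE \<eta> in P0 p. \<eta> \<notin> {\<eta>. perc \<eta> 0 0 \<and> (\<forall>v. \<not> first_break \<eta> v)}"
    by (simp add: P.prob_eq_0)
  then show ?thesis unfolding AE_Q
  proof eventually_elim
    case (elim \<eta>)
    then show ?case using break_step_eq[of \<eta> "break_step \<eta>"] by auto
  qed
qed

text \<open>The break at \<open>v\<close> is the past event \<open>local_break\<close> together with
  percolation from \<open>v\<close>, and these already imply percolation from the origin. So the
  conditioning on the origin turns into the same conditioning at \<open>v\<close>.\<close>

lemma break_step_split:
  assumes B[measurable]: "Measurable.pred (P0 p) B"
  shows "measure Q {\<eta>. break_step \<eta> = v \<and> B (sh v \<eta>)} = measure Q {\<eta>. break_step \<eta> = v} * measure Q {\<eta>. B \<eta>}"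
proof -
  have *: "measure Q {\<eta>. break_step \<eta> = v \<and> C (sh v \<eta>)} =
    measure (P0 p) {\<eta>. local_break \<eta> v} * measure (P0 p) {\<eta>. perc \<eta> 0 0 \<and> C \<eta>} / \<rho>"
    if [measurable]: "Measurable.pred (P0 p) C" for C
  proof -
    have "measure Q {\<eta>. break_step \<eta> = v \<and> C (sh v \<eta>)} = measure Q {\<eta>. first_break \<eta> v \<and> C (sh v \<eta>)}"
    proof (rule Q.finite_measure_eq_AE)
      show "AE \<eta> in Q. (\<eta> \<in> {\<eta>. break_step \<eta> = v \<and> C (sh v \<eta>)}) = (\<eta> \<in> {\<eta>. first_break \<eta> v \<and> C (sh v \<eta>)})"
        using AE_first_break by eventually_elim (use break_step_eq in blast)
      have "Measurable.pred (P0 p) (\<lambda>\<eta>. C (sh v \<eta>))" by measurable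
      then show "{\<eta>. break_step \<eta> = v \<and> C (sh v \<eta>)} \<in> sets Q" "{\<eta>. first_break \<eta> v \<and> C (sh v \<eta>)} \<in> sets Q"
        unfolding sets_Q by (intro setsP; measurable)+
    qed
    also have "\<dots> = measure (P0 p) {\<eta>. perc \<eta> 0 0 \<and> first_break \<eta> v \<and> C (sh v \<eta>)} / \<rho>"
      by (rule measure_Q) measurable
    also have "{\<eta>. perc \<eta> 0 0 \<and> first_break \<eta> v \<and> C (sh v \<eta>)} =
        {\<eta>. local_break \<eta> v \<and> (perc (sh v \<eta>) 0 0 \<and> C (sh v \<eta>))}"
      using first_break_perc[of _ v] unfolding first_break_iff_local_break perc_sh by auto
    also have "measure (P0 p) \<dots> = measure (P0 p) {\<eta>. local_break \<eta> v} * measure (P0 p) {\<eta>. perc \<eta> 0 0 \<and> C \<eta>}"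
      by (rule measure_past_future) (measurable, auto intro!: local_break_cong)
    finally show ?thesis .
  qed
  show ?thesis
    using *[of "\<lambda>_. True"] *[of B] measure_Q[of B] survival by (simp add: mult.commute)
qed

text \<open>Summation of the factorization over the countably many values of the step. The weight 1
  gives invariance of the law, the coordinates of the step give \<open>renewing\<close>.\<close>

lemma nn_integral_break_step:
  assumes B[measurable]: "B \<in> sets (P0 p)"
  shows "(\<integral>\<^sup>+\<eta>. f (break_step \<eta>) * indicator B (move break_step \<eta>) \<partial>Q) = (\<integral>\<^sup>+\<eta>. f (break_step \<eta>) \<partial>Q) * emeasure Q B"
proof -
  have [measurable]: "break_step \<in> measurable Q (count_space UNIV)" "move break_step \<in> measurable Q Q" "sh v \<in> measurable Q Q" for v
    by (auto simp: measurable_Q_iff)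
  have [measurable]: "B \<in> sets Q" by simp
  have pB: "Measurable.pred (P0 p) (\<lambda>\<eta>. \<eta> \<in> B)" using B by (simp add: pred_def)
  have *: "(\<integral>\<^sup>+\<eta>. f (break_step \<eta>) * indicator C (move break_step \<eta>) \<partial>Q) =
      (\<integral>\<^sup>+v. f v * emeasure Q {\<eta>. break_step \<eta> = v \<and> sh v \<eta> \<in> C} \<partial>count_space UNIV)"
    if C[measurable]: "C \<in> sets Q" for C
  proof -
    have s: "{\<eta>. break_step \<eta> = v \<and> sh v \<eta> \<in> C} \<in> sets Q" for v
    proof -
      have "{\<eta> \<in> space Q. break_step \<eta> = v \<and> sh v \<eta> \<in> C} \<in> sets Q" by measurable
      then show ?thesis by simp
    qed
    have "(\<integral>\<^sup>+\<eta>. f (break_step \<eta>) * indicator C (move break_step \<eta>) \<partial>Q) =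
      (\<integral>\<^sup>+\<eta>. (\<integral>\<^sup>+v. f v * indicator {\<eta>. break_step \<eta> = v \<and> sh v \<eta> \<in> C} \<eta> \<partial>count_space UNIV) \<partial>Q)"
    proof (rule nn_integral_cong)
      fix \<eta>
      have "(\<integral>\<^sup>+v. f v * indicator {\<eta>. break_step \<eta> = v \<and> sh v \<eta> \<in> C} \<eta> \<partial>count_space UNIV) =
        (\<integral>\<^sup>+v. (f v * indicator C (sh v \<eta>)) * indicator {break_step \<eta>} v \<partial>count_space UNIV)"
        by (intro nn_integral_cong) (auto simp: indicator_def)
      also have "\<dots> = f (break_step \<eta>) * indicator C (move break_step \<eta>)"
        by (subst nn_integral_indicator_singleton) (auto simp: move_def one_ennreal_def[symmetric])
      finally show "f (break_step \<eta>) * indicator C (move break_step \<eta>) =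
        (\<integral>\<^sup>+v. f v * indicator {\<eta>. break_step \<eta> = v \<and> sh v \<eta> \<in> C} \<eta> \<partial>count_space UNIV)" by simp
    qed
    also have "\<dots> = (\<integral>\<^sup>+v. (\<integral>\<^sup>+\<eta>. f v * indicator {\<eta>. break_step \<eta> = v \<and> sh v \<eta> \<in> C} \<eta> \<partial>Q) \<partial>count_space UNIV)"
      using s by (intro nn_integral_count_space_nn_integral) auto
    also have "\<dots> = (\<integral>\<^sup>+v. f v * emeasure Q {\<eta>. break_step \<eta> = v \<and> sh v \<eta> \<in> C} \<partial>count_space UNIV)"
      using s by (intro nn_integral_cong nn_integral_cmult_indicator) auto
    finally show ?thesis .
  qed
  have e: "emeasure Q {\<eta>. break_step \<eta> = v \<and> sh v \<eta> \<in> B} = emeasure Q {\<eta>. break_step \<eta> = v} * emeasure Q B" for v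
    using break_step_split[OF pB, of v] by (simp add: Q.emeasure_eq_measure ennreal_mult)
  have "(\<integral>\<^sup>+\<eta>. f (break_step \<eta>) * indicator B (move break_step \<eta>) \<partial>Q) =
     (\<integral>\<^sup>+v. f v * emeasure Q {\<eta>. break_step \<eta> = v} * emeasure Q B \<partial>count_space UNIV)"
    by (simp add: * e mult.assoc)
  also have "\<dots> = (\<integral>\<^sup>+v. f v * emeasure Q {\<eta>. break_step \<eta> = v} \<partial>count_space UNIV) * emeasure Q B"
    by (rule nn_integral_multc) simp
  also have "(\<integral>\<^sup>+v. f v * emeasure Q {\<eta>. break_step \<eta> = v} \<partial>count_space UNIV) = (\<integral>\<^sup>+\<eta>. f (break_step \<eta>) \<partial>Q)"
    using *[of UNIV] sets.top[of Q] by simp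
  finally show ?thesis .
qed

lemma distr_move_break_step: "distr Q Q (move break_step) = Q"
proof (rule measure_eqI)
  fix B assume "B \<in> sets (distr Q Q (move break_step))"
  then have B[measurable]: "B \<in> sets (P0 p)" by simp
  have [measurable]: "move break_step \<in> measurable Q Q" by (auto simp: measurable_Q_iff)
  have "emeasure (distr Q Q (move break_step)) B = emeasure Q (move break_step -` B \<inter> space Q)"
    by (rule emeasure_distr) auto
  also have "\<dots> = (\<integral>\<^sup>+\<eta>. indicator (move break_step -` B \<inter> space Q) \<eta> \<partial>Q)"
    by (rule nn_integral_indicator[symmetric]) measurable
  also have "\<dots> = (\<integral>\<^sup>+\<eta>. 1 * indicator B (move break_step \<eta>) \<partial>Q)"
    by (intro nn_integral_cong) (auto simp: indicator_def)
  also have "\<dots> = emeasure Q B"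
    using nn_integral_break_step[OF B, of "\<lambda>_. 1"] by (simp add: Q.emeasure_space_1[simplified])
  finally show "emeasure (distr Q Q (move break_step)) B = emeasure Q B" .
qed simp

lemma break_step_renewing:
  assumes f0: "\<And>v. 0 \<le> f v" and fin: "integrable Q (\<lambda>\<eta>. f (break_step \<eta>))"
  shows "renewing Q (move break_step) (\<lambda>\<eta>. f (break_step \<eta>))"
  unfolding renewing_def
proof (intro conjI ballI fin)
  fix B assume "B \<in> sets Q"
  then have B[measurable]: "B \<in> sets (P0 p)" by simp
  have [measurable]: "break_step \<in> measurable Q (count_space UNIV)" "move break_step \<in> measurable Q Q"
    by (auto simp: measurable_Q_iff)
  have [measurable]: "B \<in> sets Q" by simp
  have "(\<integral>\<eta>. f (break_step \<eta>) * indicator B (move break_step \<eta>) \<partial>Q) =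
    enn2real (\<integral>\<^sup>+\<eta>. ennreal (f (break_step \<eta>) * indicator B (move break_step \<eta>)) \<partial>Q)"
    using f0 by (intro integral_eq_nn_integral) auto
  also have "(\<integral>\<^sup>+\<eta>. ennreal (f (break_step \<eta>) * indicator B (move break_step \<eta>)) \<partial>Q) =
    (\<integral>\<^sup>+\<eta>. ennreal (f (break_step \<eta>)) * indicator B (move break_step \<eta>) \<partial>Q)"
    by (intro nn_integral_cong) (auto simp: indicator_def)
  also have "\<dots> = (\<integral>\<^sup>+\<eta>. ennreal (f (break_step \<eta>)) \<partial>Q) * emeasure Q B"
    using nn_integral_break_step[OF B, of "\<lambda>v. ennreal (f v)"] .
  also have "enn2real \<dots> = measure Q B * enn2real (\<integral>\<^sup>+\<eta>. ennreal (f (break_step \<eta>)) \<partial>Q)"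
    by (simp add: enn2real_mult measure_def mult.commute)
  also have "enn2real (\<integral>\<^sup>+\<eta>. ennreal (f (break_step \<eta>)) \<partial>Q) = (\<integral>\<eta>. f (break_step \<eta>) \<partial>Q)"
    using f0 by (intro integral_eq_nn_integral[symmetric]) auto
  finally show "(\<integral>\<eta>. f (break_step \<eta>) * indicator B (move break_step \<eta>) \<partial>Q) = measure Q B * (\<integral>\<eta>. f (break_step \<eta>) \<partial>Q)" .
qed

text \<open>The mean is the sum of the tail probabilities. The tail beyond \<open>t\<close> lies in
  \<open>no_break \<eta> t\<close>, so the mean under \<open>Q\<close> is at most
  \<open>1 / \<rho>\<close>.\<close>

lemma integrable_break_step_level: "integrable Q (\<lambda>\<eta>. real (fst (break_step \<eta>)))"
proof -
  have [measurable]: "break_step \<in> measurable Q (count_space UNIV)" by (auto simp: measurable_Q_iff)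
  have fm[measurable]: "(\<lambda>\<eta>. fst (break_step \<eta>)) \<in> measurable Q (count_space UNIV)"
    by (rule measurable_of_V[OF measurable_break_step]) simp
  have [measurable]: "(\<lambda>\<eta>. fst (break_step \<eta>)) \<in> measurable (P0 p) (count_space UNIV)"
    using fm by (simp add: measurable_Q_iff)
  have le: "emeasure Q {\<eta> \<in> space Q. t < fst (break_step \<eta>)} \<le> ennreal (measure (P0 p) {\<eta>. no_break \<eta> t} / \<rho>)" for t
  proof -
    have "measure Q {\<eta>. t < fst (break_step \<eta>)} = measure (P0 p) {\<eta>. perc \<eta> 0 0 \<and> t < fst (break_step \<eta>)} / \<rho>"
      by (rule measure_Q) measurable
    also have "\<dots> \<le> measure (P0 p) {\<eta>. no_break \<eta> t} / \<rho>"
    proof (intro divide_right_mono P.finite_measure_mono Collect_mono impI)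
      fix \<eta> assume h: "perc \<eta> 0 0 \<and> t < fst (break_step \<eta>)"
      show "no_break \<eta> t"
        using h break_step_eq[of \<eta> "break_step \<eta>"] by (auto simp: no_break_def first_break_def)
    qed (rule setsP, measurable)
    finally show ?thesis by (simp add: Q.emeasure_eq_measure ennreal_leI)
  qed
  have "(\<integral>\<^sup>+\<eta>. of_nat (fst (break_step \<eta>)) \<partial>Q) = (\<Sum>t. emeasure Q {\<eta> \<in> space Q. t < fst (break_step \<eta>)})"
    by (rule nn_integral_nat_function) measurable
  also have "\<dots> \<le> (\<Sum>t. ennreal (measure (P0 p) {\<eta>. no_break \<eta> t} / \<rho>))"
    by (intro suminf_le le) auto
  also have "\<dots> \<le> ennreal (1 / \<rho>)"
  proof (rule suminf_le_const)
    fix n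
    have "(\<Sum>t<n. measure (P0 p) {\<eta>. no_break \<eta> t} / \<rho>) \<le> (\<Sum>t\<le>n. measure (P0 p) {\<eta>. no_break \<eta> t}) / \<rho>"
      unfolding sum_divide_distrib by (intro sum_mono2) auto
    also have "\<dots> \<le> 1 / \<rho>" by (intro divide_right_mono sum_no_break_le) simp
    finally show "(\<Sum>t<n. ennreal (measure (P0 p) {\<eta>. no_break \<eta> t} / \<rho>)) \<le> ennreal (1 / \<rho>)"
      by (simp add: sum_ennreal ennreal_leI)
  qed simp
  also have "\<dots> < \<infinity>" by simp
  finally have "(\<integral>\<^sup>+\<eta>. ennreal (real (fst (break_step \<eta>))) \<partial>Q) < \<infinity>" by (simp add: ennreal_of_nat_eq_real_of_nat)
  moreover have "(\<lambda>\<eta>. real (fst (break_step \<eta>))) \<in> borel_measurable Q"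
    by (rule measurable_of_V[OF measurable_break_step]) simp
  ultimately show ?thesis by (intro integrableI_nonneg) auto
qed

lemma renewal_step_integrable:
  assumes V[measurable]: "V \<in> measurable (P0 p) (count_space UNIV)" and i: "integrable Q (\<lambda>\<eta>. real (fst (V \<eta>)))"
    and c: "AE \<eta> in Q. conn \<eta> (fst (V \<eta>)) 0 0 (snd (V \<eta>))"
  shows "integrable Q (\<lambda>\<eta>. real_of_int (snd (V \<eta>)))"
proof (rule Bochner_Integration.integrable_bound[OF i])
  have [measurable]: "V \<in> measurable Q (count_space UNIV)" by (auto simp: measurable_Q_iff)
  show "(\<lambda>\<eta>. real_of_int (snd (V \<eta>))) \<in> borel_measurable Q"
    by (rule measurable_of_V[OF V]) simp
  show "AE \<eta> in Q. norm (real_of_int (snd (V \<eta>))) \<le> norm (real (fst (V \<eta>)))"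
    using c
  proof eventually_elim
    case (elim \<eta>)
    then show ?case using conn_bounds[OF elim] by simp
  qed
qed

lemma renewal_step_break_step: "renewal_step break_step"
proof -
  have c: "AE \<eta> in Q. 1 \<le> fst (break_step \<eta>) \<and> conn \<eta> (fst (break_step \<eta>)) 0 0 (snd (break_step \<eta>))"
    using AE_first_break by eventually_elim (auto simp: first_break_def right_edge_def)
  then have i: "integrable Q (\<lambda>\<eta>. real_of_int (snd (break_step \<eta>)))"
    by (intro renewal_step_integrable integrable_break_step_level) (auto elim: eventually_mono)
  \<comment> \<open>The truncation \<open>nat\<close> makes the weight nonnegative on all pairs. It
    changes nothing on actual steps: a right edge never lies left of 0, and the default step has
    coordinate 0.\<close>
  have "renewing Q (move break_step) (\<lambda>\<eta>. real_of_int (nat (snd (break_step \<eta>))))"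
  proof (rule break_step_renewing[where f="\<lambda>v. real_of_int (nat (snd v))"])
    have [measurable]: "break_step \<in> measurable Q (count_space UNIV)" by (auto simp: measurable_Q_iff)
    show "integrable Q (\<lambda>\<eta>. real_of_int (int (nat (snd (break_step \<eta>)))))"
      by (rule Bochner_Integration.integrable_bound[OF i])
        (auto intro: measurable_of_V[OF measurable_break_step, where f="\<lambda>v. real_of_int (int (nat (snd v)))"])
  qed simp
  moreover have "real_of_int (nat (snd (break_step \<eta>))) = real_of_int (snd (break_step \<eta>))" for \<eta>
    using break_step_eq[of \<eta> "break_step \<eta>"] right_edge_bounds by (auto simp: first_break_def)
  ultimately have "renewing Q (move break_step) (\<lambda>\<eta>. real_of_int (snd (break_step \<eta>)))" by (simp only:)
  then show ?thesis
    unfolding renewal_step_def using c distr_move_break_step break_step_renewing[OF _ integrable_break_step_level]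
    by (auto intro: measurable_break_step)
qed

end

section \<open>Constructing paths with prescribed slope\<close>

lemma stage_index:
  fixes S :: "nat \<Rightarrow> nat"
  assumes "strict_mono S"
  shows "\<exists>K. (\<forall>k\<ge>S 0. S (K k) \<le> k \<and> k < S (Suc (K k))) \<and> filterlim K at_top sequentially"
proof -
  define K where "K = (\<lambda>k. LEAST j. k < S (Suc j))"
  have ex: "k < S (Suc k)" for k
    using strict_mono_imp_increasing[OF assms, of "Suc k"] by simp
  have K1: "k < S (Suc (K k))" for k unfolding K_def by (rule LeastI[of _ k]) (rule ex)
  have K2: "S (K k) \<le> k" if "S 0 \<le> k" for k
  proof (cases "K k")
    case (Suc j)
    then have "\<not> k < S (Suc j)" unfolding K_def by (metis lessI not_less_Least)
    then show ?thesis using Suc by simp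
  qed (use that in simp)
  have "filterlim K at_top sequentially"
    unfolding filterlim_at_top
  proof
    fix j
    show "eventually (\<lambda>k. j \<le> K k) sequentially"
    proof (rule eventually_sequentiallyI)
      fix k assume "S j \<le> k"
      then have "S j < S (Suc (K k))" using K1[of k] by simp
      then show "j \<le> K k" using strict_mono_less[OF assms] by simp
    qed
  qed
  then show ?thesis using K1 K2 by blast
qed

lemma opath_concat:
  assumes S: "strict_mono S"
    and st: "\<And>j k. S j \<le> k \<Longrightarrow> k < S (Suc j) \<Longrightarrow> step \<eta> k (g j k) (g j (Suc k))"
    and gl: "\<And>j. g j (S (Suc j)) = g (Suc j) (S (Suc j))"
  shows "\<exists>h. opath \<eta> (S 0) h \<and> (\<forall>j k. S j \<le> k \<longrightarrow> k \<le> S (Suc j) \<longrightarrow> h k = g j k)"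
proof -
  obtain K where K: "\<And>k. S 0 \<le> k \<Longrightarrow> S (K k) \<le> k \<and> k < S (Suc (K k))"
    using stage_index[OF S] by blast
  define h where "h = (\<lambda>k. g (K k) k)"
  have Keq: "K k = j" if "S j \<le> k" "k < S (Suc j)" for j k
  proof -
    have "S 0 \<le> k" using that(1) strict_mono_less_eq[OF S, of 0 j] by simp
    from K[OF this] have "S j < S (Suc (K k))" "S (K k) < S (Suc j)" using that by auto
    then show ?thesis using strict_mono_less[OF S] by (simp add: less_Suc_eq_le)
  qed
  have h: "h k = g j k" if k: "S j \<le> k" "k \<le> S (Suc j)" for j k
  proof (cases "k = S (Suc j)")
    case True
    have "K k = Suc j" using Keq[of "Suc j" k] True strict_monoD[OF S, of "Suc j" "Suc (Suc j)"] by simp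
    then show ?thesis using True gl by (simp add: h_def)
  next
    case False
    then show ?thesis using Keq[of j k] k by (simp add: h_def)
  qed
  have "opath \<eta> (S 0) h"
    unfolding opath_def
  proof (intro allI impI)
    fix k assume "S 0 \<le> k"
    from K[OF this] have k: "S (K k) \<le> k" "k < S (Suc (K k))" by auto
    then have "h k = g (K k) k" "h (Suc k) = g (K k) (Suc k)" using h by auto
    then show "step \<eta> k (h k) (h (Suc k))" using st[OF k] by simp
  qed
  then show ?thesis using h by blast
qed

lemma conn_function:
  "conn \<eta> l n i j \<Longrightarrow> \<exists>g. g n = i \<and> g (n + l) = j \<and> (\<forall>k. n \<le> k \<longrightarrow> k < n + l \<longrightarrow> step \<eta> k (g k) (g (Suc k)))"
proof (induction l arbitrary: n i)
  case 0
  then show ?case by (auto intro!: exI[of _ "\<lambda>_. i"])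
next
  case (Suc l)
  then obtain m where m: "step \<eta> n i m" "conn \<eta> l (Suc n) m j" unfolding conn_Suc_step by blast
  from Suc.IH[OF m(2)] obtain g where g: "g (Suc n) = m" "g (Suc n + l) = j"
    "\<And>k. Suc n \<le> k \<Longrightarrow> k < Suc n + l \<Longrightarrow> step \<eta> k (g k) (g (Suc k))" by blast
  show ?case
  proof (intro exI[of _ "g(n := i)"] conjI allI impI)
    fix k assume k: "n \<le> k" "k < n + Suc l"
    show "step \<eta> k ((g(n := i)) k) ((g(n := i)) (Suc k))"
    proof (cases "k = n")
      case True
      then show ?thesis using m(1) g(1) by simp
    next
      case False
      then show ?thesis using g(3)[of k] k by simp
    qed
  qed (use g in auto)
qed

lemma conn_perc_opath:
  assumes "conn \<eta> l n i j" "perc \<eta> (n + l) j"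
  shows "\<exists>h. opath \<eta> n h \<and> h n = i \<and> h (n + l) = j"
proof -
  obtain g where g: "g n = i" "g (n + l) = j"
    "\<And>k. n \<le> k \<Longrightarrow> k < n + l \<Longrightarrow> step \<eta> k (g k) (g (Suc k))" using conn_function[OF assms(1)] by blast
  let ?r = "rpath \<eta> (n + l) j"
  have r: "opath \<eta> (n + l) ?r" "?r (n + l) = j" using rpath_opath[OF assms(2)] by (auto simp: rpath_start)
  have "opath \<eta> n (\<lambda>k. if k \<le> n + l then g k else ?r k)"
    unfolding opath_def
  proof (intro allI impI)
    fix k assume "n \<le> k"
    consider "k < n + l" | "k = n + l" | "n + l < k" by linarith
    then show "step \<eta> k (if k \<le> n + l then g k else ?r k) (if Suc k \<le> n + l then g (Suc k) else ?r (Suc k))"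
    proof cases
      case 1
      then show ?thesis using g(3)[OF \<open>n \<le> k\<close>] by simp
    next
      case 2
      then show ?thesis using r g(2) unfolding opath_def by (metis Suc_n_not_le_n order_refl)
    next
      case 3
      then show ?thesis using r unfolding opath_def by simp
    qed
  qed
  then show ?thesis using g by (intro exI[of _ "\<lambda>k. if k \<le> n + l then g k else ?r k"]) auto
qed

text \<open>A break is the rightmost site reached on its level, which bounds the path from above; it
  also percolates, so some infinite open path runs through it, and the rightmost path cannot be to
  its left.\<close>

lemma rpath_first_break:
  assumes "first_break \<eta> v"
  shows "rpath \<eta> 0 0 (fst v) = snd v"
proof (rule antisym)
  have c: "conn \<eta> (fst v) 0 0 (snd v)" and p: "perc \<eta> (0 + fst v) (snd v)"
    and m: "\<And>j. conn \<eta> (fst v) 0 0 j \<Longrightarrow> j \<le> snd v" using assms by (auto simp: first_break_def right_edge_def)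
  have "opath \<eta> 0 (rpath \<eta> 0 0)" using first_break_perc[OF assms] by (rule rpath_opath)
  then have "conn \<eta> (fst v) 0 (rpath \<eta> 0 0 0) (rpath \<eta> 0 0 (0 + fst v))" by (rule opath_conn) simp
  then show "rpath \<eta> 0 0 (fst v) \<le> snd v" using m by simp
  obtain h where h: "opath \<eta> 0 h" "h 0 = 0" "h (0 + fst v) = snd v" using conn_perc_opath[OF c p] by blast
  have "h (fst v) \<le> rpath \<eta> 0 0 (fst v)" by (rule rpath_max[OF h(1)]) (use h in auto)
  then show "snd v \<le> rpath \<eta> 0 0 (fst v)" using h(3) by simp
qed

text \<open>For \<open>k\<close> between \<open>S j\<close> and \<open>S (Suc j)\<close>
  monotonicity puts \<open>h k / k\<close> between \<open>Y j / S (Suc j)\<close> and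
  \<open>Y (Suc j) / S j\<close>. Shifting the index by one does not change the limits of
  \<open>S j / j\<close> and \<open>Y j / j\<close>, so both bounds converge to the quotient of
  these limits.\<close>

lemma slope_along_times:
  fixes h Y :: "nat \<Rightarrow> int" and S :: "nat \<Rightarrow> nat"
  assumes S: "strict_mono S" and S0: "S 0 = 0" and h0: "h 0 = 0"
    and h: "\<And>k. h k \<le> h (Suc k)" and hY: "\<And>j. h (S j) = Y j"
    and mu: "(\<lambda>j. real (S j) / real j) \<longlonglongrightarrow> \<mu>" "0 < \<mu>"
    and nu: "(\<lambda>j. real_of_int (Y j) / real j) \<longlonglongrightarrow> \<nu>"
  shows "(\<lambda>k. real_of_int (h k) / real k) \<longlonglongrightarrow> \<nu> / \<mu>"
proof -
  obtain K where K: "\<And>k. S (K k) \<le> k \<and> k < S (Suc (K k))" and Klim: "filterlim K at_top sequentially"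
    using stage_index[OF S] S0 by auto
  have mono: "h k \<le> h l" if "k \<le> l" for k l using lift_Suc_mono_le[of h, OF h that] .
  have Y0: "0 \<le> Y j" for j using mono[of 0 "S j"] h0 hY by simp
  have Spos: "0 < S j" if "0 < j" for j using strict_monoD[OF S that] S0 by simp
  have cancel: "a / j * (j / s) / (t / s) = a / t" if "j \<noteq> 0" "s \<noteq> 0" for a j s t :: real
    using that by simp
  have sc: "(\<lambda>j. real (Suc j) / real j) \<longlonglongrightarrow> 1" using LIMSEQ_Suc_n_over_n .
  have sc': "(\<lambda>j. real j / real (Suc j)) \<longlonglongrightarrow> 1" using LIMSEQ_n_over_Suc_n .
  have "(\<lambda>j. (real_of_int (Y j) / real j) * (real j / real (Suc j)) / (real (S (Suc j)) / real (Suc j))) \<longlonglongrightarrow> \<nu> * 1 / \<mu>"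
    using mu by (intro tendsto_divide tendsto_mult nu sc' LIMSEQ_Suc[OF mu(1)]) auto
  moreover have "\<forall>\<^sub>F j in sequentially. (real_of_int (Y j) / real j) * (real j / real (Suc j)) / (real (S (Suc j)) / real (Suc j)) =
      real_of_int (Y j) / real (S (Suc j))"
    using eventually_gt_at_top[of 0] by eventually_elim (rule cancel, simp_all del: of_nat_Suc)
  ultimately have lo: "(\<lambda>j. real_of_int (Y j) / real (S (Suc j))) \<longlonglongrightarrow> \<nu> / \<mu>"
    unfolding mult_1_right by (rule Lim_transform_eventually)
  have "(\<lambda>j. (real_of_int (Y (Suc j)) / real (Suc j)) * (real (Suc j) / real j) / (real (S j) / real j)) \<longlonglongrightarrow> \<nu> * 1 / \<mu>"
    using mu by (intro tendsto_divide tendsto_mult LIMSEQ_Suc[OF nu] sc mu(1)) auto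
  moreover have "\<forall>\<^sub>F j in sequentially. (real_of_int (Y (Suc j)) / real (Suc j)) * (real (Suc j) / real j) / (real (S j) / real j) =
      real_of_int (Y (Suc j)) / real (S j)"
    using eventually_gt_at_top[of 0] by eventually_elim (rule cancel, simp_all del: of_nat_Suc)
  ultimately have up: "(\<lambda>j. real_of_int (Y (Suc j)) / real (S j)) \<longlonglongrightarrow> \<nu> / \<mu>"
    unfolding mult_1_right by (rule Lim_transform_eventually)
  show ?thesis
  proof (rule tendsto_sandwich)
    show "(\<lambda>k. real_of_int (Y (K k)) / real (S (Suc (K k)))) \<longlonglongrightarrow> \<nu> / \<mu>"
      by (rule filterlim_compose[OF lo Klim])
    show "(\<lambda>k. real_of_int (Y (Suc (K k))) / real (S (K k))) \<longlonglongrightarrow> \<nu> / \<mu>"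
      by (rule filterlim_compose[OF up Klim])
    have "\<forall>\<^sub>F k in sequentially. 0 < K k"
      using eventually_compose_filterlim[OF eventually_gt_at_top[of 0] Klim] .
    then have ev: "\<forall>\<^sub>F k in sequentially. real_of_int (Y (K k)) / real (S (Suc (K k))) \<le> real_of_int (h k) / real k
      \<and> real_of_int (h k) / real k \<le> real_of_int (Y (Suc (K k))) / real (S (K k))"
    proof eventually_elim
      case (elim k)
      have s: "0 < S (K k)" "S (K k) \<le> k" "k \<le> S (Suc (K k))" using Spos[OF elim] K[of k] by auto
      have y: "Y (K k) \<le> h k" "h k \<le> Y (Suc (K k))" using mono[OF s(2)] mono[OF s(3)] hY by auto
      have "real_of_int (Y (K k)) / real (S (Suc (K k))) \<le> real_of_int (h k) / real k"
        using s y Y0[of "K k"] by (intro frac_le) auto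
      moreover have "real_of_int (h k) / real k \<le> real_of_int (Y (Suc (K k))) / real (S (K k))"
        using s y Y0[of "Suc (K k)"] by (intro frac_le) auto
      ultimately show ?case ..
    qed
    show "\<forall>\<^sub>F k in sequentially. real_of_int (Y (K k)) / real (S (Suc (K k))) \<le> real_of_int (h k) / real k"
      using ev by eventually_elim simp
    show "\<forall>\<^sub>F k in sequentially. real_of_int (h k) / real k \<le> real_of_int (Y (Suc (K k))) / real (S (K k))"
      using ev by eventually_elim simp
  qed
qed

text \<open>With steps 0 and 1 a strict order of two paths survives one level at least weakly, so
  the minimum follows one of them through each whole step.\<close>

lemma opath_min:
  assumes g: "opath \<eta> n g" and h: "opath \<eta> n h"
  shows "opath \<eta> n (\<lambda>k. min (g k) (h k))"
  unfolding opath_def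
proof (intro allI impI)
  fix k assume k: "n \<le> k"
  have s: "step \<eta> k (g k) (g (Suc k))" "step \<eta> k (h k) (h (Suc k))" using g h k by (auto simp: opath_def)
  consider "g k < h k" | "g k = h k" | "h k < g k" by linarith
  then show "step \<eta> k (min (g k) (h k)) (min (g (Suc k)) (h (Suc k)))"
  proof cases
    case 1
    then have "g (Suc k) \<le> h (Suc k)" using step_bounds[OF s(1)] step_bounds[OF s(2)] by linarith
    then show ?thesis using 1 s by (simp add: min_def)
  next
    case 2
    then show ?thesis using s by (simp add: min_def)
  next
    case 3
    then have "h (Suc k) \<le> g (Suc k)" using step_bounds[OF s(1)] step_bounds[OF s(2)] by linarith
    then show ?thesis using 3 s by (simp add: min_def)
  qed
qed

lemma slopes_less:
  fixes f g :: "nat \<Rightarrow> int"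
  assumes "(\<lambda>l. real_of_int (f l) / real l) \<longlonglongrightarrow> a" "(\<lambda>l. real_of_int (g l) / real l) \<longlonglongrightarrow> b" "a < b"
  shows "eventually (\<lambda>l. f l \<le> g l) sequentially"
proof -
  obtain c where c: "a < c" "c < b" using dense[OF assms(3)] by blast
  have "eventually (\<lambda>l. real_of_int (f l) / real l < c) sequentially"
    using assms(1) c(1) by (rule order_tendstoD)
  moreover have "eventually (\<lambda>l. c < real_of_int (g l) / real l) sequentially"
    using assms(2) c(2) by (rule order_tendstoD)
  ultimately show ?thesis using eventually_gt_at_top[of 0]
  proof eventually_elim
    case (elim l)
    then have "real_of_int (f l) / real l < real_of_int (g l) / real l" by linarith
    then have "real_of_int (f l) < real_of_int (g l)" using elim(3) by (simp add: divide_less_cancel)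
    then show ?case by simp
  qed
qed

text \<open>The path runs along \<open>G k\<close> until level \<open>m k\<close> and is then carried to \<open>G (Suc k)\<close> by a rightmost path;
  meanwhile it stays between \<open>G k\<close> and \<open>G (Suc k)\<close>, so no uniform control of rightmost paths is needed.\<close>

lemma path_with_limiting_slope:
  fixes q :: "nat \<Rightarrow> real"
  assumes right: "\<And>n i. perc \<eta> n i \<Longrightarrow> (\<lambda>k. real_of_int (rpath \<eta> n i k) / real k) \<longlonglongrightarrow> \<beta>"
    and G: "\<And>k. opath \<eta> (N k) (G k)" and Gq: "\<And>k. (\<lambda>l. real_of_int (G k l) / real l) \<longlonglongrightarrow> q k"
    and q: "\<And>k. q k < q (Suc k)" "\<And>k. q k < \<beta>" "q \<longlonglongrightarrow> s"
  shows "\<exists>h n0. opath \<eta> n0 h \<and> (\<lambda>l. real_of_int (h l) / real l) \<longlonglongrightarrow> s \<and>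
    (\<forall>n i. perc \<eta> n i \<longrightarrow> (\<exists>l\<ge>max n n0. h l \<le> rpath \<eta> n i l))"
proof -
  \<comment> \<open>An enumeration of all sites. Stage \<open>k\<close> may start only at a level
    where \<open>G k\<close> is to the left of the rightmost paths from the percolating ones among
    \<open>e 0\<close>, ..., \<open>e k\<close>; thus every percolating site is dealt with at some
    stage.\<close>
  define e where "e = (from_nat :: nat \<Rightarrow> nat \<times> int)"
  define good where "good = (\<lambda>k m. N k \<le> m \<and> N (Suc k) \<le> m \<and>
    (\<forall>l\<ge>m. G k l \<le> G (Suc k) l \<and> \<bar>real_of_int (G k l) / real l - q k\<bar> < 1 / real (Suc k) \<and>
      \<bar>real_of_int (G (Suc k) l) / real l - q (Suc k)\<bar> < 1 / real (Suc k)) \<and>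
    (\<forall>i\<in>{..k}. perc \<eta> (fst (e i)) (snd (e i)) \<longrightarrow>
      fst (e i) \<le> m \<and> G k m \<le> rpath \<eta> (fst (e i)) (snd (e i)) m))"
  \<comment> \<open>Since \<open>\<beta>\<close> exceeds \<open>q (Suc k)\<close>, the rightmost
    path finally stays to the right of \<open>G (Suc k)\<close>, and from then on the minimum equals
    \<open>G (Suc k)\<close>.\<close>
  define J where "J = (\<lambda>k m l. min (rpath \<eta> m (G k m) l) (G (Suc k) l))"
  have close: "\<forall>\<^sub>F l in sequentially. \<bar>real_of_int (G k l) / real l - q k\<bar> < 1 / real (Suc k')" for k k'
    using Gq[of k] unfolding tendsto_iff dist_real_def by simp
  have evgood: "\<forall>\<^sub>F m in sequentially. good k m" for k
    unfolding good_def
  proof (intro eventually_conj eventually_ge_at_top)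
    show "\<forall>\<^sub>F m in sequentially. \<forall>l\<ge>m. G k l \<le> G (Suc k) l \<and> \<bar>real_of_int (G k l) / real l - q k\<bar> < 1 / real (Suc k) \<and>
      \<bar>real_of_int (G (Suc k) l) / real l - q (Suc k)\<bar> < 1 / real (Suc k)"
      by (intro eventually_all_ge_at_top eventually_conj close slopes_less[OF Gq Gq q(1)])
    show "\<forall>\<^sub>F m in sequentially. \<forall>i\<in>{..k}. perc \<eta> (fst (e i)) (snd (e i)) \<longrightarrow>
      fst (e i) \<le> m \<and> G k m \<le> rpath \<eta> (fst (e i)) (snd (e i)) m"
    proof (intro eventually_ball_finite ballI)
      fix i
      show "\<forall>\<^sub>F m in sequentially. perc \<eta> (fst (e i)) (snd (e i)) \<longrightarrow>
        fst (e i) \<le> m \<and> G k m \<le> rpath \<eta> (fst (e i)) (snd (e i)) m"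
      proof (cases "perc \<eta> (fst (e i)) (snd (e i))")
        case True
        show ?thesis using slopes_less[OF Gq[of k] right[OF True] q(2)] eventually_ge_at_top[of "fst (e i)"]
          by eventually_elim simp
      qed simp
    qed simp
  qed
  have good1: "N k \<le> m" "N (Suc k) \<le> m" and good2: "\<And>l. m \<le> l \<Longrightarrow> G k l \<le> G (Suc k) l"
    if "good k m" for k m using that unfolding good_def by auto
  have J: "opath \<eta> m (J k m)" "J k m m = G k m" "\<And>l. m \<le> l \<Longrightarrow> G k l \<le> J k m l" "\<And>l. J k m l \<le> G (Suc k) l"
    "\<forall>\<^sub>F l in sequentially. J k m l = G (Suc k) l"
    if g: "good k m" for k m
  proof -
    have p: "perc \<eta> m (G k m)" by (rule opath_perc[OF G]) (rule good1[OF g])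
    show "opath \<eta> m (J k m)" unfolding J_def
      by (rule opath_min[OF rpath_opath[OF p] opath_mono[OF G good1(2)[OF g]]])
    show "J k m m = G k m" using good2[OF g, of m] by (simp add: J_def rpath_start min_def)
    show "J k m l \<le> G (Suc k) l" for l by (simp add: J_def)
    show "G k l \<le> J k m l" if l: "m \<le> l" for l
    proof -
      have "G k l \<le> rpath \<eta> m (G k m) l"
        by (rule rpath_max[OF opath_mono[OF G good1(1)[OF g]]]) (use l in \<open>auto simp: rpath_start\<close>)
      then show ?thesis using good2[OF g l] by (simp add: J_def)
    qed
    show "\<forall>\<^sub>F l in sequentially. J k m l = G (Suc k) l"
      using slopes_less[OF Gq[of "Suc k"] right[OF p] q(2)] by eventually_elim (simp add: J_def min_def)
  qed
  have "\<exists>m. \<forall>k. good k (m k) \<and> (m k < m (Suc k) \<and> J k (m k) (m (Suc k)) = G (Suc k) (m (Suc k)))"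
  proof (rule dependent_nat_choice)
    show "\<exists>m. good 0 m" using evgood[of 0] eventually_happens by fastforce
    fix m k assume "good k m"
    have "\<forall>\<^sub>F m' in sequentially. good (Suc k) m' \<and> m < m' \<and> J k m m' = G (Suc k) m'"
      using evgood[of "Suc k"] J(5)[OF \<open>good k m\<close>] eventually_gt_at_top[of m] by eventually_elim simp
    then show "\<exists>m'. good (Suc k) m' \<and> m < m' \<and> J k m m' = G (Suc k) m'"
      using eventually_happens by fastforce
  qed
  then obtain m where m: "\<And>k. good k (m k)" "\<And>k. m k < m (Suc k)"
    "\<And>k. J k (m k) (m (Suc k)) = G (Suc k) (m (Suc k))" by blast
  have sm: "strict_mono m" using m(2) by (simp add: strict_mono_Suc_iff)
  have "\<exists>h. opath \<eta> (m 0) h \<and> (\<forall>j k. m j \<le> k \<longrightarrow> k \<le> m (Suc j) \<longrightarrow> h k = J j (m j) k)"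
  proof (rule opath_concat[OF sm])
    show "step \<eta> k (J j (m j) k) (J j (m j) (Suc k))" if "m j \<le> k" for j k
      using J(1)[OF m(1)] that by (simp add: opath_def)
    show "J j (m j) (m (Suc j)) = J (Suc j) (m (Suc j)) (m (Suc j))" for j
      using m(3) J(2)[OF m(1)] by simp
  qed
  then obtain h where h: "opath \<eta> (m 0) h" "\<And>j k. m j \<le> k \<Longrightarrow> k \<le> m (Suc j) \<Longrightarrow> h k = J j (m j) k" by blast
  obtain K where K: "\<And>k. m 0 \<le> k \<Longrightarrow> m (K k) \<le> k \<and> k < m (Suc (K k))" and Klim: "filterlim K at_top sequentially"
    using stage_index[OF sm] by blast
  have inv: "(\<lambda>k. 1 / real (Suc k)) \<longlonglongrightarrow> 0" using LIMSEQ_inverse_real_of_nat by (simp add: inverse_eq_divide)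
  have bounds: "q (K l) - 1 / real (Suc (K l)) \<le> real_of_int (h l) / real l \<and>
      real_of_int (h l) / real l \<le> q (Suc (K l)) + 1 / real (Suc (K l))" if l: "m 0 \<le> l" for l
  proof -
    let ?k = "K l"
    have k: "m ?k \<le> l" "l \<le> m (Suc ?k)" using K[OF l] by auto
    have "G ?k l \<le> h l" "h l \<le> G (Suc ?k) l"
      using h(2)[OF k] J(3)[OF m(1) k(1)] J(4)[OF m(1)] by auto
    then have "real_of_int (G ?k l) / real l \<le> real_of_int (h l) / real l"
      "real_of_int (h l) / real l \<le> real_of_int (G (Suc ?k) l) / real l"
      by (auto intro!: divide_right_mono)
    moreover have "\<bar>real_of_int (G ?k l) / real l - q ?k\<bar> < 1 / real (Suc ?k)"
      "\<bar>real_of_int (G (Suc ?k) l) / real l - q (Suc ?k)\<bar> < 1 / real (Suc ?k)"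
      using m(1)[of ?k] k(1) unfolding good_def by auto
    ultimately show ?thesis by linarith
  qed
  have "(\<lambda>l. real_of_int (h l) / real l) \<longlonglongrightarrow> s"
  proof (rule tendsto_sandwich)
    have "(\<lambda>k. q k - 1 / real (Suc k)) \<longlonglongrightarrow> s - 0" by (intro tendsto_diff q(3) inv)
    from filterlim_compose[OF this Klim] show "(\<lambda>l. q (K l) - 1 / real (Suc (K l))) \<longlonglongrightarrow> s" by simp
    have "(\<lambda>k. q (Suc k) + 1 / real (Suc k)) \<longlonglongrightarrow> s + 0" by (intro tendsto_add LIMSEQ_Suc[OF q(3)] inv)
    from filterlim_compose[OF this Klim] show "(\<lambda>l. q (Suc (K l)) + 1 / real (Suc (K l))) \<longlonglongrightarrow> s" by simp
    show "\<forall>\<^sub>F l in sequentially. q (K l) - 1 / real (Suc (K l)) \<le> real_of_int (h l) / real l"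
      using eventually_ge_at_top[of "m 0"] by eventually_elim (use bounds in blast)
    show "\<forall>\<^sub>F l in sequentially. real_of_int (h l) / real l \<le> q (Suc (K l)) + 1 / real (Suc (K l))"
      using eventually_ge_at_top[of "m 0"] by eventually_elim (use bounds in blast)
  qed
  moreover have "\<exists>l\<ge>max n (m 0). h l \<le> rpath \<eta> n i l" if p: "perc \<eta> n i" for n i
  proof -
    obtain a where a: "e a = (n, i)" unfolding e_def by (metis from_nat_to_nat)
    have "n \<le> m a \<and> G a (m a) \<le> rpath \<eta> n i (m a)"
      using m(1)[of a] p a unfolding good_def by force
    moreover have "h (m a) = G a (m a)"
      using h(2)[of a "m a"] m(2)[of a] J(2)[OF m(1)] by simp
    moreover have "m 0 \<le> m a" using strict_mono_less_eq[OF sm] by simp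
    ultimately show ?thesis by (intro exI[of _ "m a"]) simp
  qed
  ultimately show ?thesis using h(1) by blast
qed

section \<open>Speed of the rightmost path and paths of intermediate slope\<close>

lemma measure_mir:
  assumes [measurable]: "Measurable.pred (P0 p) E"
  shows "measure (P0 p) {\<eta>. E (mir \<eta>)} = measure (P0 p) {\<eta>. E \<eta>}"
proof -
  have "measure (distr (P0 p) (P0 p) mir) {\<eta>. E \<eta>} = measure (P0 p) (mir -` {\<eta>. E \<eta>} \<inter> space (P0 p))"
    using assms by (intro measure_distr) (auto simp: pred_def)
  then show ?thesis by (simp add: distr_mir vimage_def)
qed

lemma renewing_conj:
  assumes m[measurable]: "m \<in> measurable Q Q" and minv: "distr Q Q m = Q"
    and \<Theta>[measurable]: "\<Theta> \<in> measurable Q Q" and r: "renewing Q \<Theta> g"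
  shows "renewing Q (\<lambda>x. m (\<Theta> (m x))) (\<lambda>x. g (m x))"
proof -
  have ig: "integrable Q g" using r by (simp add: renewing_def)
  then have [measurable]: "g \<in> borel_measurable Q" by (rule borel_measurable_integrable)
  have via_m: "(\<integral>x. f (m x) \<partial>Q) = (\<integral>x. f x \<partial>Q)" if "f \<in> borel_measurable Q" for f :: "'a \<Rightarrow> real"
    using integral_distr[OF m that] by (simp only: minv)
  have "integrable (distr Q Q m) g" using ig by (simp only: minv)
  then have "integrable Q (\<lambda>x. g (m x))" by (rule integrable_distr[OF m])
  moreover have "(\<integral>x. g (m x) * indicator B (m (\<Theta> (m x))) \<partial>Q) = measure Q B * (\<integral>x. g (m x) \<partial>Q)"
    if B[measurable]: "B \<in> sets Q" for B
  proof -
    have B'[measurable]: "m -` B \<inter> space Q \<in> sets Q" by measurable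
    have "(\<integral>x. g (m x) * indicator B (m (\<Theta> (m x))) \<partial>Q) = (\<integral>x. g x * indicator B (m (\<Theta> x)) \<partial>Q)"
      by (rule via_m) measurable
    also have "\<dots> = (\<integral>x. g x * indicator (m -` B \<inter> space Q) (\<Theta> x) \<partial>Q)"
      using measurable_space[OF \<Theta>] by (intro Bochner_Integration.integral_cong) (auto simp: indicator_def)
    also have "\<dots> = measure Q (m -` B \<inter> space Q) * (\<integral>x. g x \<partial>Q)"
      using r B' by (simp add: renewing_def)
    also have "measure Q (m -` B \<inter> space Q) = measure (distr Q Q m) B"
      by (rule measure_distr[symmetric]) measurable
    also have "\<dots> = measure Q B" by (simp only: minv)
    finally show ?thesis by (simp add: via_m)
  qed
  ultimately show ?thesis by (simp add: renewing_def)
qed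

text \<open>The mean of \<open>g1\<close> is constant given \<open>\<Theta>1 x\<close>, and hence
  given its image under \<open>\<Theta>2\<close>. For the second summand invariance of the law under
  \<open>\<Theta>1\<close> reduces the claim to the one for \<open>g2\<close> and
  \<open>\<Theta>2\<close>.\<close>

lemma renewing_seq:
  assumes \<Theta>1[measurable]: "\<Theta>1 \<in> measurable Q Q" and inv1: "distr Q Q \<Theta>1 = Q"
    and \<Theta>2[measurable]: "\<Theta>2 \<in> measurable Q Q" and inv2: "distr Q Q \<Theta>2 = Q"
    and r1: "renewing Q \<Theta>1 g1" and r2: "renewing Q \<Theta>2 g2"
  shows "renewing Q (\<lambda>x. \<Theta>2 (\<Theta>1 x)) (\<lambda>x. g1 x + g2 (\<Theta>1 x))"
    and "(\<integral>x. g1 x + g2 (\<Theta>1 x) \<partial>Q) = (\<integral>x. g1 x \<partial>Q) + (\<integral>x. g2 x \<partial>Q)"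
proof -
  have i: "integrable Q g1" "integrable Q g2" using r1 r2 by (auto simp: renewing_def)
  then have [measurable]: "g1 \<in> borel_measurable Q" "g2 \<in> borel_measurable Q"
    by (auto intro: borel_measurable_integrable)
  have via1: "(\<integral>x. f (\<Theta>1 x) \<partial>Q) = (\<integral>x. f x \<partial>Q)" if "f \<in> borel_measurable Q" for f :: "'a \<Rightarrow> real"
    using integral_distr[OF \<Theta>1 that] by (simp only: inv1)
  have "integrable (distr Q Q \<Theta>1) g2" using i(2) by (simp only: inv1)
  then have i3: "integrable Q (\<lambda>x. g2 (\<Theta>1 x))" by (rule integrable_distr[OF \<Theta>1])
  show e: "(\<integral>x. g1 x + g2 (\<Theta>1 x) \<partial>Q) = (\<integral>x. g1 x \<partial>Q) + (\<integral>x. g2 x \<partial>Q)"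
    using i i3 by (simp add: via1)
  have "(\<integral>x. (g1 x + g2 (\<Theta>1 x)) * indicator B (\<Theta>2 (\<Theta>1 x)) \<partial>Q) = measure Q B * (\<integral>x. g1 x + g2 (\<Theta>1 x) \<partial>Q)"
    if B[measurable]: "B \<in> sets Q" for B
  proof -
    have B'[measurable]: "\<Theta>2 -` B \<inter> space Q \<in> sets Q" by measurable
    have ib: "integrable Q (\<lambda>x. g1 x * indicator B (\<Theta>2 (\<Theta>1 x)))"
      by (rule Bochner_Integration.integrable_bound[OF i(1)]) (auto simp: indicator_def)
    have ib3: "integrable Q (\<lambda>x. g2 (\<Theta>1 x) * indicator B (\<Theta>2 (\<Theta>1 x)))"
      by (rule Bochner_Integration.integrable_bound[OF i3]) (auto simp: indicator_def)
    have "(\<integral>x. g1 x * indicator B (\<Theta>2 (\<Theta>1 x)) \<partial>Q) = (\<integral>x. g1 x * indicator (\<Theta>2 -` B \<inter> space Q) (\<Theta>1 x) \<partial>Q)"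
      using measurable_space[OF \<Theta>1] by (intro Bochner_Integration.integral_cong) (auto simp: indicator_def)
    also have "\<dots> = measure Q (\<Theta>2 -` B \<inter> space Q) * (\<integral>x. g1 x \<partial>Q)"
      using r1 B' by (simp add: renewing_def)
    also have "measure Q (\<Theta>2 -` B \<inter> space Q) = measure (distr Q Q \<Theta>2) B"
      by (rule measure_distr[symmetric]) measurable
    finally have 1: "(\<integral>x. g1 x * indicator B (\<Theta>2 (\<Theta>1 x)) \<partial>Q) = measure Q B * (\<integral>x. g1 x \<partial>Q)"
      by (simp only: inv2)
    have "(\<integral>x. g2 (\<Theta>1 x) * indicator B (\<Theta>2 (\<Theta>1 x)) \<partial>Q) = (\<integral>x. g2 x * indicator B (\<Theta>2 x) \<partial>Q)"
      by (rule via1) measurable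
    also have "\<dots> = measure Q B * (\<integral>x. g2 x \<partial>Q)" using r2 B by (simp add: renewing_def)
    finally have 2: "(\<integral>x. g2 (\<Theta>1 x) * indicator B (\<Theta>2 (\<Theta>1 x)) \<partial>Q) = measure Q B * (\<integral>x. g2 x \<partial>Q)" .
    show ?thesis unfolding e distrib_right Bochner_Integration.integral_add[OF ib ib3] 1 2
      by (simp add: distrib_left)
  qed
  then show "renewing Q (\<lambda>x. \<Theta>2 (\<Theta>1 x)) (\<lambda>x. g1 x + g2 (\<Theta>1 x))"
    using i i3 by (simp add: renewing_def)
qed

text \<open>\<open>pow_step V n\<close> takes \<open>n + 1\<close> steps: a zeroth power would gain
  no level and so would not be a \<open>renewal_step\<close>.\<close>

primrec pow_step :: "(config \<Rightarrow> nat \<times> int) \<Rightarrow> nat \<Rightarrow> config \<Rightarrow> nat \<times> int" where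
  "pow_step V 0 = V"
| "pow_step V (Suc n) = seq_step V (pow_step V n)"

primrec posn :: "(config \<Rightarrow> nat \<times> int) \<Rightarrow> nat \<Rightarrow> config \<Rightarrow> nat \<times> int" where
  "posn V 0 \<eta> = (0, 0)"
| "posn V (Suc n) \<eta> = posn V n \<eta> + V ((move V ^^ n) \<eta>)"

lemma funpow_move: "(move V ^^ n) \<eta> = sh (posn V n \<eta>) \<eta>"
proof (induction n)
  case 0
  show ?case by (simp add: sh_def)
next
  case (Suc n)
  have "(move V ^^ Suc n) \<eta> = sh (V ((move V ^^ n) \<eta>)) ((move V ^^ n) \<eta>)"
    using move_def[of V "(move V ^^ n) \<eta>"] by simp
  also have "\<dots> = sh (V ((move V ^^ n) \<eta>)) (sh (posn V n \<eta>) \<eta>)" using Suc by (rule arg_cong)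
  also have "\<dots> = sh (posn V (Suc n) \<eta>) \<eta>" by (simp add: sh_sh add.commute)
  finally show ?case .
qed

lemma posn_sums: "fst (posn V n \<eta>) = (\<Sum>i<n. fst (V ((move V ^^ i) \<eta>)))"
  "snd (posn V n \<eta>) = (\<Sum>i<n. snd (V ((move V ^^ i) \<eta>)))"
  by (induction n) auto

context supercritical
begin

text \<open>The reflection fixes the origin, so the conditioning event is symmetric.\<close>

lemma distr_mir_Q: "distr Q Q mir = Q"
proof (rule measure_eqI)
  fix B assume "B \<in> sets (distr Q Q mir)"
  then have B: "B \<in> sets (P0 p)" by simp
  have pB[measurable]: "Measurable.pred (P0 p) (\<lambda>\<eta>. \<eta> \<in> B)" using B by (simp add: pred_def)
  have [measurable]: "mir \<in> measurable Q Q" by (simp add: measurable_Q_iff)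
  have "emeasure (distr Q Q mir) B = emeasure Q (mir -` B \<inter> space Q)"
    using B by (intro emeasure_distr) auto
  also have "\<dots> = ennreal (measure Q {\<eta>. mir \<eta> \<in> B})" by (simp add: Q.emeasure_eq_measure vimage_def)
  also have "measure Q {\<eta>. mir \<eta> \<in> B} = measure (P0 p) {\<eta>. perc \<eta> 0 0 \<and> mir \<eta> \<in> B} / \<rho>"
    by (rule measure_Q) measurable
  also have "measure (P0 p) {\<eta>. perc \<eta> 0 0 \<and> mir \<eta> \<in> B} = measure (P0 p) {\<eta>. perc (mir \<eta>) 0 0 \<and> mir \<eta> \<in> B}"
    by (simp add: perc_mir)
  also have "\<dots> = measure (P0 p) {\<eta>. perc \<eta> 0 0 \<and> \<eta> \<in> B}" by (rule measure_mir) measurable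
  also have "\<dots> / \<rho> = measure Q {\<eta>. \<eta> \<in> B}" by (rule measure_Q[symmetric]) measurable
  finally show "emeasure (distr Q Q mir) B = emeasure Q B" by (simp add: Q.emeasure_eq_measure)
qed simp

lemma AE_Q_move:
  assumes V: "V \<in> measurable (P0 p) (count_space UNIV)" and inv: "distr Q Q (move V) = Q" and E: "AE \<eta> in Q. E \<eta>"
  shows "AE \<eta> in Q. E (move V \<eta>)"
proof (rule AE_distrD[of "move V" Q Q])
  show "move V \<in> measurable Q Q" using measurable_move[OF V] by (simp add: measurable_Q_iff)
  show "AE \<eta> in distr Q Q (move V). E \<eta>" using E by (simp only: inv)
qed

lemma AE_Q_mir: "AE \<eta> in Q. E \<eta> \<Longrightarrow> AE \<eta> in Q. E (mir \<eta>)"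
  by (rule AE_distrD[of mir Q Q]) (simp_all only: distr_mir_Q measurable_Q_iff measurable_mir)

definition meanL :: "(config \<Rightarrow> nat \<times> int) \<Rightarrow> real" where
  "meanL V = (\<integral>\<eta>. real (fst (V \<eta>)) \<partial>Q)"

definition meanY :: "(config \<Rightarrow> nat \<times> int) \<Rightarrow> real" where
  "meanY V = (\<integral>\<eta>. real_of_int (snd (V \<eta>)) \<partial>Q)"

lemma renewal_stepD:
  assumes "renewal_step V"
  shows "V \<in> measurable (P0 p) (count_space UNIV)" "move V \<in> measurable Q Q"
    "AE \<eta> in Q. 1 \<le> fst (V \<eta>) \<and> conn \<eta> (fst (V \<eta>)) 0 0 (snd (V \<eta>))"
    "distr Q Q (move V) = Q" "renewing Q (move V) (\<lambda>\<eta>. real (fst (V \<eta>)))"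
    "renewing Q (move V) (\<lambda>\<eta>. real_of_int (snd (V \<eta>)))"
  using assms measurable_move[of V p] unfolding renewal_step_def by (auto simp: measurable_Q_iff)

text \<open>Recentring is conjugated by the reflection, which preserves \<open>Q\<close>. The step
  gains the same level in mean, and its displacement is the level gained minus the original
  displacement.\<close>

lemma renewal_step_mirror_step:
  assumes V: "renewal_step V"
  shows "renewal_step (mirror_step V)" "meanL (mirror_step V) = meanL V" "meanY (mirror_step V) = meanL V - meanY V"
proof -
  note S = renewal_stepD[OF V]
  have mm[measurable]: "mir \<in> measurable Q Q" by (simp add: measurable_Q_iff)
  note [measurable] = S(1)
  have meas: "mirror_step V \<in> measurable (P0 p) (count_space UNIV)"
  proof -
    have "(\<lambda>\<eta>. V (mir \<eta>)) \<in> measurable (P0 p) (count_space UNIV)" by measurable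
    then have "(\<lambda>\<eta>. (\<lambda>v. (fst v, int (fst v) - snd v)) (V (mir \<eta>))) \<in> measurable (P0 p) (count_space UNIV)"
      by (rule measurable_compose) simp
    then show ?thesis by (simp add: mirror_step_def[abs_def])
  qed
  have mv: "move (mirror_step V) = (\<lambda>\<eta>. mir (move V (mir \<eta>)))" by (simp add: fun_eq_iff move_mirror_step)
  have ae: "AE \<eta> in Q. 1 \<le> fst (mirror_step V \<eta>) \<and> conn \<eta> (fst (mirror_step V \<eta>)) 0 0 (snd (mirror_step V \<eta>))"
    using AE_Q_mir[OF S(3)] by eventually_elim (simp add: mirror_step_def conn_mir)
  have "distr Q Q (move (mirror_step V)) = distr (distr Q Q (\<lambda>\<eta>. move V (mir \<eta>))) Q mir"
    unfolding mv using S(2) mm by (subst distr_distr) (auto simp: comp_def)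
  also have "distr Q Q (\<lambda>\<eta>. move V (mir \<eta>)) = distr (distr Q Q mir) Q (move V)"
    using S(2) mm by (subst distr_distr) (auto simp: comp_def)
  also have "distr (distr (distr Q Q mir) Q (move V)) Q mir = Q" by (simp only: distr_mir_Q S(4))
  finally have inv: "distr Q Q (move (mirror_step V)) = Q" .
  have rL: "renewing Q (move (mirror_step V)) (\<lambda>\<eta>. real (fst (mirror_step V \<eta>)))"
    unfolding mv mirror_step_def fst_conv by (rule renewing_conj[OF mm distr_mir_Q S(2,5)])
  have "renewing Q (move (mirror_step V)) (\<lambda>\<eta>. 1 * real (fst (V (mir \<eta>))) + (-1) * real_of_int (snd (V (mir \<eta>))))"
    unfolding mv
    by (rule renewing_lincomb[OF renewing_conj[OF mm distr_mir_Q S(2,5)] renewing_conj[OF mm distr_mir_Q S(2,6)]])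
      (use S(2) mm in measurable)
  then have rY: "renewing Q (move (mirror_step V)) (\<lambda>\<eta>. real_of_int (snd (mirror_step V \<eta>)))"
    by (simp add: mirror_step_def)
  show "renewal_step (mirror_step V)" unfolding renewal_step_def using meas ae inv rL rY by blast
  have iV: "integrable Q (\<lambda>\<eta>. real (fst (V \<eta>)))" "integrable Q (\<lambda>\<eta>. real_of_int (snd (V \<eta>)))"
    using S(5,6) by (auto simp: renewing_def)
  have via: "(\<integral>x. f (mir x) \<partial>Q) = (\<integral>x. f x \<partial>Q)" if "integrable Q f" for f :: "config \<Rightarrow> real"
    using integral_distr[OF mm borel_measurable_integrable[OF that]] by (simp only: distr_mir_Q)
  show "meanL (mirror_step V) = meanL V" unfolding meanL_def mirror_step_def fst_conv by (rule via[OF iV(1)])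
  have "meanY (mirror_step V) = (\<integral>\<eta>. real (fst (V (mir \<eta>))) - real_of_int (snd (V (mir \<eta>))) \<partial>Q)"
    by (simp add: meanY_def mirror_step_def)
  also have "\<dots> = (\<integral>\<eta>. real (fst (V \<eta>)) - real_of_int (snd (V \<eta>)) \<partial>Q)"
    by (rule via[of "\<lambda>\<eta>. real (fst (V \<eta>)) - real_of_int (snd (V \<eta>))"]) (use iV in simp)
  also have "\<dots> = meanL V - meanY V" using iV by (simp add: meanL_def meanY_def)
  finally show "meanY (mirror_step V) = meanL V - meanY V" .
qed

lemma renewal_step_seq_step:
  assumes V: "renewal_step V" and W: "renewal_step W"
  shows "renewal_step (seq_step V W)" "meanL (seq_step V W) = meanL V + meanL W" "meanY (seq_step V W) = meanY V + meanY W"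
proof -
  note S = renewal_stepD[OF V] and R = renewal_stepD[OF W]
  note [measurable] = S(1) R(1) measurable_move[OF S(1)]
  have meas: "seq_step V W \<in> measurable (P0 p) (count_space UNIV)"
    unfolding seq_step_def[abs_def]
  proof (rule measurable_compose_countable[where f="\<lambda>v \<eta>. v + W (move V \<eta>)" and g=V])
    fix v
    have "(\<lambda>\<eta>. W (move V \<eta>)) \<in> measurable (P0 p) (count_space UNIV)" by measurable
    then show "(\<lambda>\<eta>. v + W (move V \<eta>)) \<in> measurable (P0 p) (count_space UNIV)"
      by (rule measurable_compose) simp
  qed (rule S(1))
  have mv: "move (seq_step V W) = (\<lambda>\<eta>. move W (move V \<eta>))" by (simp add: fun_eq_iff move_seq_step)
  have ae: "AE \<eta> in Q. 1 \<le> fst (seq_step V W \<eta>) \<and> conn \<eta> (fst (seq_step V W \<eta>)) 0 0 (snd (seq_step V W \<eta>))"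
    using S(3) AE_Q_move[OF S(1,4) R(3)]
  proof eventually_elim
    case (elim \<eta>)
    let ?v = "V \<eta>" and ?w = "W (move V \<eta>)"
    have "conn \<eta> (fst ?w) (fst ?v) (snd ?v) (snd ?w + snd ?v)"
      using elim(2) by (simp add: move_def conn_sh)
    then have "conn \<eta> (fst ?v + fst ?w) 0 0 (snd ?w + snd ?v)"
      using elim(1) unfolding conn_add add_0 by blast
    then show ?case using elim(1) by (simp add: seq_step_def add.commute)
  qed
  have "distr Q Q (move (seq_step V W)) = distr (distr Q Q (move V)) Q (move W)"
    unfolding mv using S(2) R(2) by (subst distr_distr) (auto simp: comp_def)
  also have "\<dots> = Q" by (simp only: S(4) R(4))
  finally have inv: "distr Q Q (move (seq_step V W)) = Q" .
  have rL: "renewing Q (move (seq_step V W)) (\<lambda>\<eta>. real (fst (seq_step V W \<eta>)))"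
    using renewing_seq(1)[OF S(2,4) R(2,4) S(5) R(5)] by (simp add: mv seq_step_def)
  have rY: "renewing Q (move (seq_step V W)) (\<lambda>\<eta>. real_of_int (snd (seq_step V W \<eta>)))"
    using renewing_seq(1)[OF S(2,4) R(2,4) S(6) R(6)] by (simp add: mv seq_step_def)
  show "renewal_step (seq_step V W)" unfolding renewal_step_def using meas ae inv rL rY by blast
  show "meanL (seq_step V W) = meanL V + meanL W"
    using renewing_seq(2)[OF S(2,4) R(2,4) S(5) R(5)] by (simp add: meanL_def seq_step_def)
  show "meanY (seq_step V W) = meanY V + meanY W"
    using renewing_seq(2)[OF S(2,4) R(2,4) S(6) R(6)] by (simp add: meanY_def seq_step_def)
qed

lemma renewal_step_pow_step:
  assumes V: "renewal_step V"
  shows "renewal_step (pow_step V n)" "meanL (pow_step V n) = real (Suc n) * meanL V" "meanY (pow_step V n) = real (Suc n) * meanY V"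
  by (induction n) (simp_all add: V renewal_step_seq_step algebra_simps)

lemma AE_Q_funpow:
  assumes V: "renewal_step V" and E: "AE \<eta> in Q. E \<eta>"
  shows "AE \<eta> in Q. \<forall>n. E ((move V ^^ n) \<eta>)"
  unfolding AE_all_countable
proof
  fix n
  show "AE \<eta> in Q. E ((move V ^^ n) \<eta>)"
  proof (induction n)
    case (Suc n)
    show ?case using AE_Q_move[OF renewal_stepD(1,4)[OF V] Suc] by (simp add: funpow_swap1)
  qed (use E in simp)
qed

lemma meanL_pos:
  assumes V: "renewal_step V"
  shows "1 \<le> meanL V"
proof -
  have i: "integrable Q (\<lambda>\<eta>. real (fst (V \<eta>)))" using renewal_stepD(5)[OF V] by (simp add: renewing_def)
  have "(\<integral>\<eta>. 1 \<partial>Q) \<le> meanL V"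
    unfolding meanL_def
  proof (rule integral_mono_AE)
    show "AE \<eta> in Q. 1 \<le> real (fst (V \<eta>))" using renewal_stepD(3)[OF V] by eventually_elim simp
  qed (use i in auto)
  then show ?thesis using Q.prob_space by simp
qed

lemma posn_asymptotics:
  assumes V: "renewal_step V"
  shows "AE \<eta> in Q. strict_mono (\<lambda>n. fst (posn V n \<eta>)) \<and>
    (\<forall>n. conn \<eta> (fst (posn V (Suc n) \<eta>) - fst (posn V n \<eta>)) (fst (posn V n \<eta>))
       (snd (posn V n \<eta>)) (snd (posn V (Suc n) \<eta>))) \<and>
    (\<lambda>n. real (fst (posn V n \<eta>)) / real n) \<longlonglongrightarrow> meanL V \<and>
    (\<lambda>n. real_of_int (snd (posn V n \<eta>)) / real n) \<longlonglongrightarrow> meanY V"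
  using AE_Q_funpow[OF V renewal_stepD(3)[OF V]]
    renewing_average[OF prob_space_Q renewal_stepD(2)[OF V] renewal_stepD(4)[OF V] renewal_stepD(5)[OF V]]
    renewing_average[OF prob_space_Q renewal_stepD(2)[OF V] renewal_stepD(4)[OF V] renewal_stepD(6)[OF V]]
proof eventually_elim
  case (elim \<eta>)
  have "strict_mono (\<lambda>n. fst (posn V n \<eta>))"
    unfolding strict_mono_Suc_iff using elim(1) by (simp add: Suc_le_lessD)
  moreover have "conn \<eta> (fst (posn V (Suc n) \<eta>) - fst (posn V n \<eta>)) (fst (posn V n \<eta>))
       (snd (posn V n \<eta>)) (snd (posn V (Suc n) \<eta>))" for n
    using elim(1)[rule_format, of n] by (simp add: funpow_move conn_sh add.commute)
  ultimately show ?case using elim(2,3) by (simp add: posn_sums meanL_def meanY_def)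
qed

lemma path_along_renewal_step:
  assumes V: "renewal_step V"
  shows "AE \<eta> in Q. \<exists>h. opath \<eta> 0 h \<and> h 0 = 0 \<and>
    (\<lambda>k. real_of_int (h k) / real k) \<longlonglongrightarrow> meanY V / meanL V"
  using posn_asymptotics[OF V]
proof eventually_elim
  case (elim \<eta>)
  define S where "S = (\<lambda>n. fst (posn V n \<eta>))"
  define Y where "Y = (\<lambda>n. snd (posn V n \<eta>))"
  have S: "strict_mono S" and c: "\<And>n. conn \<eta> (S (Suc n) - S n) (S n) (Y n) (Y (Suc n))"
    and L: "(\<lambda>n. real (S n) / real n) \<longlonglongrightarrow> meanL V" "(\<lambda>n. real_of_int (Y n) / real n) \<longlonglongrightarrow> meanY V"
    using elim by (auto simp: S_def Y_def)
  have S0: "S 0 = 0" "Y 0 = 0" by (auto simp: S_def Y_def)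
  have "\<forall>n. \<exists>g. g (S n) = Y n \<and> g (S (Suc n)) = Y (Suc n) \<and>
    (\<forall>k. S n \<le> k \<longrightarrow> k < S (Suc n) \<longrightarrow> step \<eta> k (g k) (g (Suc k)))"
  proof
    fix n
    have "S n + (S (Suc n) - S n) = S (Suc n)" using strict_monoD[OF S, of n "Suc n"] by simp
    then show "\<exists>g. g (S n) = Y n \<and> g (S (Suc n)) = Y (Suc n) \<and>
      (\<forall>k. S n \<le> k \<longrightarrow> k < S (Suc n) \<longrightarrow> step \<eta> k (g k) (g (Suc k)))"
      using conn_function[OF c[of n]] by simp
  qed
  then obtain g where g: "\<And>n. g n (S n) = Y n" "\<And>n. g n (S (Suc n)) = Y (Suc n)"
    "\<And>n k. S n \<le> k \<Longrightarrow> k < S (Suc n) \<Longrightarrow> step \<eta> k (g n k) (g n (Suc k))" by metis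
  have "\<exists>h. opath \<eta> (S 0) h \<and> (\<forall>j k. S j \<le> k \<longrightarrow> k \<le> S (Suc j) \<longrightarrow> h k = g j k)"
    by (rule opath_concat[OF S]) (use g in auto)
  then obtain h where h: "opath \<eta> 0 h" "\<And>j k. S j \<le> k \<Longrightarrow> k \<le> S (Suc j) \<Longrightarrow> h k = g j k"
    using S0 by auto
  have hY: "h (S j) = Y j" for j
    using h(2)[of j "S j"] g(1) strict_monoD[OF S, of j "Suc j"] by simp
  have "(\<lambda>k. real_of_int (h k) / real k) \<longlonglongrightarrow> meanY V / meanL V"
  proof (rule slope_along_times[OF S S0(1) _ _ hY L(1) _ L(2)])
    show "h 0 = 0" using hY[of 0] S0 by simp
    show "h k \<le> h (Suc k)" for k using opath_steps[OF h(1), of k] by simp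
    show "0 < meanL V" using meanL_pos[OF V] by simp
  qed
  then show ?case using h(1) hY[of 0] S0 by auto
qed

text \<open>Slopes are limits of \<open>i / n\<close> for sites \<open>(n, i)\<close>: slope
  \<open>s\<close> belongs to the direction \<open>(s, 1 - s)\<close>, and the reflection turns it
  into \<open>1 - s\<close>. This constant is the slope of the rightmost path.\<close>

definition \<beta> :: real where "\<beta> = meanY break_step / meanL break_step"

text \<open>The rightmost path runs through all successive breaks, because its continuation from a
  break is the rightmost path of the recentred configuration. The law of large numbers for the
  breaks then fixes its slope.\<close>

lemma rpath_speed: "AE \<eta> in Q. (\<lambda>k. real_of_int (rpath \<eta> 0 0 k) / real k) \<longlonglongrightarrow> \<beta>"
proof -
  have p0: "AE \<eta> in Q. perc \<eta> 0 0" unfolding AE_Q by simp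
  show ?thesis
    using posn_asymptotics[OF renewal_step_break_step] AE_Q_funpow[OF renewal_step_break_step AE_first_break] p0
  proof eventually_elim
    case (elim \<eta>)
    let ?z = "\<lambda>n. posn break_step n \<eta>"
    have hY: "rpath \<eta> 0 0 (fst (?z n)) = snd (?z n)" for n
    proof (induction n)
      case (Suc n)
      let ?v = "break_step (sh (?z n) \<eta>)"
      have z: "?z (Suc n) = ?z n + ?v" by (simp add: funpow_move)
      have "rpath (sh (?z n) \<eta>) 0 0 (fst ?v) = snd ?v"
        using elim(2)[rule_format, of n] by (intro rpath_first_break) (simp add: funpow_move)
      then have "rpath \<eta> (fst (?z n)) (rpath \<eta> 0 0 (fst (?z n))) (fst (?z (Suc n))) = snd (?z (Suc n))"
        unfolding Suc.IH z by (simp add: rpath_sh add.commute)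
      then show ?case by (subst (asm) rpath_compose) (simp_all add: z)
    qed simp
    show ?case unfolding \<beta>_def
    proof (rule slope_along_times[where S="\<lambda>n. fst (?z n)" and Y="\<lambda>n. snd (?z n)"])
      show "rpath \<eta> 0 0 (fst (?z n)) = snd (?z n)" for n by (rule hY)
      show "rpath \<eta> 0 0 k \<le> rpath \<eta> 0 0 (Suc k)" for k by simp
      show "0 < meanL break_step" using meanL_pos[OF renewal_step_break_step] by simp
    qed (use elim in auto)
  qed
qed

text \<open>The cycle of \<open>b + 1\<close> break steps and \<open>c + 1\<close> mirrored ones is
  again a \<open>renewal_step\<close>. Both kinds gain the same level in mean, so the slopes
  \<open>\<beta>\<close> and \<open>1 - \<beta>\<close> are weighted by the numbers of
  steps.\<close>

lemma path_of_mixed_slope: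
  "AE \<eta> in Q. \<exists>h. opath \<eta> 0 h \<and> h 0 = 0 \<and> (\<lambda>k. real_of_int (h k) / real k) \<longlonglongrightarrow>
     (real (Suc b) * \<beta> + real (Suc c) * (1 - \<beta>)) / (real (Suc b) + real (Suc c))"
proof -
  let ?V = "seq_step (pow_step break_step b) (pow_step (mirror_step break_step) c)"
  note m = renewal_step_mirror_step[OF renewal_step_break_step]
  note pr = renewal_step_pow_step[OF renewal_step_break_step, of b] and pl = renewal_step_pow_step[OF m(1), of c]
  note s = renewal_step_seq_step[OF pr(1) pl(1)]
  have L: "meanL break_step > 0" using meanL_pos[OF renewal_step_break_step] by simp
  have Y: "meanY break_step = \<beta> * meanL break_step" using L by (simp add: \<beta>_def)
  have pos: "real (Suc b) + real (Suc c) > 0" by simp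
  have "meanY ?V / meanL ?V =
    ((real (Suc b) * \<beta> + real (Suc c) * (1 - \<beta>)) * meanL break_step) / ((real (Suc b) + real (Suc c)) * meanL break_step)"
    unfolding s(2,3) pr(2,3) pl(2,3) m(2,3) Y by (simp add: algebra_simps)
  also have "\<dots> = (real (Suc b) * \<beta> + real (Suc c) * (1 - \<beta>)) / (real (Suc b) + real (Suc c))"
    using L by (intro mult_divide_mult_cancel_right) simp
  finally have e: "meanY ?V / meanL ?V = (real (Suc b) * \<beta> + real (Suc c) * (1 - \<beta>)) / (real (Suc b) + real (Suc c))" .
  show ?thesis using path_along_renewal_step[OF s(1)] unfolding e .
qed

end

section \<open>Coalescence of rightmost paths\<close>

definition apart :: "config \<Rightarrow> nat \<Rightarrow> int \<Rightarrow> int \<Rightarrow> bool" where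
  "apart \<eta> n i j \<longleftrightarrow> perc \<eta> n i \<and> perc \<eta> n j \<and> (\<forall>k\<ge>n. rpath \<eta> n i k \<noteq> rpath \<eta> n j k)"

lemma measurable_apart[measurable]: "Measurable.pred (P0 p) (\<lambda>\<eta>. apart \<eta> n i j)"
  unfolding apart_def by measurable

lemma rpath_monotone: "perc \<eta> n i \<Longrightarrow> i \<le> j \<Longrightarrow> n \<le> k \<Longrightarrow> rpath \<eta> n i k \<le> rpath \<eta> n j k"
  by (rule rpath_max[OF rpath_opath]) (auto simp: rpath_start)

lemma apart_less: "apart \<eta> n i j \<Longrightarrow> i < j \<Longrightarrow> n \<le> k \<Longrightarrow> rpath \<eta> n i k < rpath \<eta> n j k"
  using rpath_monotone[of \<eta> n i j k] by (auto simp: apart_def order_less_le)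

lemma apart_sh: "apart (sh v \<eta>) n i j \<longleftrightarrow> apart \<eta> (n + fst v) (i + snd v) (j + snd v)"
proof -
  have "(\<forall>k\<ge>n. rpath \<eta> (n + fst v) (i + snd v) (k + fst v) \<noteq> rpath \<eta> (n + fst v) (j + snd v) (k + fst v)) \<longleftrightarrow>
    (\<forall>k\<ge>n + fst v. rpath \<eta> (n + fst v) (i + snd v) k \<noteq> rpath \<eta> (n + fst v) (j + snd v) k)" (is "?L \<longleftrightarrow> ?R")
  proof
    assume l: ?L
    show ?R
    proof (intro allI impI)
      fix k assume "n + fst v \<le> k"
      then show "rpath \<eta> (n + fst v) (i + snd v) k \<noteq> rpath \<eta> (n + fst v) (j + snd v) k"
        using l[rule_format, of "k - fst v"] by simp
    qed
  qed simp
  then show ?thesis by (simp add: apart_def perc_sh rpath_sh)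
qed

text \<open>The two edges that end at site \<open>(1, k)\<close> come from \<open>(0, k - 1)\<close>
  and \<open>(0, k)\<close>. So no open edge enters level 1 strictly between \<open>i\<close> and
  \<open>j\<close>.\<close>

definition closed_below :: "config \<Rightarrow> int \<Rightarrow> int \<Rightarrow> bool" where
  "closed_below \<eta> i j \<longleftrightarrow> (\<forall>k. i < k \<and> k < j \<longrightarrow> \<not> \<eta> (0, k - 1, True) \<and> \<not> \<eta> (0, k, False))"

lemma measurable_closed_below[measurable]: "Measurable.pred (P0 p) (\<lambda>\<eta>. closed_below \<eta> i j)"
  unfolding closed_below_def by measurable

lemma measure_closed_edge: "0 \<le> p \<Longrightarrow> p \<le> 1 \<Longrightarrow> measure (P0 p) {\<eta>. \<not> \<eta> e} = 1 - p"
proof -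
  assume p: "0 \<le> p" "p \<le> 1"
  have d: "distr (P0 p) (measure_pmf (bernoulli_pmf p)) (\<lambda>\<eta>. \<eta> e) = measure_pmf (bernoulli_pmf p)"
    unfolding P0_def by (rule distr_PiM_component) (auto intro: measure_pmf.prob_space_axioms)
  have rv: "(\<lambda>\<eta>. \<eta> e) \<in> measurable (P0 p) (measure_pmf (bernoulli_pmf p))"
    unfolding P0_def by (rule measurable_component_singleton) simp
  have *: "measure (P0 p) {\<eta>. \<eta> e = b} = pmf (bernoulli_pmf p) b" for b
  proof -
    have "pmf (bernoulli_pmf p) b = measure (distr (P0 p) (measure_pmf (bernoulli_pmf p)) (\<lambda>\<eta>. \<eta> e)) {b}"
      by (simp add: d pmf.rep_eq)
    also have "\<dots> = measure (P0 p) ((\<lambda>\<eta>. \<eta> e) -` {b} \<inter> space (P0 p))"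
      by (rule measure_distr[OF rv]) simp
    finally show ?thesis by (simp add: vimage_def)
  qed
  show "measure (P0 p) {\<eta>. \<not> \<eta> e} = 1 - p" using *[of False] p by simp
qed

lemma closed_edges_pos:
  assumes "finite F" "0 \<le> p" "p < 1"
  shows "0 < measure (P0 p) {\<eta>. \<forall>e\<in>F. \<not> \<eta> e}"
  using assms(1)
proof induction
  case empty
  show ?case using prob_space.prob_space[OF prob_space_P0] by simp
next
  case (insert x F)
  have m: "Measurable.pred (P0 p) (\<lambda>\<eta>. \<forall>e\<in>F. \<not> \<eta> e)"
    using insert.hyps(1) by (intro pred_intros_finite) measurable
  have "measure (P0 p) {\<eta>. \<not> \<eta> x \<and> (\<forall>e\<in>F. \<not> \<eta> e)} =
    measure (P0 p) {\<eta>. \<not> \<eta> x} * measure (P0 p) {\<eta>. \<forall>e\<in>F. \<not> \<eta> e}"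
  proof (rule measure_indep[where A="{x}" and B=F])
    show "(\<forall>e\<in>F. \<not> \<eta> e) = (\<forall>e\<in>F. \<not> \<eta>' e)" if "\<And>e. e \<in> F \<Longrightarrow> \<eta> e = \<eta>' e" for \<eta> \<eta>' :: config
      using that by blast
  qed (use insert.hyps m in auto)
  then show ?case using insert.IH measure_closed_edge[of p x] assms by simp
qed

lemma closed_below_pos:
  assumes "0 \<le> p" "p < 1"
  shows "0 < measure (P0 p) {\<eta>. closed_below \<eta> i j}"
proof -
  let ?F = "(\<lambda>k. (0, k - 1, True)) ` {i<..<j} \<union> (\<lambda>k. (0, k, False)) ` {i<..<j} :: (nat \<times> int \<times> bool) set"
  have "{\<eta>. closed_below \<eta> i j} = {\<eta>. \<forall>e\<in>?F. \<not> \<eta> e}"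
    by (force simp: closed_below_def)
  then show ?thesis using closed_edges_pos[of ?F p] assms by simp
qed

text \<open>By stationarity the left-hand side is the expected number of \<open>u\<close> in
  \<open>U\<close> for which the translated event occurs.\<close>

lemma card_times_measure_le:
  fixes U :: "(nat \<times> int) set"
  assumes "finite U" and E[measurable]: "Measurable.pred (P0 p) E"
    and c: "AE \<eta> in P0 p. real (card {u \<in> U. E (sh u \<eta>)}) \<le> c"
  shows "real (card U) * measure (P0 p) {\<eta>. E \<eta>} \<le> c"
proof -
  interpret prob_space "P0 p" by (rule prob_space_P0)
  have s: "{\<eta>. E (sh u \<eta>)} \<in> sets (P0 p)" for u by (rule setsP) measurable
  have e: "real (card {u \<in> U. E (sh u \<eta>)}) = (\<Sum>u\<in>U. indicator {\<eta>. E (sh u \<eta>)} \<eta>)" for \<eta>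
    using assms(1) by (simp add: indicator_def sum.If_cases Int_def)
  have "real (card U) * measure (P0 p) {\<eta>. E \<eta>} = (\<Sum>u\<in>U. measure (P0 p) {\<eta>. E (sh u \<eta>)})"
    by (simp add: measure_sh)
  also have "\<dots> = (\<integral>\<eta>. (\<Sum>u\<in>U. indicator {\<eta>. E (sh u \<eta>)} \<eta>) \<partial>P0 p)"
    using s by (subst Bochner_Integration.integral_sum) (auto simp: emeasure_eq_measure)
  also have "\<dots> \<le> (\<integral>\<eta>. c \<partial>P0 p)"
    using s c by (intro integral_mono_AE) (auto simp: e emeasure_eq_measure)
  finally show ?thesis using prob_space by simp
qed

text \<open>Burton--Keane argument: if three rightmost paths from level 1 stay apart and no open edge enters
  between the outer two from below, then the middle path meets no rightmost path started elsewhere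
  in such a configuration; so there are at most as many of them as sites at a later level.\<close>

lemma no_three_apart:
  assumes p: "0 \<le> p" "p < 1" and i: "i1 < i2" "i2 < i3"
  shows "measure (P0 p) {\<eta>. apart \<eta> 0 i1 i2 \<and> apart \<eta> 0 i2 i3} = 0"
proof -
  \<comment> \<open>The triple is moved to level 1, where it is independent of the edges below. As
    \<open>p < 1\<close>, closing those has positive probability, so it suffices to show that
    \<open>E\<close> is null.\<close>
  define E where "E = (\<lambda>\<eta>. closed_below \<eta> i1 i3 \<and> apart (sh (1, 0) \<eta>) 0 i1 i2 \<and> apart (sh (1, 0) \<eta>) 0 i2 i3)"
  have E[measurable]: "Measurable.pred (P0 p) E" unfolding E_def by measurable
  have PE: "measure (P0 p) {\<eta>. E \<eta>} =
    measure (P0 p) {\<eta>. closed_below \<eta> i1 i3} * measure (P0 p) {\<eta>. apart \<eta> 0 i1 i2 \<and> apart \<eta> 0 i2 i3}"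
    unfolding E_def
  proof (rule measure_past_future)
    show "closed_below \<eta> i1 i3 = closed_below \<eta>' i1 i3"
      if "\<And>e. fst e < fst (1::nat, 0::int) \<Longrightarrow> \<eta> e = \<eta>' e" for \<eta> \<eta>'
      unfolding closed_below_def using that by simp
  qed measurable
  \<comment> \<open>A horizontal spacing larger than the width of a triple, so that translates on
    the same level do not overlap.\<close>
  define m where "m = i3 - i1 + 1"
  have m: "0 < m" "i3 - i1 < m" using i by (auto simp: m_def)
  have key: "real N * real N * measure (P0 p) {\<eta>. E \<eta>} \<le> real N * (real_of_int m + 1) + 2" for N :: nat
  proof -
    \<comment> \<open>There are \<open>N * N\<close> translates, but distinct occurrences of
      \<open>E\<close> among them have distinct middle paths at level \<open>N + 1\<close>, all in
      an interval of length of order \<open>N\<close>.\<close>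
    define U where "U = (\<lambda>(a, b). (a, m * int b)) ` ({..<N} \<times> {..<N})"
    have injU: "inj_on (\<lambda>(a, b). (a, m * int b)) ({..<N} \<times> {..<N})"
      using m(1) by (auto simp: inj_on_def)
    have cU: "card U = N * N" unfolding U_def by (subst card_image[OF injU]) (simp add: card_cartesian_product)
    have "real (card {u \<in> U. E (sh u \<eta>)}) \<le> real N * (real_of_int m + 1) + 2" for \<eta>
    proof -
      define \<xi> where "\<xi> = (\<lambda>u::nat \<times> int. rpath \<eta> (Suc (fst u)) (i2 + snd u))"
      let ?W = "{u \<in> U. E (sh u \<eta>)}"
      have W: "apart \<eta> (Suc (fst u)) (i1 + snd u) (i2 + snd u)" "apart \<eta> (Suc (fst u)) (i2 + snd u) (i3 + snd u)"
        "\<And>k. i1 + snd u < k \<Longrightarrow> k < i3 + snd u \<Longrightarrow> \<not> \<eta> (fst u, k - 1, True) \<and> \<not> \<eta> (fst u, k, False)"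
        if "E (sh u \<eta>)" for u
      proof -
        show "apart \<eta> (Suc (fst u)) (i1 + snd u) (i2 + snd u)" "apart \<eta> (Suc (fst u)) (i2 + snd u) (i3 + snd u)"
          using that by (auto simp: E_def apart_sh)
        fix k assume k: "i1 + snd u < k" "k < i3 + snd u"
        have "closed_below (sh u \<eta>) i1 i3" using that by (simp add: E_def)
        then show "\<not> \<eta> (fst u, k - 1, True) \<and> \<not> \<eta> (fst u, k, False)"
          using k unfolding closed_below_def by (auto simp: sh_def dest!: spec[of _ "k - snd u"])
      qed
      \<comment> \<open>On the level where the later triple starts, the earlier middle path cannot
        be strictly between its outer starting sites. The outer path on its side then keeps it
        strictly away from the later middle path.\<close>
      have sep: "\<xi> u k \<noteq> \<xi> u' k"
        if u: "u \<in> ?W" "u' \<in> ?W" "fst u < fst u' \<or> fst u = fst u' \<and> snd u < snd u'" and k: "Suc (fst u') \<le> k" for u u' k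
      proof -
        let ?n = "Suc (fst u')"
        define y where "y = \<xi> u ?n"
        note W1 = W[of u] and W2 = W[of u']
        have Eu: "E (sh u \<eta>)" "E (sh u' \<eta>)" using u by auto
        have pu: "perc \<eta> (Suc (fst u)) (i2 + snd u)" using W1(1)[OF Eu(1)] by (simp add: apart_def)
        have le: "Suc (fst u) \<le> ?n" using u(3) by auto
        have py: "perc \<eta> ?n y" unfolding y_def \<xi>_def by (rule rpath_perc[OF pu le])
        have \<xi>y: "\<xi> u k = rpath \<eta> ?n y k"
          unfolding y_def \<xi>_def by (rule rpath_compose[symmetric, OF le k])
        have "y \<le> i1 + snd u' \<or> i3 + snd u' \<le> y"
          using u(3)
        proof
          assume lt: "fst u < fst u'"
          have st: "step \<eta> (fst u') (\<xi> u (fst u')) y"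
            using rpath_opath[OF pu] lt unfolding opath_def y_def \<xi>_def by simp
          show ?thesis
          proof (rule ccontr)
            assume "\<not> ?thesis"
            then show False using st W2(3)[OF Eu(2), of y] by (auto simp: step_def)
          qed
        next
          assume eq: "fst u = fst u' \<and> snd u < snd u'"
          then have y: "y = i2 + snd u" unfolding y_def \<xi>_def by (simp add: rpath_start)
          have "\<exists>b. snd w = m * int b" if "w \<in> ?W" for w using that unfolding U_def by force
          then obtain b b' where b: "snd u = m * int b" "snd u' = m * int b'" using u(1,2) by blast
          then have "int b + 1 \<le> int b'" using eq m(1) by auto
          then have "m * (int b + 1) \<le> m * int b'" using m(1) by (intro mult_left_mono) auto
          then show ?thesis using y b m(2) i by (simp add: algebra_simps)
        qed
        then show ?thesis
        proof
          assume y: "y \<le> i1 + snd u'"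
          have "rpath \<eta> ?n y k \<le> rpath \<eta> ?n (i1 + snd u') k" by (rule rpath_monotone[OF py y k])
          also have "\<dots> < rpath \<eta> ?n (i2 + snd u') k" using W2(1)[OF Eu(2)] i k by (intro apart_less) auto
          finally show ?thesis unfolding \<xi>y by (simp add: \<xi>_def)
        next
          assume y: "i3 + snd u' \<le> y"
          have "rpath \<eta> ?n (i2 + snd u') k < rpath \<eta> ?n (i3 + snd u') k"
            using W2(2)[OF Eu(2)] i k by (intro apart_less) auto
          also have "\<dots> \<le> rpath \<eta> ?n y k"
            using W2(2)[OF Eu(2)] by (intro rpath_monotone y k) (simp add: apart_def)
          finally show ?thesis unfolding \<xi>y by (simp add: \<xi>_def)
        qed
      qed
      have fU: "fst u < N" "0 \<le> snd u" "snd u \<le> m * int N" if "u \<in> U" for u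
        using that m(1) unfolding U_def by (auto intro: mult_left_mono)
      have "inj_on (\<lambda>u. \<xi> u (Suc N)) ?W"
      proof (rule inj_onI, rule ccontr)
        fix u u' assume u: "u \<in> ?W" "u' \<in> ?W" "\<xi> u (Suc N) = \<xi> u' (Suc N)" "u \<noteq> u'"
        have lv: "Suc (fst u) \<le> Suc N" "Suc (fst u') \<le> Suc N" using fU(1)[of u] fU(1)[of u'] u(1,2) by auto
        have "(fst u < fst u' \<or> fst u = fst u' \<and> snd u < snd u') \<or> (fst u' < fst u \<or> fst u' = fst u \<and> snd u' < snd u)"
          using u(4) by (cases u, cases u') auto
        then show False using sep[OF u(1,2) _ lv(2)] sep[OF u(2,1) _ lv(1)] u(3) by auto
      qed
      moreover have "(\<lambda>u. \<xi> u (Suc N)) ` ?W \<subseteq> {i2 .. i2 + m * int N + int N}"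
      proof
        fix x assume "x \<in> (\<lambda>u. \<xi> u (Suc N)) ` ?W"
        then obtain u where u: "u \<in> U" "E (sh u \<eta>)" "x = \<xi> u (Suc N)" by auto
        have pu: "perc \<eta> (Suc (fst u)) (i2 + snd u)" using W(1)[OF u(2)] by (simp add: apart_def)
        have l: "Suc (fst u) + (N - fst u) = Suc N" using fU(1)[OF u(1)] by simp
        have "conn \<eta> (N - fst u) (Suc (fst u)) (\<xi> u (Suc (fst u))) (\<xi> u (Suc (fst u) + (N - fst u)))"
          unfolding \<xi>_def by (rule opath_conn[OF rpath_opath[OF pu]]) simp
        then have "i2 + snd u \<le> x \<and> x \<le> i2 + snd u + int (N - fst u)"
          using conn_bounds u(3) unfolding l by (fastforce simp: \<xi>_def rpath_start)
        then show "x \<in> {i2 .. i2 + m * int N + int N}" using fU[OF u(1)] by auto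
      qed
      ultimately have "card ?W \<le> card {i2 .. i2 + m * int N + int N}"
        by (intro card_inj_on_le) auto
      also have "\<dots> = nat (m * int N + int N + 1)" by simp
      finally have "int (card ?W) \<le> m * int N + int N + 1" using m(1) by (simp add: nat_le_iff le_nat_iff)
      then have "real_of_int (int (card ?W)) \<le> real_of_int (m * int N + int N + 1)" by (simp only: of_int_le_iff)
      then show ?thesis by (simp add: algebra_simps)
    qed
    then have "real (card U) * measure (P0 p) {\<eta>. E \<eta>} \<le> real N * (real_of_int m + 1) + 2"
      by (intro card_times_measure_le E) (auto simp: U_def)
    then show ?thesis by (simp add: cU)
  qed
  have "measure (P0 p) {\<eta>. E \<eta>} \<le> 0"
  proof (rule LIMSEQ_le_const)
    have "(\<lambda>N. (real_of_int m + 1) * (1 / real (Suc N)) + 2 * (1 / real (Suc N) * (1 / real (Suc N)))) \<longlonglongrightarrow>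
        (real_of_int m + 1) * 0 + 2 * (0 * 0)"
      by (intro tendsto_intros LIMSEQ_Suc[OF lim_1_over_n])
    then show "(\<lambda>N. (real_of_int m + 1) * (1 / real (Suc N)) + 2 * (1 / real (Suc N) * (1 / real (Suc N)))) \<longlonglongrightarrow> 0"
      by simp
    have "measure (P0 p) {\<eta>. E \<eta>} \<le> (real_of_int m + 1) * (1 / real (Suc N)) + 2 * (1 / real (Suc N) * (1 / real (Suc N)))" for N
    proof -
      have "(real (Suc N) * real (Suc N)) * measure (P0 p) {\<eta>. E \<eta>} \<le>
         (real (Suc N) * real (Suc N)) * ((real_of_int m + 1) * (1 / real (Suc N)) + 2 * (1 / real (Suc N) * (1 / real (Suc N))))"
      proof -
        have "(x * x) * ((real_of_int m + 1) * (1 / x) + 2 * (1 / x * (1 / x))) = x * (real_of_int m + 1) + 2"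
          if "x \<noteq> 0" for x :: real using that by (simp add: field_simps)
        from this[of "real (Suc N)"] show ?thesis using key[of "Suc N"] by simp
      qed
      then show ?thesis by (rule mult_left_le_imp_le) (simp del: of_nat_Suc)
    qed
    then show "\<exists>N. \<forall>n\<ge>N. measure (P0 p) {\<eta>. E \<eta>} \<le>
       (real_of_int m + 1) * (1 / real (Suc n)) + 2 * (1 / real (Suc n) * (1 / real (Suc n)))" by blast
  qed
  then have "measure (P0 p) {\<eta>. E \<eta>} = 0" by (simp add: measure_le_0_iff)
  then show ?thesis using PE closed_below_pos[OF p, of i1 i3] by simp
qed

lemma AE_no_three_apart:
  assumes p: "0 \<le> p" "p < 1"
  shows "AE \<eta> in P0 p. \<forall>i j k. i < j \<longrightarrow> j < k \<longrightarrow> \<not> (apart \<eta> 0 i j \<and> apart \<eta> 0 j k)"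
  unfolding AE_all_countable
proof (intro allI)
  fix i j k
  interpret prob_space "P0 p" by (rule prob_space_P0)
  show "AE \<eta> in P0 p. i < j \<longrightarrow> j < k \<longrightarrow> \<not> (apart \<eta> 0 i j \<and> apart \<eta> 0 j k)"
  proof (cases "i < j \<and> j < k")
    case True
    have "{\<eta>. apart \<eta> 0 i j \<and> apart \<eta> 0 j k} \<in> events" by (rule setsP) measurable
    then have "AE \<eta> in P0 p. \<eta> \<notin> {\<eta>. apart \<eta> 0 i j \<and> apart \<eta> 0 j k}"
      using no_three_apart[OF p, of i j k] True by (simp add: prob_eq_0)
    then show ?thesis by eventually_elim simp
  qed auto
qed

text \<open>Among translates of the pair by multiples of its width at most one can stay apart. Given
  two, the right path of the left pair must meet that of the right pair, as otherwise three paths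
  would stay apart; but the left path of the right pair strictly separates them. So \<open>N\<close>
  times the probability is at most 1 for every \<open>N\<close>.\<close>

lemma no_two_apart:
  assumes p: "0 \<le> p" "p < 1" and ij: "i < j"
  shows "measure (P0 p) {\<eta>. apart \<eta> 0 i j} = 0"
proof -
  define m where "m = j - i"
  have m: "0 < m" using ij by (simp add: m_def)
  have key: "real N * measure (P0 p) {\<eta>. apart \<eta> 0 i j} \<le> 1" for N :: nat
  proof -
    define U where "U = (\<lambda>b. (0::nat, m * int b)) ` {..<N}"
    have cU: "card U = N" unfolding U_def using m by (subst card_image) (auto simp: inj_on_def)
    have fU: "finite U" by (simp add: U_def)
    have "AE \<eta> in P0 p. real (card {u \<in> U. apart (sh u \<eta>) 0 i j}) \<le> 1"
      using AE_no_three_apart[OF p]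
    proof eventually_elim
      case (elim \<eta>)
      have no: "False" if u: "u \<in> U" "apart (sh u \<eta>) 0 i j" "u' \<in> U" "apart (sh u' \<eta>) 0 i j" "snd u < snd u'" for u u'
      proof -
        have f0: "fst u = 0" "fst u' = 0" using u unfolding U_def by auto
        have "\<exists>b. snd w = m * int b" if "w \<in> U" for w using that unfolding U_def by force
        then obtain b b' where b: "snd u = m * int b" "snd u' = m * int b'" using u(1,3) by blast
        then have "int b + 1 \<le> int b'" using u(5) m by auto
        then have "m * (int b + 1) \<le> m * int b'" using m by (intro mult_left_mono) auto
        then have le: "j + snd u \<le> i + snd u'" unfolding b by (simp add: m_def algebra_simps)
        have a: "apart \<eta> 0 (i + snd u) (j + snd u)" "apart \<eta> 0 (i + snd u') (j + snd u')"
          using u(2,4) f0 by (simp_all add: apart_sh)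
        have "\<not> apart \<eta> 0 (j + snd u) (j + snd u')"
          using elim[rule_format, of "i + snd u" "j + snd u" "j + snd u'"] a(1) le ij by simp
        then obtain k where k: "rpath \<eta> 0 (j + snd u) k = rpath \<eta> 0 (j + snd u') k"
          using a by (auto simp: apart_def)
        have "rpath \<eta> 0 (j + snd u) k \<le> rpath \<eta> 0 (i + snd u') k"
          using a(1) le by (intro rpath_monotone) (auto simp: apart_def)
        also have "\<dots> < rpath \<eta> 0 (j + snd u') k" using a(2) ij by (intro apart_less) auto
        finally show False using k by simp
      qed
      have "card {u \<in> U. apart (sh u \<eta>) 0 i j} \<le> Suc 0"
      proof (subst card_le_Suc0_iff_eq)
        show "finite {u \<in> U. apart (sh u \<eta>) 0 i j}" using fU by simp
        show "\<forall>u\<in>{u \<in> U. apart (sh u \<eta>) 0 i j}. \<forall>u'\<in>{u \<in> U. apart (sh u \<eta>) 0 i j}. u = u'"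
        proof (intro ballI)
          fix u u' assume u: "u \<in> {u \<in> U. apart (sh u \<eta>) 0 i j}" "u' \<in> {u \<in> U. apart (sh u \<eta>) 0 i j}"
          have "fst u = fst u'" using u unfolding U_def by auto
          moreover have "snd u = snd u'"
          proof (rule linorder_cases[of "snd u" "snd u'"])
            assume "snd u < snd u'"
            then show ?thesis using no[of u u'] u by simp
          next
            assume "snd u' < snd u"
            then show ?thesis using no[of u' u] u by simp
          qed
          ultimately show "u = u'" by (rule prod_eqI)
        qed
      qed
      then show ?case by simp
    qed
    from card_times_measure_le[OF fU _ this] show ?thesis unfolding cU by simp
  qed
  show ?thesis
  proof (rule ccontr)
    assume "\<not> ?thesis"
    then have pos: "0 < measure (P0 p) {\<eta>. apart \<eta> 0 i j}" using zero_less_measure_iff by blast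
    obtain N :: nat where "1 / measure (P0 p) {\<eta>. apart \<eta> 0 i j} < real N" using reals_Archimedean2 by blast
    then show False using key[of N] pos by (simp add: field_simps)
  qed
qed

lemma rightmost_paths_coalesce:
  assumes p: "0 \<le> p" "p < 1"
  shows "AE \<eta> in P0 p. \<forall>n i j. perc \<eta> n i \<longrightarrow> perc \<eta> n j \<longrightarrow> (\<exists>k\<ge>n. rpath \<eta> n i k = rpath \<eta> n j k)"
proof -
  interpret prob_space "P0 p" by (rule prob_space_P0)
  have lt: "AE \<eta> in P0 p. \<not> apart \<eta> 0 i j" if "i < j" for i j
  proof -
    have "{\<eta>. apart \<eta> 0 i j} \<in> events" by (rule setsP) measurable
    then have "AE \<eta> in P0 p. \<eta> \<notin> {\<eta>. apart \<eta> 0 i j}"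
      using no_two_apart[OF p that] by (simp add: prob_eq_0)
    then show ?thesis by eventually_elim simp
  qed
  have "AE \<eta> in P0 p. \<forall>n i j. i < j \<longrightarrow> \<not> apart \<eta> n i j"
    unfolding AE_all_countable
  proof (intro allI)
    fix n and i j :: int
    show "AE \<eta> in P0 p. i < j \<longrightarrow> \<not> apart \<eta> n i j"
    proof (cases "i < j")
      case True
      from AE_sh[OF lt[OF this], of "(n, 0)"] show ?thesis
        by eventually_elim (simp add: apart_sh)
    qed simp
  qed
  then show ?thesis
  proof eventually_elim
    case (elim \<eta>)
    show ?case
    proof (intro allI impI)
      fix n i j assume "perc \<eta> n i" "perc \<eta> n j"
      then show "\<exists>k\<ge>n. rpath \<eta> n i k = rpath \<eta> n j k"
        using elim[rule_format, of i j n] elim[rule_format, of j i n]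
        by (cases i j rule: linorder_cases) (auto simp: apart_def)
    qed
  qed
qed

section \<open>Guarded paths\<close>

definition has_slope :: "(nat \<Rightarrow> int) \<Rightarrow> real \<Rightarrow> bool" where
  "has_slope h s \<longleftrightarrow> (\<lambda>k. real_of_int (h k) / real k) \<longlonglongrightarrow> s"

text \<open>All almost sure properties that are used, simultaneously for all sites. The sites
  \<open>(j, - j)\<close> are vertices \<open>(- j, 2 j)\<close>, far to the left, where guards can
  start. Coalescence is tied to \<open>\<beta> = 1/2\<close>: for \<open>p = 1\<close> rightmost
  paths are parallel and never meet.\<close>

definition good :: "real \<Rightarrow> config \<Rightarrow> bool" where
  "good \<beta> \<eta> \<longleftrightarrow>
     (\<forall>n i. perc \<eta> n i \<longrightarrow> has_slope (rpath \<eta> n i) \<beta> \<and>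
        (\<forall>b c. \<exists>h. opath \<eta> n h \<and>
           has_slope h ((real (Suc b) * \<beta> + real (Suc c) * (1 - \<beta>)) / (real (Suc b) + real (Suc c))))) \<and>
     (\<forall>m. \<exists>j\<ge>m. perc \<eta> j (- int j)) \<and>
     (\<beta> = 1/2 \<longrightarrow> (\<forall>n i j. perc \<eta> n i \<longrightarrow> perc \<eta> n j \<longrightarrow> (\<exists>k\<ge>n. rpath \<eta> n i k = rpath \<eta> n j k)))"

lemma has_slope_shift:
  assumes "has_slope h s"
  shows "has_slope (\<lambda>l. h (l - n) + i) s"
  unfolding has_slope_def
proof (rule LIMSEQ_offset[of _ n])
  have "(\<lambda>k. real_of_int (h k) / real k * (real k / real (k + n)) + real_of_int i / real (k + n)) \<longlonglongrightarrow> s * 1 + 0"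
  proof (intro tendsto_add tendsto_mult)
    show "(\<lambda>k. real_of_int (h k) / real k) \<longlonglongrightarrow> s" using assms by (simp add: has_slope_def)
    show "(\<lambda>k. real k / real (k + n)) \<longlonglongrightarrow> 1" by real_asymp
    show "(\<lambda>k. real_of_int i / real (k + n)) \<longlonglongrightarrow> 0" by real_asymp
  qed
  then have "(\<lambda>k. real_of_int (h k) / real k * (real k / real (k + n)) + real_of_int i / real (k + n)) \<longlonglongrightarrow> s" by simp
  moreover have "\<forall>\<^sub>F k in sequentially. real_of_int (h k) / real k * (real k / real (k + n)) + real_of_int i / real (k + n) =
    real_of_int (h (k + n - n) + i) / real (k + n)"
    using eventually_gt_at_top[of 0] by eventually_elim (simp add: add_divide_distrib)
  ultimately show "(\<lambda>k. real_of_int (h (k + n - n) + i) / real (k + n)) \<longlonglongrightarrow> s"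
    by (rule Lim_transform_eventually)
qed

lemma has_slope_cong: "has_slope f s \<Longrightarrow> (\<And>k. m \<le> k \<Longrightarrow> f k = g k) \<Longrightarrow> has_slope g s"
  unfolding has_slope_def
  by (erule Lim_transform_eventually) (auto intro!: eventually_sequentiallyI[of m])

lemma has_slope_mirror: "has_slope h s \<Longrightarrow> has_slope (\<lambda>k. int k - h k) (1 - s)"
  unfolding has_slope_def
proof -
  assume h: "(\<lambda>k. real_of_int (h k) / real k) \<longlonglongrightarrow> s"
  then have "(\<lambda>k. 1 - real_of_int (h k) / real k) \<longlonglongrightarrow> 1 - s" by (intro tendsto_intros)
  moreover have "\<forall>\<^sub>F k in sequentially. 1 - real_of_int (h k) / real k = real_of_int (int k - h k) / real k"
    using eventually_gt_at_top[of 0] by eventually_elim (simp add: diff_divide_distrib)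
  ultimately show "(\<lambda>k. real_of_int (int k - h k) / real k) \<longlonglongrightarrow> 1 - s" by (rule Lim_transform_eventually)
qed

lemma opath_unshift: "opath (sh (n, i) \<eta>) 0 h \<Longrightarrow> opath \<eta> n (\<lambda>l. h (l - n) + i)"
  using opath_sh[of "(n, i)" \<eta> 0 "\<lambda>l. h (l - n) + i"] by simp

lemma rpath_unshift: "n \<le> l \<Longrightarrow> rpath (sh (n, i) \<eta>) 0 0 (l - n) + i = rpath \<eta> n i l"
  by (simp add: rpath_sh)

context supercritical
begin

text \<open>Let \<open>q\<close> be the probability that no site \<open>(j, - j)\<close> percolates.
  On this event the origin either has died out by level \<open>n\<close>, which is independent of
  the sites from level \<open>n\<close> on, or it dies out later. Letting \<open>n\<close> grow
  gives \<open>q \<le> (1 - \<rho>) q\<close>, hence \<open>q = 0\<close>. Placing the sites on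
  different levels provides the independence.\<close>

lemma AE_far_sites: "AE \<eta> in P0 p. \<forall>m. \<exists>j\<ge>m. perc \<eta> j (- int j)"
proof -
  define F where "F = (\<lambda>\<eta>. \<forall>j. \<not> perc \<eta> j (- int j))"
  define A where "A = (\<lambda>n. {\<eta>. \<exists>j. conn \<eta> n 0 0 j})"
  have F[measurable]: "Measurable.pred (P0 p) F" unfolding F_def by measurable
  have Fsh: "F (sh (n, - int n) \<eta>) \<longleftrightarrow> (\<forall>j\<ge>n. \<not> perc \<eta> j (- int j))" for n \<eta>
  proof -
    have "F (sh (n, - int n) \<eta>) \<longleftrightarrow> (\<forall>j. \<not> perc \<eta> (j + n) (- int (j + n)))"
      by (simp add: F_def perc_sh)
    then show ?thesis by (metis le_add2 le_add_diff_inverse2)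
  qed
  have A_sets: "A n \<in> sets (P0 p)" for n unfolding A_def by (rule setsP) measurable
  have Asub: "A (Suc n) \<subseteq> A n" for n
  proof
    fix \<eta> assume "\<eta> \<in> A (Suc n)"
    then obtain j where "conn \<eta> (n + 1) 0 0 j" unfolding A_def by auto
    then show "\<eta> \<in> A n" unfolding conn_add A_def by blast
  qed
  have "decseq A" using Asub by (intro decseq_SucI)
  then have "(\<lambda>n. measure (P0 p) (A n)) \<longlonglongrightarrow> measure (P0 p) (\<Inter>n. A n)"
    using A_sets by (intro P.finite_Lim_measure_decseq) auto
  moreover have "(\<Inter>n. A n) = {\<eta>. perc \<eta> 0 0}" by (auto simp: A_def perc_def)
  ultimately have lim: "(\<lambda>n. measure (P0 p) (A n)) \<longlonglongrightarrow> \<rho>" by simp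
  let ?q = "measure (P0 p) {\<eta>. F \<eta>}"
  have bound: "?q \<le> (1 - \<rho>) * ?q + (measure (P0 p) (A n) - \<rho>)" for n
  proof -
    have subA: "{\<eta>. perc \<eta> 0 0} \<subseteq> A n" unfolding A_def perc_def by blast
    have ps: "{\<eta>. perc \<eta> 0 0} \<in> sets (P0 p)" by (rule setsP) measurable
    let ?X = "{\<eta>. (\<forall>j. \<not> conn \<eta> n 0 0 j) \<and> F (sh (n, - int n) \<eta>)}"
    have X: "?X \<in> sets (P0 p)" by (rule setsP) measurable
    have D: "A n - {\<eta>. perc \<eta> 0 0} \<in> sets (P0 p)" using A_sets ps by (rule sets.Diff)
    have "{\<eta>. F \<eta>} \<subseteq> ?X \<union> (A n - {\<eta>. perc \<eta> 0 0})"
    proof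
      fix \<eta> assume f: "\<eta> \<in> {\<eta>. F \<eta>}"
      have "\<not> perc \<eta> 0 0" using f unfolding F_def by (auto dest: spec[of _ 0])
      moreover have "F (sh (n, - int n) \<eta>)" using f unfolding Fsh by (simp add: F_def)
      ultimately show "\<eta> \<in> ?X \<union> (A n - {\<eta>. perc \<eta> 0 0})" by (auto simp: A_def)
    qed
    then have "?q \<le> measure (P0 p) (?X \<union> (A n - {\<eta>. perc \<eta> 0 0}))"
      by (intro P.finite_measure_mono sets.Un X D)
    also have "\<dots> \<le> measure (P0 p) ?X + measure (P0 p) (A n - {\<eta>. perc \<eta> 0 0})"
      by (rule measure_Un_le[OF X D])
    also have "measure (P0 p) ?X = measure (P0 p) {\<eta>. \<forall>j. \<not> conn \<eta> n 0 0 j} * ?q"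
    proof (rule measure_past_future)
      show "(\<forall>j. \<not> conn \<eta> n 0 0 j) = (\<forall>j. \<not> conn \<eta>' n 0 0 j)"
        if "\<And>e. fst e < fst (n, - int n) \<Longrightarrow> \<eta> e = \<eta>' e" for \<eta> \<eta>'
        using conn_cong[of 0 n \<eta> \<eta>' 0] that by simp
    qed measurable
    also have "{\<eta>. \<forall>j. \<not> conn \<eta> n 0 0 j} = space (P0 p) - A n" by (auto simp: A_def)
    also have "measure (P0 p) \<dots> = 1 - measure (P0 p) (A n)" using A_sets by (rule P.prob_compl)
    also have "measure (P0 p) (A n - {\<eta>. perc \<eta> 0 0}) = measure (P0 p) (A n) - \<rho>"
      by (rule P.finite_measure_Diff[OF A_sets ps subA])
    finally have "?q \<le> (1 - measure (P0 p) (A n)) * ?q + (measure (P0 p) (A n) - \<rho>)" .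
    moreover have "(1 - measure (P0 p) (A n)) * ?q \<le> (1 - \<rho>) * ?q"
      using P.finite_measure_mono[OF subA A_sets] by (intro mult_right_mono) auto
    ultimately show ?thesis by linarith
  qed
  have "(\<lambda>n. (1 - \<rho>) * ?q + (measure (P0 p) (A n) - \<rho>)) \<longlonglongrightarrow> (1 - \<rho>) * ?q + (\<rho> - \<rho>)"
    by (intro tendsto_intros lim)
  then have "?q \<le> (1 - \<rho>) * ?q + (\<rho> - \<rho>)" by (rule LIMSEQ_le_const) (use bound in blast)
  then have "\<rho> * ?q \<le> 0" by (simp add: algebra_simps)
  then have "?q \<le> 0" using survival by (simp add: mult_le_0_iff)
  then have "?q = 0" by (simp add: measure_le_0_iff)
  moreover have "{\<eta>. F \<eta>} \<in> sets (P0 p)" by (rule setsP[OF F])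
  ultimately have "AE \<eta> in P0 p. \<eta> \<notin> {\<eta>. F \<eta>}" by (simp add: P.prob_eq_0)
  then have nF: "AE \<eta> in P0 p. \<not> F \<eta>" by simp
  have "AE \<eta> in P0 p. \<exists>j\<ge>m. perc \<eta> j (- int j)" for m
    using AE_sh[OF nF, of "(m, - int m)"] by eventually_elim (auto simp: Fsh)
  then show ?thesis by (simp add: AE_all_countable)
qed

text \<open>This keeps \<open>p = 1\<close> out of the coalescence clause of \<open>good\<close>,
  which could not be proved there.\<close>

lemma \<beta>_if_all_open:
  assumes "p = 1"
  shows "\<beta> = 1"
proof -
  have "AE \<eta> in P0 p. \<forall>e. \<eta> e"
    unfolding AE_all_countable
  proof
    fix e :: "nat \<times> int \<times> bool"
    have "measure (P0 p) {\<eta>. \<not> \<eta> e} = 0" using measure_closed_edge[of p e] assms by simp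
    moreover have "{\<eta>. \<not> \<eta> e} \<in> sets (P0 p)" by (rule setsP) measurable
    ultimately have "AE \<eta> in P0 p. \<eta> \<notin> {\<eta>. \<not> \<eta> e}" by (simp add: P.prob_eq_0)
    then show "AE \<eta> in P0 p. \<eta> e" by simp
  qed
  then have "AE \<eta> in Q. \<forall>e. \<eta> e" unfolding AE_Q by eventually_elim simp
  then have "AE \<eta> in Q. \<beta> = 1"
    using rpath_speed
  proof eventually_elim
    case (elim \<eta>)
    have o: "\<eta> e" for e using elim(1) by blast
    have c: "conn \<eta> k n i i" for k n i by (induction k arbitrary: n) (auto simp: o)
    then have pc: "perc \<eta> n i" for n i unfolding perc_def by blast
    have "rpath \<eta> 0 0 k = int k" for k
    proof (induction k)
      case (Suc k)
      have c: "0 \<le> k \<and> \<eta> (k, rpath \<eta> 0 0 k, True) \<and> perc \<eta> (Suc k) (rpath \<eta> 0 0 k + 1)"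
        using o pc by blast
      have "rpath \<eta> 0 0 (Suc k) = rpath \<eta> 0 0 k + 1" unfolding rpath.simps(2) if_P[OF c] ..
      then show ?case using Suc by linarith
    qed simp
    then have "(\<lambda>k. real k / real k) \<longlonglongrightarrow> \<beta>" using elim(2) by simp
    moreover have "(\<lambda>k. real k / real k) \<longlonglongrightarrow> 1"
      by (rule tendsto_eventually) (auto intro!: eventually_sequentiallyI[of 1])
    ultimately show "\<beta> = 1" by (rule LIMSEQ_unique)
  qed
  then show ?thesis by simp
qed

text \<open>The statements at the origin are translated to the countably many sites; countably many
  mixed slopes are covered by the same null set.\<close>

lemma AE_good:
  assumes p: "0 \<le> p" "p \<le> 1"
  shows "AE \<eta> in P0 p. good \<beta> \<eta> \<and> good \<beta> (mir \<eta>)"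
proof -
  have 1: "AE \<eta> in P0 p. perc \<eta> 0 0 \<longrightarrow> has_slope (rpath \<eta> 0 0) \<beta>"
    using rpath_speed unfolding AE_Q has_slope_def .
  have 2: "AE \<eta> in P0 p. perc \<eta> 0 0 \<longrightarrow> (\<forall>b c. \<exists>h. opath \<eta> 0 h \<and>
    has_slope h ((real (Suc b) * \<beta> + real (Suc c) * (1 - \<beta>)) / (real (Suc b) + real (Suc c))))"
    (is "AE \<eta> in _. _ \<longrightarrow> (\<forall>b c. ?S b c \<eta>)")
  proof -
    have "AE \<eta> in P0 p. \<forall>b c. perc \<eta> 0 0 \<longrightarrow> ?S b c \<eta>"
      unfolding AE_all_countable
    proof (intro allI)
      fix b c
      show "AE \<eta> in P0 p. perc \<eta> 0 0 \<longrightarrow> ?S b c \<eta>"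
        using path_of_mixed_slope[of b c] unfolding AE_Q has_slope_def by eventually_elim blast
    qed
    then show ?thesis by eventually_elim blast
  qed
  have 3: "AE \<eta> in P0 p. \<beta> = 1/2 \<longrightarrow> (\<forall>n i j. perc \<eta> n i \<longrightarrow> perc \<eta> n j \<longrightarrow> (\<exists>k\<ge>n. rpath \<eta> n i k = rpath \<eta> n j k))"
  proof (cases "p = 1")
    case True
    then show ?thesis using \<beta>_if_all_open by simp
  next
    case False
    then show ?thesis using rightmost_paths_coalesce[of p] p by auto
  qed
  have 4: "AE \<eta> in P0 p. \<forall>n i. perc (sh (n, i) \<eta>) 0 0 \<longrightarrow> has_slope (rpath (sh (n, i) \<eta>) 0 0) \<beta> \<and>
    (\<forall>b c. ?S b c (sh (n, i) \<eta>))"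
    unfolding AE_all_countable
  proof (intro allI)
    fix n i
    show "AE \<eta> in P0 p. perc (sh (n, i) \<eta>) 0 0 \<longrightarrow> has_slope (rpath (sh (n, i) \<eta>) 0 0) \<beta> \<and>
      (\<forall>b c. ?S b c (sh (n, i) \<eta>))"
      using AE_sh[OF 1, of "(n, i)"] AE_sh[OF 2, of "(n, i)"] by eventually_elim simp
  qed
  have g: "AE \<eta> in P0 p. good \<beta> \<eta>"
    using 3 4 AE_far_sites
  proof eventually_elim
    case (elim \<eta>)
    have "has_slope (rpath \<eta> n i) \<beta> \<and> (\<forall>b c. \<exists>h. opath \<eta> n h \<and>
      has_slope h ((real (Suc b) * \<beta> + real (Suc c) * (1 - \<beta>)) / (real (Suc b) + real (Suc c))))"
      if "perc \<eta> n i" for n i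
    proof (intro conjI allI)
      have pc: "perc (sh (n, i) \<eta>) 0 0" using that by (simp add: perc_sh)
      have "has_slope (rpath (sh (n, i) \<eta>) 0 0) \<beta>" using elim(2) pc by blast
      from has_slope_shift[OF this] show "has_slope (rpath \<eta> n i) \<beta>"
        by (rule has_slope_cong) (rule rpath_unshift)
      fix b c
      obtain h where h: "opath (sh (n, i) \<eta>) 0 h"
        "has_slope h ((real (Suc b) * \<beta> + real (Suc c) * (1 - \<beta>)) / (real (Suc b) + real (Suc c)))"
        using elim(2) pc by blast
      show "\<exists>h. opath \<eta> n h \<and>
        has_slope h ((real (Suc b) * \<beta> + real (Suc c) * (1 - \<beta>)) / (real (Suc b) + real (Suc c)))"
        using opath_unshift[OF h(1)] has_slope_shift[OF h(2)] by blast
    qed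
    then show ?case using elim(1,3) unfolding good_def by blast
  qed
  show ?thesis using g AE_mir[OF g] by eventually_elim simp
qed

end

text \<open>From every percolating site some open path gets to the right of \<open>h\<close> or onto
  it, and some other one to the left or onto it. Started on the opposite side, such a path must meet
  \<open>h\<close>.\<close>

definition guarded :: "config \<Rightarrow> nat \<Rightarrow> (nat \<Rightarrow> int) \<Rightarrow> bool" where
  "guarded \<eta> n0 h \<longleftrightarrow> opath \<eta> n0 h \<and> (\<forall>n i. perc \<eta> n i \<longrightarrow>
     (\<exists>z. opath \<eta> n z \<and> z n = i \<and> (\<exists>l\<ge>max n n0. h l \<le> z l)) \<and>
     (\<exists>z. opath \<eta> n z \<and> z n = i \<and> (\<exists>l\<ge>max n n0. z l \<le> h l)))"

text \<open>Reflected back, the rightmost path of the mirrored configuration is the leftmost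
  path.\<close>

lemma left_path:
  assumes "good \<beta> (mir \<eta>)" "perc \<eta> n i"
  shows "\<exists>z. opath \<eta> n z \<and> z n = i \<and> has_slope z (1 - \<beta>)"
proof -
  have p: "perc (mir \<eta>) n (int n - i)" using assms(2) by (simp add: perc_mir)
  let ?r = "rpath (mir \<eta>) n (int n - i)"
  have "opath \<eta> n (\<lambda>k. int k - ?r k)" using rpath_opath[OF p] by (simp add: opath_mir)
  moreover have "has_slope (\<lambda>k. int k - ?r k) (1 - \<beta>)"
    using assms(1) p by (intro has_slope_mirror) (simp add: good_def)
  ultimately show ?thesis by (intro exI[of _ "\<lambda>k. int k - ?r k"]) (simp add: rpath_start)
qed

text \<open>The fractions are the weights that cycles of \<open>b + 1\<close> and
  \<open>c + 1\<close> steps produce. Each is a rational chosen between consecutive terms of the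
  sequence \<open>x * k / (k + 1)\<close>.\<close>

lemma increasing_rationals:
  assumes "0 < (x::real)" "x \<le> 1"
  shows "\<exists>b c :: nat \<Rightarrow> nat. (\<forall>k. real (Suc (b k)) / (real (Suc (b k)) + real (Suc (c k))) <
      real (Suc (b (Suc k))) / (real (Suc (b (Suc k))) + real (Suc (c (Suc k))))) \<and>
    (\<forall>k. real (Suc (b k)) / (real (Suc (b k)) + real (Suc (c k))) < x) \<and>
    (\<lambda>k. real (Suc (b k)) / (real (Suc (b k)) + real (Suc (c k)))) \<longlonglongrightarrow> x"
proof -
  define y where "y = (\<lambda>k::nat. x * (real k / real (Suc k)))"
  have y0: "0 \<le> y k" and y1: "y k < y (Suc k)" and yx: "y k < x" for k
    using assms by (auto simp: y_def field_simps)
  have "\<exists>b c. y k < real (Suc b) / (real (Suc b) + real (Suc c)) \<and>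
    real (Suc b) / (real (Suc b) + real (Suc c)) < y (Suc k)" for k
  proof -
    obtain r where r: "r \<in> \<rat>" "y k < r" "r < y (Suc k)" using Rats_dense_in_real[OF y1] by blast
    obtain m n :: nat where mn: "n \<noteq> 0" "\<bar>r\<bar> = real m / real n" using Rats_abs_nat_div_natE[OF r(1)] by blast
    have r0: "0 < r" "r < 1" using r y0[of k] yx[of "Suc k"] assms by auto
    then have rm: "r = real m / real n" using mn by simp
    then have "0 < m" "m < n" using r0 mn(1) by (auto simp: zero_less_divide_iff divide_less_eq)
    then have "real m = real (Suc (m - 1))" "real n = real (Suc (m - 1)) + real (Suc (n - m - 1))" by auto
    then show ?thesis using r unfolding rm by metis
  qed
  then obtain b c where bc: "\<And>k. y k < real (Suc (b k)) / (real (Suc (b k)) + real (Suc (c k)))"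
    "\<And>k. real (Suc (b k)) / (real (Suc (b k)) + real (Suc (c k))) < y (Suc k)" by metis
  have ylim: "y \<longlonglongrightarrow> x"
  proof -
    have "(\<lambda>k. x * (real k / real (Suc k))) \<longlonglongrightarrow> x * 1" by (intro tendsto_intros LIMSEQ_n_over_Suc_n)
    then show ?thesis by (simp add: y_def[abs_def])
  qed
  have "(\<lambda>k. real (Suc (b k)) / (real (Suc (b k)) + real (Suc (c k)))) \<longlonglongrightarrow> x"
    by (rule tendsto_sandwich[OF _ _ ylim LIMSEQ_Suc[OF ylim]]) (auto intro!: always_eventually less_imp_le bc simp del: of_nat_Suc)
  moreover have "real (Suc (b k)) / (real (Suc (b k)) + real (Suc (c k))) <
      real (Suc (b (Suc k))) / (real (Suc (b (Suc k))) + real (Suc (c (Suc k))))" for k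
    using bc(2)[of k] bc(1)[of "Suc k"] by (rule less_trans)
  moreover have "real (Suc (b k)) / (real (Suc (b k)) + real (Suc (c k))) < x" for k
    using bc(2)[of k] yx[of "Suc k"] by (rule less_trans)
  ultimately show ?thesis by blast
qed

text \<open>\<open>s\<close> is approached strictly from below by mixed slopes, which is why
  \<open>1 - \<beta>\<close> is excluded. Guards crossing to the right are rightmost paths; those
  crossing to the left are leftmost paths, whose slope \<open>1 - \<beta>\<close> is less than
  \<open>s\<close>.\<close>

lemma guarded_path_upper:
  assumes g: "good \<beta> \<eta>" "good \<beta> (mir \<eta>)" and s: "1 - \<beta> < s" "s \<le> \<beta>"
  shows "\<exists>h n0. guarded \<eta> n0 h \<and> has_slope h s"
proof -
  have d: "0 < 2 * \<beta> - 1" using s by simp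
  define x where "x = (s - (1 - \<beta>)) / (2 * \<beta> - 1)"
  have x: "0 < x" "x \<le> 1" using s d by (auto simp: x_def divide_le_eq)
  obtain b c :: "nat \<Rightarrow> nat" where bc:
    "\<And>k. real (Suc (b k)) / (real (Suc (b k)) + real (Suc (c k))) <
      real (Suc (b (Suc k))) / (real (Suc (b (Suc k))) + real (Suc (c (Suc k))))"
    "\<And>k. real (Suc (b k)) / (real (Suc (b k)) + real (Suc (c k))) < x"
    "(\<lambda>k. real (Suc (b k)) / (real (Suc (b k)) + real (Suc (c k)))) \<longlonglongrightarrow> x"
    using increasing_rationals[OF x] by blast
  define r where "r = (\<lambda>k. real (Suc (b k)) / (real (Suc (b k)) + real (Suc (c k))))"
  define q where "q = (\<lambda>k. (1 - \<beta>) + r k * (2 * \<beta> - 1))"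
  have qe: "(real (Suc (b k)) * \<beta> + real (Suc (c k)) * (1 - \<beta>)) / (real (Suc (b k)) + real (Suc (c k))) = q k" for k
  proof -
    have "(u * \<beta> + v * (1 - \<beta>)) / (u + v) = (1 - \<beta>) + u / (u + v) * (2 * \<beta> - 1)" if "0 < u" "0 < v" for u v
    proof -
      have "u + v \<noteq> 0" using that by simp
      then show ?thesis by (simp add: field_simps)
    qed
    from this[of "real (Suc (b k))" "real (Suc (c k))"] show ?thesis
      unfolding q_def r_def by (simp del: of_nat_Suc)
  qed
  have xs: "(1 - \<beta>) + x * (2 * \<beta> - 1) = s" using d by (simp add: x_def)
  have q1: "q k < q (Suc k)" for k using mult_strict_right_mono[OF bc(1)[of k] d] by (simp only: q_def r_def add_less_cancel_left)
  have "q k < s" for k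
    unfolding q_def xs[symmetric] using mult_strict_right_mono[OF bc(2)[of k] d] by (simp only: r_def add_less_cancel_left)
  then have q2: "q k < \<beta>" for k using s(2) less_le_trans by blast
  have "q \<longlonglongrightarrow> (1 - \<beta>) + x * (2 * \<beta> - 1)"
    unfolding q_def by (intro tendsto_intros) (use bc(3) in \<open>simp add: r_def[abs_def] del: of_nat_Suc\<close>)
  then have q3: "q \<longlonglongrightarrow> s" by (simp only: xs)
  obtain n i where p: "perc \<eta> n i" using g(1) unfolding good_def by blast
  have "\<exists>G. opath \<eta> n G \<and> has_slope G (q k)" for k
    using g(1) p unfolding good_def qe[symmetric] by blast
  then obtain G where G: "\<And>k. opath \<eta> n (G k)" "\<And>k. has_slope (G k) (q k)" by metis
  have right: "(\<lambda>k. real_of_int (rpath \<eta> n i k) / real k) \<longlonglongrightarrow> \<beta>" if "perc \<eta> n i" for n i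
    using g(1) that unfolding good_def has_slope_def by blast
  obtain h n0 where h: "opath \<eta> n0 h" "(\<lambda>l. real_of_int (h l) / real l) \<longlonglongrightarrow> s"
    "\<And>n i. perc \<eta> n i \<Longrightarrow> \<exists>l\<ge>max n n0. h l \<le> rpath \<eta> n i l"
    using path_with_limiting_slope[OF right G(1) G(2)[unfolded has_slope_def] q1 q2 q3] by blast
  have "guarded \<eta> n0 h"
    unfolding guarded_def
  proof (intro conjI h(1) allI impI)
    fix n i assume p: "perc \<eta> n i"
    show "\<exists>z. opath \<eta> n z \<and> z n = i \<and> (\<exists>l\<ge>max n n0. h l \<le> z l)"
      using h(3)[OF p] rpath_opath[OF p] by (intro exI[of _ "rpath \<eta> n i"]) (simp add: rpath_start)
    obtain z where z: "opath \<eta> n z" "z n = i" "has_slope z (1 - \<beta>)" using left_path[OF g(2) p] by blast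
    have "eventually (\<lambda>l. z l \<le> h l) sequentially"
      using z(3) h(2) s(1) unfolding has_slope_def by (rule slopes_less)
    then have "\<forall>\<^sub>F l in sequentially. z l \<le> h l \<and> max n n0 \<le> l"
      using eventually_ge_at_top[of "max n n0"] by (rule eventually_conj)
    then have "\<exists>l. z l \<le> h l \<and> max n n0 \<le> l" using eventually_happens by fastforce
    then show "\<exists>z. opath \<eta> n z \<and> z n = i \<and> (\<exists>l\<ge>max n n0. z l \<le> h l)" using z by blast
  qed
  then show ?thesis using h(2) unfolding has_slope_def by blast
qed

lemma guarded_mir:
  assumes "guarded (mir \<eta>) n0 h"
  shows "guarded \<eta> n0 (\<lambda>k. int k - h k)"
  unfolding guarded_def
proof (intro conjI allI impI)
  show "opath \<eta> n0 (\<lambda>k. int k - h k)" using assms by (simp add: guarded_def opath_mir)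
  fix n i assume "perc \<eta> n i"
  then have p: "perc (mir \<eta>) n (int n - i)" by (simp add: perc_mir)
  obtain z where z: "opath (mir \<eta>) n z" "z n = int n - i" "\<exists>l\<ge>max n n0. z l \<le> h l"
    using assms p unfolding guarded_def by blast
  show "\<exists>z. opath \<eta> n z \<and> z n = i \<and> (\<exists>l\<ge>max n n0. int l - h l \<le> z l)"
    using z by (intro exI[of _ "\<lambda>k. int k - z k"]) (simp add: opath_mir)
  obtain z where z: "opath (mir \<eta>) n z" "z n = int n - i" "\<exists>l\<ge>max n n0. h l \<le> z l"
    using assms p unfolding guarded_def by blast
  show "\<exists>z. opath \<eta> n z \<and> z n = i \<and> (\<exists>l\<ge>max n n0. z l \<le> int l - h l)"
    using z by (intro exI[of _ "\<lambda>k. int k - z k"]) (simp add: opath_mir)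
qed

text \<open>The remaining slope \<open>1 - \<beta>\<close> is the mirror image of the slope
  \<open>\<beta>\<close> as long as the cone is not a ray. If it is a ray, a rightmost path is its
  own model: every other rightmost path merges with it and serves as a guard on either side.\<close>

lemma guarded_path:
  assumes g: "good \<beta> \<eta>" "good \<beta> (mir \<eta>)" and s: "1 - \<beta> \<le> s" "s \<le> \<beta>"
  shows "\<exists>h n0. guarded \<eta> n0 h \<and> has_slope h s"
proof -
  consider "1 - \<beta> < s" | "s = 1 - \<beta>" "1 - \<beta> < \<beta>" | "s = 1 - \<beta>" "\<beta> = 1/2" using s by linarith
  then show ?thesis
  proof cases
    case 1
    then show ?thesis using guarded_path_upper[OF g] s by blast
  next
    case 2
    obtain h n0 where h: "guarded (mir \<eta>) n0 h" "has_slope h \<beta>"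
      using guarded_path_upper[of \<beta> "mir \<eta>" \<beta>] g 2 by (auto simp: mir_mir)
    show ?thesis using guarded_mir[OF h(1)] has_slope_mirror[OF h(2)] 2 by blast
  next
    case 3
    obtain n0 i0 where p: "perc \<eta> n0 i0" using g(1) unfolding good_def by blast
    let ?h = "rpath \<eta> n0 i0"
    have "guarded \<eta> n0 ?h"
      unfolding guarded_def
    proof (intro conjI rpath_opath[OF p] allI impI)
      fix n i assume pi: "perc \<eta> n i"
      define N where "N = max n n0"
      have N: "n \<le> N" "n0 \<le> N" by (auto simp: N_def)
      obtain k where k: "N \<le> k" "rpath \<eta> N (?h N) k = rpath \<eta> N (rpath \<eta> n i N) k"
        using g(1) 3 rpath_perc[OF p N(2)] rpath_perc[OF pi N(1)] unfolding good_def by blast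
      then have "?h k = rpath \<eta> n i k" using rpath_compose N by simp
      then show "\<exists>z. opath \<eta> n z \<and> z n = i \<and> (\<exists>l\<ge>max n n0. ?h l \<le> z l)"
        "\<exists>z. opath \<eta> n z \<and> z n = i \<and> (\<exists>l\<ge>max n n0. z l \<le> ?h l)"
        using k(1) rpath_opath[OF pi] unfolding N_def by (intro exI[of _ "rpath \<eta> n i"]; force simp: rpath_start)+
    qed
    moreover have "has_slope ?h \<beta>" using g(1) p unfolding good_def by blast
    moreover have "s = \<beta>" using 3 by simp
    ultimately show ?thesis by blast
  qed
qed

section \<open>First passage times and geodesics\<close>

text \<open>Functions with a length in place of lists, so that cutting and joining paths is a change
  of index.\<close>

definition walk :: "(nat \<Rightarrow> vertex) \<Rightarrow> nat \<Rightarrow> vertex \<Rightarrow> vertex \<Rightarrow> bool" where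
  "walk \<gamma> n x y \<longleftrightarrow> \<gamma> 0 = x \<and> \<gamma> n = y \<and> (\<forall>i<n. neighbours (\<gamma> i) (\<gamma> (Suc i)))"

definition wtime :: "(edge \<Rightarrow> real) \<Rightarrow> (nat \<Rightarrow> vertex) \<Rightarrow> nat \<Rightarrow> real" where
  "wtime w \<gamma> n = (\<Sum>i<n. w {\<gamma> i, \<gamma> (Suc i)})"

definition lev :: "vertex \<Rightarrow> int" where
  "lev x = fst x + snd x"

definition site :: "nat \<Rightarrow> int \<Rightarrow> vertex" where
  "site n i = (i, int n - i)"

definition dedge :: "nat \<times> int \<times> bool \<Rightarrow> edge" where
  "dedge = (\<lambda>(n, i, b). {site n i, site (Suc n) (if b then i + 1 else i)})"

text \<open>Up to reversal each lattice edge is an oriented step. Hence the distance of a lattice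
  path from a curve with steps 0 and 1, measured on the current level, changes by at most 1 per
  edge, and the path cannot jump over the curve.\<close>

lemma neighbours_lev:
  assumes "neighbours u v"
  shows "lev v = lev u + 1 \<and> fst u \<le> fst v \<and> fst v \<le> fst u + 1 \<or>
    lev u = lev v + 1 \<and> fst v \<le> fst u \<and> fst u \<le> fst v + 1"
proof -
  obtain a b a' b' where uv: "u = (a, b)" "v = (a', b')" by (cases u, cases v) auto
  have "\<bar>a - a'\<bar> + \<bar>b - b'\<bar> = 1" using assms uv by (simp add: neighbours_def)
  then have "a = a' \<and> (b' = b + 1 \<or> b = b' + 1) \<or> b = b' \<and> (a' = a + 1 \<or> a = a' + 1)" by smt
  then show ?thesis unfolding uv lev_def by auto
qed

lemma path_from_to_map: "path_from_to (map \<gamma> [0..<Suc n]) x y \<longleftrightarrow> walk \<gamma> n x y"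
proof -
  have "hd (map \<gamma> [0..<Suc n]) = \<gamma> 0" by (subst hd_map) (auto simp del: upt_Suc)
  moreover have "last (map \<gamma> [0..<Suc n]) = \<gamma> n" by simp
  moreover have "finite_lattice_path (map \<gamma> [0..<Suc n]) \<longleftrightarrow> (\<forall>i<n. neighbours (\<gamma> i) (\<gamma> (Suc i)))"
    by (auto simp: finite_lattice_path_def simp del: upt_Suc)
  ultimately show ?thesis by (simp add: path_from_to_def walk_def del: upt_Suc) auto
qed

lemma path_time_map: "path_time w (map \<gamma> [0..<Suc n]) = wtime w \<gamma> n"
  unfolding path_time_def wtime_def by (intro sum.cong) (auto simp del: upt_Suc)

lemma path_from_to_walk:
  assumes "path_from_to vs x y"
  shows "\<exists>n. length vs = Suc n \<and> walk (\<lambda>i. vs ! i) n x y \<and> path_time w vs = wtime w (\<lambda>i. vs ! i) n"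
proof -
  have "vs \<noteq> []" using assms by (simp add: path_from_to_def finite_lattice_path_def)
  then obtain n where n: "length vs = Suc n" by (cases vs) auto
  have vs: "map (\<lambda>i. vs ! i) [0..<Suc n] = vs" unfolding n[symmetric] by (rule map_nth)
  show ?thesis
    using n assms path_from_to_map[of "\<lambda>i. vs ! i" n x y] path_time_map[of w "\<lambda>i. vs ! i" n]
    unfolding vs by blast
qed

lemma walk_concat:
  assumes "walk \<gamma> n x y" "walk \<gamma>' m y z"
  shows "walk (\<lambda>i. if i \<le> n then \<gamma> i else \<gamma>' (i - n)) (n + m) x z"
    and "wtime w (\<lambda>i. if i \<le> n then \<gamma> i else \<gamma>' (i - n)) (n + m) = wtime w \<gamma> n + wtime w \<gamma>' m"
proof -
  define g where "g = (\<lambda>i. if i \<le> n then \<gamma> i else \<gamma>' (i - n))"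
  have hi: "g (n + i) = \<gamma>' i" for i using assms by (cases i) (auto simp: walk_def g_def)
  have lo: "g i = \<gamma> i" if "i \<le> n" for i using that by (simp add: g_def)
  have "walk g (n + m) x z"
    unfolding walk_def
  proof (intro conjI allI impI)
    fix i assume i: "i < n + m"
    show "neighbours (g i) (g (Suc i))"
    proof (cases "i < n")
      case True
      then show ?thesis using assms(1) lo by (simp add: walk_def)
    next
      case False
      then obtain j where j: "i = n + j" using le_Suc_ex not_less by blast
      have nb: "neighbours (\<gamma>' j) (\<gamma>' (Suc j))" using assms(2) i j by (simp add: walk_def)
      have "g i = \<gamma>' j" unfolding j by (rule hi)
      moreover have "g (Suc i) = \<gamma>' (Suc j)" using hi[of "Suc j"] j by simp
      ultimately show ?thesis using nb by simp
    qed
  next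
    show "g 0 = x" using lo[of 0] assms(1) by (simp add: walk_def)
    show "g (n + m) = z" using hi[of m] assms(2) by (simp add: walk_def)
  qed
  then show "walk (\<lambda>i. if i \<le> n then \<gamma> i else \<gamma>' (i - n)) (n + m) x z" by (simp only: g_def)
  have "wtime w g (n + m) = wtime w \<gamma> n + wtime w \<gamma>' m"
  proof (induction m)
    case 0
    show ?case unfolding wtime_def using lo by simp
  next
    case (Suc m)
    have "g (Suc (n + m)) = \<gamma>' (Suc m)" using hi[of "Suc m"] by simp
    then have "wtime w g (n + Suc m) = wtime w g (n + m) + w {\<gamma>' m, \<gamma>' (Suc m)}"
      by (simp add: wtime_def hi)
    then show ?case using Suc by (simp add: wtime_def)
  qed
  then show "wtime w (\<lambda>i. if i \<le> n then \<gamma> i else \<gamma>' (i - n)) (n + m) = wtime w \<gamma> n + wtime w \<gamma>' m"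
    by (simp only: g_def)
qed

lemma walk_split:
  assumes "walk \<gamma> n x y" "k \<le> n"
  shows "walk \<gamma> k x (\<gamma> k)" "walk (\<lambda>i. \<gamma> (k + i)) (n - k) (\<gamma> k) y"
    "wtime w \<gamma> n = wtime w \<gamma> k + wtime w (\<lambda>i. \<gamma> (k + i)) (n - k)"
proof -
  show w1: "walk \<gamma> k x (\<gamma> k)" and w2: "walk (\<lambda>i. \<gamma> (k + i)) (n - k) (\<gamma> k) y"
    using assms by (auto simp: walk_def)
  have "(\<lambda>i. if i \<le> k then \<gamma> i else \<gamma> (k + (i - k))) = \<gamma>" by (auto simp: fun_eq_iff)
  then show "wtime w \<gamma> n = wtime w \<gamma> k + wtime w (\<lambda>i. \<gamma> (k + i)) (n - k)"
    using walk_concat(2)[OF w1 w2, of w] assms(2) by simp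
qed

lemma walk_straight:
  assumes "v \<in> {(1, 0), (- 1, 0), (0, 1), (0, - 1)}"
  shows "walk (\<lambda>i. (fst x + int i * fst v, snd x + int i * snd v)) k x (fst x + int k * fst v, snd x + int k * snd v)"
  using assms by (auto simp: walk_def neighbours_def algebra_simps)

lemma walk_exists: "\<exists>\<gamma> n. walk \<gamma> n x y"
proof -
  have h: "\<exists>\<gamma> n. walk \<gamma> n (a, b) (a', b)" for a a' b
  proof (cases "a \<le> a'")
    case True
    then show ?thesis using walk_straight[of "(1, 0)" "(a, b)" "nat (a' - a)"] by (auto simp del: of_nat_nat)
  next
    case False
    then show ?thesis using walk_straight[of "(- 1, 0)" "(a, b)" "nat (a - a')"] by (auto simp del: of_nat_nat)
  qed
  have v: "\<exists>\<gamma> n. walk \<gamma> n (a, b) (a, b')" for a b b'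
  proof (cases "b \<le> b'")
    case True
    then show ?thesis using walk_straight[of "(0, 1)" "(a, b)" "nat (b' - b)"] by (auto simp del: of_nat_nat)
  next
    case False
    then show ?thesis using walk_straight[of "(0, - 1)" "(a, b)" "nat (b - b')"] by (auto simp del: of_nat_nat)
  qed
  obtain \<gamma> n where 1: "walk \<gamma> n (fst x, snd x) (fst y, snd x)" using h by blast
  obtain \<gamma>' m where 2: "walk \<gamma>' m (fst y, snd x) (fst y, snd y)" using v by blast
  show ?thesis using walk_concat(1)[OF 1 2] by auto
qed

lemma finite_neighbours: "finite {y. neighbours x y}"
proof (rule finite_subset)
  show "{y. neighbours x y} \<subseteq> {fst x - 1..fst x + 1} \<times> {snd x - 1..snd x + 1}"
    by (auto simp: neighbours_def)
qed simp

lemma finite_paths: "finite {vs. finite_lattice_path vs \<and> hd vs = x \<and> length vs = Suc n}"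
proof (induction n arbitrary: x)
  case 0
  have "{vs. finite_lattice_path vs \<and> hd vs = x \<and> length vs = Suc 0} \<subseteq> {[x]}"
    by (auto simp: length_Suc_conv)
  then show ?case by (rule finite_subset) simp
next
  case (Suc n)
  let ?S = "\<lambda>y. {vs. finite_lattice_path vs \<and> hd vs = y \<and> length vs = Suc n}"
  have "{vs. finite_lattice_path vs \<and> hd vs = x \<and> length vs = Suc (Suc n)} \<subseteq>
    (\<lambda>vs. x # vs) ` (\<Union>y\<in>{y. neighbours x y}. ?S y)"
  proof
    fix vs assume "vs \<in> {vs. finite_lattice_path vs \<and> hd vs = x \<and> length vs = Suc (Suc n)}"
    then obtain y us where vs: "vs = x # y # us" and f: "finite_lattice_path vs" and l: "length us = n"
      by (auto simp: length_Suc_conv)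
    have nb: "neighbours (vs ! i) (vs ! Suc i)" if "Suc i < length vs" for i
      using f that by (simp add: finite_lattice_path_def)
    have "neighbours x y" using nb[of 0] vs by simp
    moreover have "finite_lattice_path (y # us)"
      unfolding finite_lattice_path_def
    proof (intro conjI allI impI)
      fix i assume "Suc i < length (y # us)"
      then show "neighbours ((y # us) ! i) ((y # us) ! Suc i)" using nb[of "Suc i"] vs by simp
    qed simp
    ultimately have "y # us \<in> (\<Union>y\<in>{y. neighbours x y}. ?S y)" using l by auto
    then show "vs \<in> (\<lambda>vs. x # vs) ` (\<Union>y\<in>{y. neighbours x y}. ?S y)" using vs by blast
  qed
  moreover have "finite (\<Union>y\<in>{y. neighbours x y}. ?S y)"
    using finite_neighbours Suc by blast
  ultimately show ?case by (meson finite_imageI finite_subset)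
qed

section \<open>Passage times that are bounded below by 1\<close>

locale passage_times =
  fixes w :: "edge \<Rightarrow> real"
  assumes ge1: "e \<in> lattice_edges \<Longrightarrow> 1 \<le> w e"
begin

abbreviation "\<tau> \<equiv> passage_time w"

lemma ge1_step: "neighbours x y \<Longrightarrow> 1 \<le> w {x, y}"
  by (rule ge1) (unfold lattice_edges_def, blast)

lemma wtime_ge: "walk \<gamma> n x y \<Longrightarrow> real n \<le> wtime w \<gamma> n"
proof -
  assume "walk \<gamma> n x y"
  then have "(\<Sum>i<n. 1) \<le> wtime w \<gamma> n"
    unfolding wtime_def by (intro sum_mono ge1_step) (auto simp: walk_def)
  then show ?thesis by simp
qed

text \<open>A path of time at most \<open>C\<close> has at most \<open>C\<close> edges, and there
  are finitely many of these from \<open>x\<close>; so the infimum is a minimum.\<close>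

lemma passage_attained: "\<exists>\<gamma> n. walk \<gamma> n x y \<and> wtime w \<gamma> n = \<tau> x y"
  and passage_le: "walk \<gamma> n x y \<Longrightarrow> \<tau> x y \<le> wtime w \<gamma> n"
proof -
  let ?P = "{vs. path_from_to vs x y}"
  have nn: "0 \<le> path_time w vs" if v: "vs \<in> ?P" for vs
  proof -
    obtain n where "walk (\<lambda>i. vs ! i) n x y" "path_time w vs = wtime w (\<lambda>i. vs ! i) n"
      using path_from_to_walk[of vs x y w] v by blast
    then show ?thesis using wtime_ge[of "\<lambda>i. vs ! i" n x y] by simp
  qed
  have bdd: "bdd_below (path_time w ` ?P)" using nn by (intro bdd_belowI2)
  have le: "\<tau> x y \<le> path_time w vs" if "vs \<in> ?P" for vs
    unfolding passage_time_def by (rule cINF_lower[OF bdd that])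
  show "walk \<gamma> n x y \<Longrightarrow> \<tau> x y \<le> wtime w \<gamma> n" for \<gamma> n
    using le[of "map \<gamma> [0..<Suc n]"] by (simp only: mem_Collect_eq path_from_to_map path_time_map)
  obtain \<gamma>0 n0 where w0: "walk \<gamma>0 n0 x y" using walk_exists by blast
  define C where "C = wtime w \<gamma>0 n0"
  let ?K = "{vs \<in> ?P. path_time w vs \<le> C}"
  have "?K \<subseteq> (\<Union>n\<in>{..nat \<lceil>C\<rceil>}. {vs. finite_lattice_path vs \<and> hd vs = x \<and> length vs = Suc n})"
  proof
    fix vs assume vs: "vs \<in> ?K"
    then obtain n where n: "length vs = Suc n" "walk (\<lambda>i. vs ! i) n x y" "path_time w vs = wtime w (\<lambda>i. vs ! i) n"
      using path_from_to_walk[of vs x y w] by blast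
    then have "real n \<le> C" using wtime_ge[OF n(2)] vs by auto
    then have "n \<le> nat \<lceil>C\<rceil>" by linarith
    then show "vs \<in> (\<Union>n\<in>{..nat \<lceil>C\<rceil>}. {vs. finite_lattice_path vs \<and> hd vs = x \<and> length vs = Suc n})"
      using n vs by (auto simp: path_from_to_def)
  qed
  then have fin: "finite (path_time w ` ?K)"
    by (intro finite_imageI) (rule finite_subset, auto intro: finite_paths)
  have "map \<gamma>0 [0..<Suc n0] \<in> ?K"
    using w0 by (simp only: mem_Collect_eq path_from_to_map path_time_map C_def) simp
  then have ne: "path_time w ` ?K \<noteq> {}" by blast
  let ?m = "Min (path_time w ` ?K)"
  have "?m \<in> path_time w ` ?K" using Min_in[OF fin ne] .
  then obtain vs where vs: "vs \<in> ?K" "path_time w vs = ?m" by auto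
  have mC: "?m \<le> C" using vs by auto
  have "?m \<le> path_time w us" if "us \<in> ?P" for us
  proof (cases "path_time w us \<le> C")
    case True
    then show ?thesis using that by (intro Min_le[OF fin]) auto
  next
    case False
    then show ?thesis using mC by simp
  qed
  then have "?m \<le> \<tau> x y" unfolding passage_time_def using vs(1) by (intro cINF_greatest) auto
  then have eq: "path_time w vs = \<tau> x y" using le[of vs] vs by auto
  obtain n where "walk (\<lambda>i. vs ! i) n x y" "path_time w vs = wtime w (\<lambda>i. vs ! i) n"
    using path_from_to_walk[of vs x y w] vs(1) by blast
  then show "\<exists>\<gamma> n. walk \<gamma> n x y \<and> wtime w \<gamma> n = \<tau> x y" using eq by auto
qed

lemma passage_triangle: "\<tau> x z \<le> \<tau> x y + \<tau> y z"
proof -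
  obtain \<gamma> n where 1: "walk \<gamma> n x y" "wtime w \<gamma> n = \<tau> x y" using passage_attained by blast
  obtain \<gamma>' m where 2: "walk \<gamma>' m y z" "wtime w \<gamma>' m = \<tau> y z" using passage_attained by blast
  show ?thesis using passage_le[OF walk_concat(1)[OF 1(1) 2(1)]] walk_concat(2)[OF 1(1) 2(1), of w] 1 2 by simp
qed

lemma walk_dist: "walk \<gamma> n x y \<Longrightarrow> \<bar>fst x - fst y\<bar> + \<bar>snd x - snd y\<bar> \<le> int n"
proof (induction n arbitrary: y)
  case (Suc n)
  have "walk \<gamma> n x (\<gamma> n)" using Suc.prems by (simp add: walk_def)
  from Suc.IH[OF this] have "\<bar>fst x - fst (\<gamma> n)\<bar> + \<bar>snd x - snd (\<gamma> n)\<bar> \<le> int n" .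
  moreover have "\<bar>fst (\<gamma> n) - fst y\<bar> + \<bar>snd (\<gamma> n) - snd y\<bar> = 1"
    using Suc.prems by (auto simp: walk_def neighbours_def)
  ultimately show ?case by simp
qed (auto simp: walk_def)

lemma passage_ge_dist: "real_of_int (\<bar>fst x - fst y\<bar> + \<bar>snd x - snd y\<bar>) \<le> \<tau> x y"
proof -
  obtain \<gamma> n where 1: "walk \<gamma> n x y" "wtime w \<gamma> n = \<tau> x y" using passage_attained by blast
  have "real_of_int (\<bar>fst x - fst y\<bar> + \<bar>snd x - snd y\<bar>) \<le> real n"
    using walk_dist[OF 1(1)] by linarith
  then show ?thesis using wtime_ge[OF 1(1)] 1(2) by simp
qed

lemma passage_ge_lev: "real_of_int (lev y - lev x) \<le> \<tau> x y"
proof -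
  have "lev y - lev x \<le> \<bar>fst x - fst y\<bar> + \<bar>snd x - snd y\<bar>" by (simp add: lev_def)
  then have "real_of_int (lev y - lev x) \<le> real_of_int (\<bar>fst x - fst y\<bar> + \<bar>snd x - snd y\<bar>)"
    by (simp only: of_int_le_iff)
  then show ?thesis using passage_ge_dist[of x y] by linarith
qed

text \<open>Moving against an orientation is paid twice: once for the move itself and once more to
  regain the level lost.\<close>

lemma passage_ge_fst: "real_of_int (lev y - lev x + 2 * (fst x - fst y)) \<le> \<tau> x y"
  and passage_ge_snd: "real_of_int (lev y - lev x + 2 * (snd x - snd y)) \<le> \<tau> x y"
proof -
  have g1: "a' + b' - (a + b) + 2 * (a - a') \<le> A + B" if "a - a' \<le> A" "- (b - b') \<le> B" for a a' b b' A B :: int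
    using that by simp
  have g2: "a' + b' - (a + b) + 2 * (b - b') \<le> A + B" if "- (a - a') \<le> A" "b - b' \<le> B" for a a' b b' A B :: int
    using that by simp
  have "lev y - lev x + 2 * (fst x - fst y) \<le> \<bar>fst x - fst y\<bar> + \<bar>snd x - snd y\<bar>"
    "lev y - lev x + 2 * (snd x - snd y) \<le> \<bar>fst x - fst y\<bar> + \<bar>snd x - snd y\<bar>"
    unfolding lev_def by (rule g1[OF abs_ge_self abs_ge_minus_self], rule g2[OF abs_ge_minus_self abs_ge_self])
  then have "real_of_int (lev y - lev x + 2 * (fst x - fst y)) \<le> real_of_int (\<bar>fst x - fst y\<bar> + \<bar>snd x - snd y\<bar>)"
    "real_of_int (lev y - lev x + 2 * (snd x - snd y)) \<le> real_of_int (\<bar>fst x - fst y\<bar> + \<bar>snd x - snd y\<bar>)"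
    by (simp_all only: of_int_le_iff)
  then show "real_of_int (lev y - lev x + 2 * (fst x - fst y)) \<le> \<tau> x y"
    "real_of_int (lev y - lev x + 2 * (snd x - snd y)) \<le> \<tau> x y"
    using passage_ge_dist[of x y] by linarith+
qed

lemma passage_via:
  assumes "walk \<gamma> n x y" "k \<le> n"
  shows "\<tau> x (\<gamma> k) + \<tau> (\<gamma> k) y \<le> wtime w \<gamma> n"
  using passage_le[OF walk_split(1)[OF assms]] passage_le[OF walk_split(2)[OF assms]]
    walk_split(3)[OF assms, of w] by simp

definition config_of :: config where
  "config_of e \<longleftrightarrow> w (dedge e) = 1"

lemma step_config: "step config_of n i j \<Longrightarrow> w {site n i, site (Suc n) j} = 1 \<and> neighbours (site n i) (site (Suc n) j)"
  by (auto simp: step_def config_of_def dedge_def site_def neighbours_def)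

lemma lev_site: "lev (site n i) = int n"
  by (simp add: lev_def site_def)

lemma opath_walk:
  assumes "opath config_of n h"
  shows "walk (\<lambda>i. site (n + i) (h (n + i))) k (site n (h n)) (site (n + k) (h (n + k)))"
    "wtime w (\<lambda>i. site (n + i) (h (n + i))) k = real k"
  using step_config assms by (auto simp: walk_def wtime_def opath_def)

text \<open>An open path takes one unit of time per level, and no path gains levels faster.\<close>

lemma opath_passage:
  assumes "opath config_of n0 h" "n0 \<le> n" "n \<le> m"
  shows "\<tau> (site n (h n)) (site m (h m)) = real m - real n"
proof -
  have o: "opath config_of n h" using opath_mono assms by blast
  have "\<tau> (site n (h n)) (site m (h m)) \<le> real (m - n)"
    using passage_le[OF opath_walk(1)[OF o, of "m - n"]] opath_walk(2)[OF o, of "m - n"] assms(3) by simp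
  moreover have "real m - real n \<le> \<tau> (site n (h n)) (site m (h m))"
    using passage_ge_lev[of "site m (h m)" "site n (h n)"] by (simp add: lev_site)
  ultimately show ?thesis using assms(3) by simp
qed

text \<open>A geodesic that ends on the guarded path \<open>h\<close> cannot get around the two guards, because leaving
  the region below them costs too much; so it meets a guard, and from there it is free to follow
  the guard to \<open>h\<close>. The curves \<open>D1\<close> and \<open>D2\<close> are the guards, prolonged downwards.\<close>

lemma passage_eventually_linear:
  assumes g: "guarded config_of n0 h"
    and far1: "\<forall>m. \<exists>j\<ge>m. perc config_of j (- int j)" and far2: "\<forall>m. \<exists>j\<ge>m. perc config_of j (2 * int j)"
  shows "\<exists>m\<ge>n0. \<forall>n\<ge>m. \<tau> x (site n (h n)) = \<tau> x (site m (h m)) + (real n - real m)"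
proof -
  let ?G = "\<lambda>n. site n (h n)"
  have oh: "opath config_of n0 h" using g by (simp add: guarded_def)
  have hmono: "h n0 \<le> h n \<and> h n \<le> h n0 + (int n - int n0)" if "n0 \<le> n" for n
    using conn_bounds[OF opath_conn[OF oh order_refl, of "n - n0"]] that by simp
  \<comment> \<open>The excess of passage time over level at the start of \<open>h\<close>. It does
    not increase along \<open>h\<close>, so it bounds the excess at all later points.\<close>
  define C where "C = \<tau> x (?G n0) - real n0"
  \<comment> \<open>The last two conditions make sites with a coordinate below \<open>- J\<close>
    too expensive: the passage time from \<open>x\<close> to such a site exceeds its level by more
    than \<open>C\<close>.\<close>
  obtain J :: nat where J: "n0 \<le> J" "lev x \<le> int J" "\<bar>fst x\<bar> < int J" "\<bar>snd x\<bar> < int J" "\<bar>h n0\<bar> < int J"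
    "C + real_of_int (lev x) < 2 * (real_of_int (fst x) + real J)"
    "C + real_of_int (lev x) < 2 * (real_of_int (snd x) + real J)"
  proof -
    have bnd: "\<exists>a. t \<le> int a \<and> - t \<le> int a \<and> - real_of_int t \<le> real a \<and> real_of_int t \<le> real a" for t
      by (intro exI[of _ "nat \<bar>t\<bar>"]) auto
    obtain a where a: "lev x \<le> int a" "real_of_int (lev x) \<le> real a" using bnd by blast
    obtain b where b: "fst x \<le> int b" "- fst x \<le> int b" "- real_of_int (fst x) \<le> real b" using bnd by blast
    obtain c where c: "snd x \<le> int c" "- snd x \<le> int c" "- real_of_int (snd x) \<le> real c" using bnd by blast
    obtain d where d: "h n0 \<le> int d" "- h n0 \<le> int d" using bnd by blast
    obtain e :: nat where e: "C \<le> real e" using real_arch_simple by blast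
    show ?thesis
    proof (rule that[of "n0 + a + b + c + d + e + 1"])
      show "\<bar>fst x\<bar> < int (n0 + a + b + c + d + e + 1)" using b by (simp add: abs_less_iff)
      show "\<bar>snd x\<bar> < int (n0 + a + b + c + d + e + 1)" using c by (simp add: abs_less_iff)
      show "\<bar>h n0\<bar> < int (n0 + a + b + c + d + e + 1)" using d by (simp add: abs_less_iff)
    qed (use a b c e in simp_all)
  qed
  obtain j1 where j1: "J \<le> j1" "perc config_of j1 (- int j1)" using far1 by blast
  obtain j2 where j2: "J \<le> j2" "perc config_of j2 (2 * int j2)" using far2 by blast
  have n0j: "n0 \<le> j1" "n0 \<le> j2" using J j1 j2 by auto
  obtain z1 l1 where z1: "opath config_of j1 z1" "z1 j1 = - int j1" "j1 \<le> l1" "h l1 \<le> z1 l1"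
    using g j1(2) unfolding guarded_def by (metis max.boundedE)
  obtain z2 l2 where z2: "opath config_of j2 z2" "z2 j2 = 2 * int j2" "j2 \<le> l2" "z2 l2 \<le> h l2"
    using g j2(2) unfolding guarded_def by (metis max.boundedE)
  have "z1 j1 \<le> h j1" using hmono[OF n0j(1)] z1(2) J(5) j1(1) by linarith
  then obtain k1 where k1: "j1 \<le> k1" "z1 k1 = h k1"
    using opath_meet[OF z1(1) oh order_refl n0j(1) _ z1(3,4)] by blast
  have "h j2 \<le> z2 j2" using hmono[OF n0j(2)] z2(2) J(5) j2(1) by linarith
  then obtain k2 where k2: "j2 \<le> k2" "h k2 = z2 k2"
    using opath_meet[OF oh z2(1) n0j(2) order_refl _ z2(3,4)] by blast
  define e1 where "e1 = (\<lambda>k. if k \<le> k1 then z1 k else h k)"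
  define e2 where "e2 = (\<lambda>k. if k \<le> k2 then z2 k else h k)"
  have e1: "opath config_of j1 e1" unfolding e1_def
    using k1 n0j by (intro opath_splice[OF z1(1) opath_mono[OF oh]]) auto
  have e2: "opath config_of j2 e2" unfolding e2_def
    using k2 n0j by (intro opath_splice[OF z2(1) opath_mono[OF oh]]) auto
  have e1h: "e1 k = h k" if "k1 \<le> k" for k using that k1 by (auto simp: e1_def)
  have e2h: "e2 k = h k" if "k2 \<le> k" for k using that k2 by (auto simp: e2_def)
  have e1j: "e1 j1 = - int j1" and e2j: "e2 j2 = 2 * int j2" using k1 k2 z1 z2 by (auto simp: e1_def e2_def)
  \<comment> \<open>Below level \<open>j1\<close> this is the horizontal half-line to the left from
    the vertex \<open>(- j1, 2 j1)\<close>; \<open>D2\<close> ends in the vertical half-line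
    downwards from \<open>(2 j2, - j2)\<close>. Every site on these half-lines has a coordinate
    below \<open>- J\<close>.\<close>
  define D1 where "D1 = (\<lambda>l::int. if l < int j1 then l - 2 * int j1 else e1 (nat l))"
  define D2 where "D2 = (\<lambda>l::int. if l < int j2 then 2 * int j2 else e2 (nat l))"
  have D1: "D1 l \<le> D1 (l + 1) \<and> D1 (l + 1) \<le> D1 l + 1" for l
  proof (cases "int j1 \<le> l")
    case True
    then have "nat (l + 1) = Suc (nat l)" "j1 \<le> nat l" by auto
    then show ?thesis using opath_steps[OF e1, of "nat l"] True by (simp add: D1_def)
  next
    case False
    then show ?thesis using e1j by (cases "l + 1 = int j1") (auto simp: D1_def)
  qed
  have D2: "D2 l \<le> D2 (l + 1) \<and> D2 (l + 1) \<le> D2 l + 1" for l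
  proof (cases "int j2 \<le> l")
    case True
    then have "nat (l + 1) = Suc (nat l)" "j2 \<le> nat l" by auto
    then show ?thesis using opath_steps[OF e2, of "nat l"] True by (simp add: D2_def)
  next
    case False
    then show ?thesis using e2j by (cases "l + 1 = int j2") (auto simp: D2_def)
  qed
  define m where "m = max k1 k2"
  have m: "k1 \<le> m" "k2 \<le> m" "n0 \<le> m" "j1 \<le> m" "j2 \<le> m" using k1 k2 n0j by (auto simp: m_def)
  have Dm: "D1 l = h (nat l)" "D2 l = h (nat l)" if "int m \<le> l" for l
    using that m e1h[of "nat l"] e2h[of "nat l"] by (auto simp: D1_def D2_def)
  have "\<tau> x (?G n) = \<tau> x (?G m) + (real n - real m)" if n: "m \<le> n" for n
  proof -
    have upper: "\<tau> x (?G n) \<le> \<tau> x (?G k) + (real n - real k)" if "n0 \<le> k" "k \<le> n" for k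
      using passage_triangle[of x "?G n" "?G k"] opath_passage[OF oh that] by simp
    obtain \<gamma> N where \<gamma>: "walk \<gamma> N x (?G n)" "wtime w \<gamma> N = \<tau> x (?G n)" using passage_attained by blast
    \<comment> \<open>Both curves agree with \<open>h\<close> from level \<open>m\<close> on, so
      this region contains no point there. The geodesic starts inside and ends outside.\<close>
    define inside where "inside = (\<lambda>v. D1 (lev v) < fst v \<and> fst v < D2 (lev v))"
    have in0: "inside (\<gamma> 0)"
    proof -
      have "D1 (lev x) \<le> - int j1" using J(2) j1(1) e1j by (cases "lev x = int j1") (auto simp: D1_def)
      moreover have "D2 (lev x) = 2 * int j2" using J(2) j2(1) e2j by (cases "lev x = int j2") (auto simp: D2_def)
      ultimately show ?thesis using \<gamma>(1) J(3) j1(1) j2(1) by (auto simp: inside_def walk_def)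
    qed
    have inN: "\<not> inside (\<gamma> N)"
      using \<gamma>(1) Dm[of "int n"] n by (simp add: inside_def walk_def lev_site)
    define k where "k = (LEAST k. \<not> inside (\<gamma> k))"
    have k: "\<not> inside (\<gamma> k)" unfolding k_def by (rule LeastI[of _ N]) (rule inN)
    have kN: "k \<le> N" unfolding k_def by (rule Least_le) (rule inN)
    obtain k' where k': "k = Suc k'" using k in0 by (cases k) auto
    have ink': "inside (\<gamma> k')" using not_less_Least[of k' "\<lambda>k. \<not> inside (\<gamma> k)"] k' unfolding k_def by auto
    let ?u = "\<gamma> k'" and ?v = "\<gamma> k"
    have nb: "neighbours ?u ?v" using \<gamma>(1) kN k' by (simp add: walk_def)
    have levu: "lev ?u < int m"
    proof (rule ccontr)
      assume "\<not> ?thesis"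
      then show False using ink' Dm[of "lev ?u"] by (simp add: inside_def)
    qed
    have nbc: "lev ?v = lev ?u + 1 \<and> fst ?u \<le> fst ?v \<and> fst ?v \<le> fst ?u + 1 \<or>
      lev ?u = lev ?v + 1 \<and> fst ?v \<le> fst ?u \<and> fst ?u \<le> fst ?v + 1"
      by (rule neighbours_lev[OF nb])
    have levv: "lev ?v \<le> int m" using nbc levu by linarith
    have in_u: "D1 (lev ?u) < fst ?u" "fst ?u < D2 (lev ?u)" using ink' by (auto simp: inside_def)
    have "D1 (lev ?v) \<le> fst ?v \<and> fst ?v \<le> D2 (lev ?v)"
      using nbc
    proof (elim disjE conjE)
      assume l: "lev ?v = lev ?u + 1" and f: "fst ?u \<le> fst ?v" "fst ?v \<le> fst ?u + 1"
      show ?thesis unfolding l using in_u f D1[of "lev ?u"] D2[of "lev ?u"] by linarith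
    next
      assume l: "lev ?u = lev ?v + 1" and f: "fst ?v \<le> fst ?u" "fst ?u \<le> fst ?v + 1"
      show ?thesis using in_u[unfolded l] f D1[of "lev ?v"] D2[of "lev ?v"] by linarith
    qed
    \<comment> \<open>An edge changes the position relative to either curve by at most 1, so the
      first exit takes place on one of the curves.\<close>
    then have on: "fst ?v = D1 (lev ?v) \<or> fst ?v = D2 (lev ?v)" using k unfolding inside_def by linarith
    have via: "\<tau> x ?v + \<tau> ?v (?G n) \<le> \<tau> x (?G n)" using passage_via[OF \<gamma>(1) kN] \<gamma>(2) by simp
    have rest: "real n - real_of_int (lev ?v) \<le> \<tau> ?v (?G n)"
      using passage_ge_lev[of "?G n" ?v] by (simp add: lev_site)
    \<comment> \<open>After \<open>?v\<close> the geodesic spends at least the levels it still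
      gains; so its excess at \<open>?v\<close> is at most the one at the end, hence at most
      \<open>C\<close>.\<close>
    have C: "\<tau> x ?v - real_of_int (lev ?v) \<le> C"
      using via rest upper[of n0] m n by (simp add: C_def)
    have vsite: "?v = site (nat (lev ?v)) (fst ?v)" if "0 \<le> lev ?v"
      using that by (simp add: site_def lev_def prod_eq_iff)
    have up: "\<tau> ?v (?G m) \<le> real m - real_of_int (lev ?v)"
      using on
    proof
      assume v: "fst ?v = D1 (lev ?v)"
      have lj: "int j1 \<le> lev ?v"
      proof (rule ccontr)
        assume "\<not> ?thesis"
        then have lt: "lev ?v < int j1" by simp
        then have "fst ?v < - int j1" using v by (simp add: D1_def)
        then have "fst ?v < - int J" using j1(1) by simp
        then have "real_of_int (fst ?v) < - real J" by linarith
        then show False using passage_ge_fst[of ?v x] C J(6) by simp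
      qed
      define a where "a = nat (lev ?v)"
      have a: "j1 \<le> a" "a \<le> m" "real_of_int (lev ?v) = real a" using lj levv by (auto simp: a_def)
      have "?v = site a (e1 a)" using vsite v lj by (simp add: a_def D1_def)
      moreover have "?G m = site m (e1 m)" using e1h m by simp
      ultimately show ?thesis using opath_passage[OF e1 a(1,2)] a(3) by simp
    next
      assume v: "fst ?v = D2 (lev ?v)"
      have lj: "int j2 \<le> lev ?v"
      proof (rule ccontr)
        assume "\<not> ?thesis"
        then have lt: "lev ?v < int j2" by simp
        then have "fst ?v = 2 * int j2" using v by (simp add: D2_def)
        then have "snd ?v < - int j2" using lt unfolding lev_def by linarith
        then have "snd ?v < - int J" using j2(1) by simp
        then have "real_of_int (snd ?v) < - real J" by linarith
        then show False using passage_ge_snd[of ?v x] C J(7) by simp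
      qed
      define a where "a = nat (lev ?v)"
      have a: "j2 \<le> a" "a \<le> m" "real_of_int (lev ?v) = real a" using lj levv by (auto simp: a_def)
      have "?v = site a (e2 a)" using vsite v lj by (simp add: a_def D2_def)
      moreover have "?G m = site m (e2 m)" using e2h m by simp
      ultimately show ?thesis using opath_passage[OF e2 a(1,2)] a(3) by simp
    qed
    have "\<tau> x (?G m) \<le> \<tau> x ?v + (real m - real_of_int (lev ?v))"
      using passage_triangle[of x "?G m" ?v] up by linarith
    \<comment> \<open>Going on from \<open>?v\<close> along the guard to \<open>?G m\<close> and
      along \<open>h\<close> to \<open>?G n\<close> costs exactly the levels gained, so this detour
      is also optimal.\<close>
    then show ?thesis using via rest upper[OF m(3) n] by linarith
  qed
  then show ?thesis using m(3) by blast
qed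

text \<open>Any finite subpath is part of a longer optimal initial segment; by the triangle
  inequality a shortcut for the part would shorten the whole. Optimality is therefore required for
  late \<open>n\<close> only.\<close>

lemma infinite_geodesicI:
  assumes nb: "\<And>i. neighbours (\<gamma> i) (\<gamma> (Suc i))" and opt: "\<And>n. N \<le> n \<Longrightarrow> wtime w \<gamma> n \<le> \<tau> (\<gamma> 0) (\<gamma> n)"
  shows "infinite_geodesic w \<gamma>"
  unfolding infinite_geodesic_def infinite_lattice_path_def
proof (intro conjI allI impI nb)
  fix i j :: nat assume ij: "i \<le> j"
  let ?s = "\<lambda>k. \<gamma> (i + k)"
  have wk: "walk (\<lambda>k. \<gamma> (a + k)) n (\<gamma> a) (\<gamma> (a + n))" for a n using nb by (simp add: walk_def)
  have m: "map \<gamma> [i..<Suc j] = map ?s [0..<Suc (j - i)]"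
  proof (rule nth_equalityI)
    show "length (map \<gamma> [i..<Suc j]) = length (map ?s [0..<Suc (j - i)])" using ij by simp
    fix k assume "k < length (map \<gamma> [i..<Suc j])"
    then have k: "k < Suc j - i" by (simp del: upt_Suc)
    then have "k < Suc (j - i) - 0" using ij by simp
    then show "map \<gamma> [i..<Suc j] ! k = map ?s [0..<Suc (j - i)] ! k"
      using nth_map_upt[OF k, of \<gamma>] nth_map_upt[of k "Suc (j - i)" 0 ?s] by (simp del: upt_Suc)
  qed
  define n where "n = max j N"
  have w0: "walk \<gamma> n (\<gamma> 0) (\<gamma> n)" using wk[of 0 n] by simp
  have wj: "walk \<gamma> j (\<gamma> 0) (\<gamma> j)" using wk[of 0 j] by simp
  have "wtime w \<gamma> n = wtime w \<gamma> j + wtime w (\<lambda>k. \<gamma> (j + k)) (n - j)"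
    by (rule walk_split(3)[OF w0]) (simp add: n_def)
  moreover have "wtime w \<gamma> j = wtime w \<gamma> i + wtime w ?s (j - i)"
    by (rule walk_split(3)[OF wj ij])
  moreover have "\<tau> (\<gamma> 0) (\<gamma> i) \<le> wtime w \<gamma> i" using passage_le[OF wk[of 0 i]] by simp
  moreover have "\<tau> (\<gamma> j) (\<gamma> n) \<le> wtime w (\<lambda>k. \<gamma> (j + k)) (n - j)"
    using passage_le[OF wk[of j "n - j"]] by (simp add: n_def)
  moreover have "\<tau> (\<gamma> 0) (\<gamma> n) \<le> \<tau> (\<gamma> 0) (\<gamma> i) + \<tau> (\<gamma> i) (\<gamma> j) + \<tau> (\<gamma> j) (\<gamma> n)"
    using passage_triangle[of "\<gamma> 0" "\<gamma> n" "\<gamma> i"] passage_triangle[of "\<gamma> i" "\<gamma> n" "\<gamma> j"] by simp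
  moreover have "wtime w \<gamma> n \<le> \<tau> (\<gamma> 0) (\<gamma> n)" by (rule opt) (simp add: n_def)
  ultimately have "wtime w ?s (j - i) \<le> \<tau> (\<gamma> i) (\<gamma> j)" by linarith
  moreover have wij: "walk ?s (j - i) (\<gamma> i) (\<gamma> j)" using wk[of i "j - i"] ij by simp
  ultimately have "wtime w ?s (j - i) = \<tau> (\<gamma> i) (\<gamma> j)" using passage_le[OF wij] by simp
  then show "geodesic w (map \<gamma> [i..<Suc j]) (\<gamma> i) (\<gamma> j)"
    unfolding geodesic_def m path_from_to_map path_time_map using wij by simp
qed

lemma geodesic_joining:
  assumes g: "guarded config_of n0 h"
    and far: "\<forall>m. \<exists>j\<ge>m. perc config_of j (- int j)" "\<forall>m. \<exists>j\<ge>m. perc config_of j (2 * int j)"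
  shows "\<exists>\<gamma> N m. \<gamma> 0 = x \<and> infinite_geodesic w \<gamma> \<and> (\<forall>k. \<gamma> (N + k) = site (m + k) (h (m + k)))"
proof -
  obtain m where m: "n0 \<le> m" "\<And>n. m \<le> n \<Longrightarrow> \<tau> x (site n (h n)) = \<tau> x (site m (h m)) + (real n - real m)"
    using passage_eventually_linear[OF g far] by blast
  have oh: "opath config_of m h" using g m(1) opath_mono unfolding guarded_def by blast
  obtain \<gamma>0 N where \<gamma>0: "walk \<gamma>0 N x (site m (h m))" "wtime w \<gamma>0 N = \<tau> x (site m (h m))"
    using passage_attained by blast
  define \<gamma> where "\<gamma> = (\<lambda>i. if i \<le> N then \<gamma>0 i else site (m + (i - N)) (h (m + (i - N))))"
  note ow = opath_walk[OF oh]
  have cat: "walk \<gamma> (N + k) x (site (m + k) (h (m + k)))"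
    "wtime w \<gamma> (N + k) = \<tau> x (site m (h m)) + real k" for k
    using walk_concat[OF \<gamma>0(1) ow(1)[of k]] ow(2)[of k] \<gamma>0(2) unfolding \<gamma>_def by simp_all
  have end_eq: "\<gamma> (N + k) = site (m + k) (h (m + k))" for k using cat(1)[of k] by (simp add: walk_def)
  have "\<gamma> 0 = x" using cat(1)[of 0] by (simp add: walk_def)
  moreover have "infinite_geodesic w \<gamma>"
  proof (rule infinite_geodesicI[where N=N])
    show "neighbours (\<gamma> i) (\<gamma> (Suc i))" for i using cat(1)[of "Suc i"] by (simp add: walk_def)
    fix n assume "N \<le> n"
    then obtain k where k: "n = N + k" using le_Suc_ex by blast
    show "wtime w \<gamma> n \<le> \<tau> (\<gamma> 0) (\<gamma> n)"
      using cat(2)[of k] m(2)[of "m + k"] end_eq[of k] \<open>\<gamma> 0 = x\<close> k by simp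
  qed
  ultimately show ?thesis using end_eq by blast
qed

end

text \<open>As \<open>s\<close> and \<open>1 - s\<close> are nonnegative, the norm of the vertex on
  level \<open>n\<close> is asymptotic to \<open>n\<close>. The normalized vertices thus converge to
  \<open>(s, 1 - s)\<close>, which avoids the branch cut of the argument.\<close>

lemma direction_of_slope:
  assumes s: "has_slope h s" "0 \<le> s" "s \<le> 1" and \<gamma>: "\<And>k. \<gamma> (N + k) = site (m + k) (h (m + k))"
  shows "has_asymptotic_direction \<gamma> (plane_arg (s, 1 - s))"
proof -
  have e: "\<gamma> (k + N) = site (k + m) (h (k + m))" for k
    using \<gamma>[of k] by (simp only: add.commute)
  let ?H = "\<lambda>n. real_of_int (h n)"
  let ?d = "\<lambda>n. \<bar>?H n\<bar> + \<bar>real n - ?H n\<bar>"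
  have hl: "(\<lambda>n. ?H n / real n) \<longlonglongrightarrow> s" using s(1) by (simp add: has_slope_def)
  have gl: "(\<lambda>n. (real n - ?H n) / real n) \<longlonglongrightarrow> 1 - s"
    using has_slope_mirror[OF s(1)] by (simp add: has_slope_def)
  have "(\<lambda>n. \<bar>?H n / real n\<bar> + \<bar>(real n - ?H n) / real n\<bar>) \<longlonglongrightarrow> \<bar>s\<bar> + \<bar>1 - s\<bar>"
    by (intro tendsto_intros hl gl)
  then have dl: "(\<lambda>n. ?d n / real n) \<longlonglongrightarrow> 1" using s(2,3) by (simp add: abs_divide add_divide_distrib)
  have cancel: "a / c / (b / c) = a / b" if "c \<noteq> 0" for a b c :: real using that by simp
  have "(\<lambda>n. ?H n / real n / (?d n / real n)) \<longlonglongrightarrow> s / 1" by (intro tendsto_divide hl dl) simp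
  moreover have "\<forall>\<^sub>F n in sequentially. ?H n / real n / (?d n / real n) = ?H n / ?d n"
    using eventually_gt_at_top[of 0] by eventually_elim (rule cancel, simp)
  ultimately have xl: "(\<lambda>n. ?H n / ?d n) \<longlonglongrightarrow> s" unfolding div_by_1 by (rule Lim_transform_eventually)
  have "(\<lambda>n. (real n - ?H n) / real n / (?d n / real n)) \<longlonglongrightarrow> (1 - s) / 1" by (intro tendsto_divide gl dl) simp
  moreover have "\<forall>\<^sub>F n in sequentially. (real n - ?H n) / real n / (?d n / real n) = (real n - ?H n) / ?d n"
    using eventually_gt_at_top[of 0] by eventually_elim (rule cancel, simp)
  ultimately have yl: "(\<lambda>n. (real n - ?H n) / ?d n) \<longlonglongrightarrow> 1 - s" unfolding div_by_1 by (rule Lim_transform_eventually)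
  have "Complex s (1 - s) \<notin> \<real>\<^sub>\<le>\<^sub>0" using s by (auto simp: complex_nonpos_Reals_iff)
  then have "isCont Arg (Complex s (1 - s))" by (rule continuous_at_Arg)
  then have "(\<lambda>n. Arg (Complex (?H n / ?d n) ((real n - ?H n) / ?d n))) \<longlonglongrightarrow> Arg (Complex s (1 - s))"
    by (rule isCont_tendsto_compose) (intro tendsto_Complex xl yl)
  then have "(\<lambda>k. Arg (Complex (?H (k + m) / ?d (k + m)) ((real (k + m) - ?H (k + m)) / ?d (k + m)))) \<longlonglongrightarrow> Arg (Complex s (1 - s))"
    by (rule LIMSEQ_ignore_initial_segment)
  then have l: "(\<lambda>k. plane_arg (real_of_int (fst (\<gamma> (k + N))) / norm1 (\<gamma> (k + N)),
    real_of_int (snd (\<gamma> (k + N))) / norm1 (\<gamma> (k + N)))) \<longlonglongrightarrow> plane_arg (s, 1 - s)"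
    by (simp only: e norm1_def site_def plane_arg_def fst_conv snd_conv of_int_diff of_int_of_nat_eq)
  show ?thesis unfolding has_asymptotic_direction_def by (rule LIMSEQ_offset[OF l])
qed

section \<open>Directions and transfer to the passage times\<close>

text \<open>The path of slope \<open>1 - \<beta>\<close> from a site stays to the left of the
  rightmost path from there; a path moves by at most 1 per level.\<close>

lemma good_bounds:
  assumes g: "good \<beta> \<eta>" "good \<beta> (mir \<eta>)"
  shows "1 - \<beta> \<le> \<beta>" "\<beta> \<le> 1"
proof -
  obtain n i where p: "perc \<eta> n i" using g(1) unfolding good_def by blast
  have r: "(\<lambda>k. real_of_int (rpath \<eta> n i k) / real k) \<longlonglongrightarrow> \<beta>"
    using g(1) p unfolding good_def has_slope_def by blast
  obtain z where z: "opath \<eta> n z" "z n = i" "has_slope z (1 - \<beta>)" using left_path[OF g(2) p] by blast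
  have zr: "z k \<le> rpath \<eta> n i k" if "n \<le> k" for k
    by (rule rpath_max[OF z(1) order_refl _ that]) (simp add: z(2) rpath_start)
  show "1 - \<beta> \<le> \<beta>"
  proof (rule LIMSEQ_le[OF z(3)[unfolded has_slope_def] r], intro exI allI impI)
    fix k assume "n \<le> k"
    then show "real_of_int (z k) / real k \<le> real_of_int (rpath \<eta> n i k) / real k"
      using zr by (intro divide_right_mono) auto
  qed
  have "(\<lambda>k. real_of_int i / real k + 1) \<longlonglongrightarrow> 0 + 1" by (intro tendsto_intros lim_const_over_n)
  then have l1: "(\<lambda>k. real_of_int i / real k + 1) \<longlonglongrightarrow> 1" by simp
  show "\<beta> \<le> 1"
  proof (rule LIMSEQ_le[OF r l1], intro exI allI impI)
    fix k assume k: "n + 1 \<le> k"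
    have "conn \<eta> (k - n) n (rpath \<eta> n i n) (rpath \<eta> n i (n + (k - n)))"
      by (rule opath_conn[OF rpath_opath[OF p]]) simp
    then have "rpath \<eta> n i k \<le> i + int k" using k conn_bounds by (fastforce simp: rpath_start)
    then have "real_of_int (rpath \<eta> n i k) \<le> real_of_int (i + int k)" by (simp only: of_int_le_iff)
    then have "real_of_int (rpath \<eta> n i k) / real k \<le> real_of_int (i + int k) / real k"
      by (intro divide_right_mono) auto
    also have "\<dots> = real_of_int i / real k + 1" using k by (simp add: add_divide_distrib)
    finally show "real_of_int (rpath \<eta> n i k) / real k \<le> real_of_int i / real k + 1" .
  qed
qed

section \<open>Oriented percolation on the whole lattice: critical value, speed and cone\<close>

lemma inj_dedge: "inj dedge"
proof (rule injI)
  fix e e' assume eq: "dedge e = dedge e'"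
  obtain n i b n' i' b' where e: "e = (n, i, b)" "e' = (n', i', b')" by (cases e, cases e') auto
  have "int n = int n' \<and> i = i' \<and> b = b'"
    using eq unfolding e dedge_def site_def
    by (cases b; cases b') (auto simp: doubleton_eq_iff)
  then show "e = e'" using e by simp
qed

lemma dedge_lattice: "dedge e \<in> lattice_edges"
proof -
  obtain n i b where e: "e = (n, i, b)" by (cases e) auto
  have "neighbours (site n i) (site (Suc n) (if b then i + 1 else i))"
    by (simp add: neighbours_def site_def)
  then show ?thesis unfolding lattice_edges_def e dedge_def by blast
qed

lemma countable_lattice_edges: "countable lattice_edges"
proof (rule countable_subset)
  show "lattice_edges \<subseteq> (\<lambda>(x, y). {x, y}) ` UNIV" by (auto simp: lattice_edges_def)
qed simp

text \<open>Restriction to the edges that start on level 0 or above, the only ones an oriented path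
  from the origin can use.\<close>

definition forget :: "(edge \<Rightarrow> bool) \<Rightarrow> config" where
  "forget \<omega> e = \<omega> (dedge e)"

lemma measurable_forget[measurable]: "forget \<in> measurable (oriented_percolation p) (P0 p)"
  unfolding oriented_percolation_def P0_def forget_def[abs_def]
  by (rule measurable_PiM_single'[OF measurable_component_singleton[of _ _ "\<lambda>_. measure_pmf (bernoulli_pmf p)"]])
    (auto simp: dedge_lattice space_PiM)

lemma distr_forget: "distr (oriented_percolation p) (P0 p) forget = P0 p"
proof -
  have "distr (Pi\<^sub>M lattice_edges (\<lambda>_. measure_pmf (bernoulli_pmf p))) (\<Pi>\<^sub>M i\<in>UNIV. measure_pmf (bernoulli_pmf p))
    (\<lambda>\<omega>. \<lambda>n\<in>UNIV. \<omega> (dedge n)) = (\<Pi>\<^sub>M i\<in>UNIV. measure_pmf (bernoulli_pmf p))"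
    using inj_dedge dedge_lattice by (intro distr_PiM_reindex) (auto intro: measure_pmf.prob_space_axioms)
  then show ?thesis by (simp add: oriented_percolation_def P0_def forget_def[abs_def] restrict_UNIV)
qed

lemma prob_space_oriented: "prob_space (oriented_percolation p)"
  unfolding oriented_percolation_def by (intro prob_space_PiM measure_pmf.prob_space_axioms)

lemma step_forget: "step (forget \<omega>) k i j \<longleftrightarrow> (j = i + 1 \<or> j = i) \<and> \<omega> {site k i, site (Suc k) j}"
  by (auto simp: step_def forget_def dedge_def)

lemma open_oriented_iff:
  "open_oriented_path_from \<omega> (0, 0) r \<longleftrightarrow>
     (\<exists>h. opath (forget \<omega>) 0 h \<and> h 0 = 0 \<and> r = (\<lambda>k. site k (h k)))"
proof
  assume o: "open_oriented_path_from \<omega> (0, 0) r"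
  have st: "r (Suc k) = r k + (1, 0) \<or> r (Suc k) = r k + (0, 1)" "\<omega> {r k, r (Suc k)}" for k
    using o by (auto simp: open_oriented_path_from_def)
  define h where "h = (\<lambda>k. fst (r k))"
  have "fst (r k) + snd (r k) = int k" for k
  proof (induction k)
    case 0
    show ?case using o by (simp add: open_oriented_path_from_def)
  next
    case (Suc k)
    then show ?case using st(1)[of k] by auto
  qed
  then have r: "r k = site k (h k)" for k by (simp add: site_def h_def prod_eq_iff algebra_simps)
  have "step (forget \<omega>) k (h k) (h (Suc k))" for k
    unfolding step_forget r[symmetric] using st[of k] by (auto simp: h_def)
  moreover have "h 0 = 0" using o by (simp add: h_def open_oriented_path_from_def)
  ultimately show "\<exists>h. opath (forget \<omega>) 0 h \<and> h 0 = 0 \<and> r = (\<lambda>k. site k (h k))"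
    using r by (intro exI[of _ h]) (auto simp: opath_def)
next
  assume "\<exists>h. opath (forget \<omega>) 0 h \<and> h 0 = 0 \<and> r = (\<lambda>k. site k (h k))"
  then obtain h where h: "opath (forget \<omega>) 0 h" "h 0 = 0" and r: "r = (\<lambda>k. site k (h k))" by blast
  have "(h (Suc k) = h k + 1 \<or> h (Suc k) = h k) \<and> \<omega> {site k (h k), site (Suc k) (h (Suc k))}" for k
    using h(1) by (simp add: opath_def step_forget)
  note st = this
  have "site (Suc k) (h (Suc k)) = site k (h k) + (1, 0) \<or> site (Suc k) (h (Suc k)) = site k (h k) + (0, 1)" for k
    using st[of k] by (elim conjE disjE) (simp_all add: site_def)
  moreover have "site 0 (h 0) = (0, 0)" using h(2) by (simp add: site_def)
  ultimately show "open_oriented_path_from \<omega> (0, 0) r"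
    unfolding open_oriented_path_from_def r using st by blast
qed

lemma ex_open_oriented_iff: "(\<exists>r. open_oriented_path_from \<omega> (0, 0) r) \<longleftrightarrow> perc (forget \<omega>) 0 0"
proof
  assume "\<exists>r. open_oriented_path_from \<omega> (0, 0) r"
  then obtain h where "opath (forget \<omega>) 0 h" "h 0 = 0" unfolding open_oriented_iff by blast
  then show "perc (forget \<omega>) 0 0" using opath_perc[of "forget \<omega>" 0 h 0] by simp
next
  assume "perc (forget \<omega>) 0 0"
  then show "\<exists>r. open_oriented_path_from \<omega> (0, 0) r"
    unfolding open_oriented_iff using rpath_opath by fastforce
qed

lemma percolation_probability_eq: "percolation_probability p = measure (P0 p) {\<eta>. perc \<eta> 0 0}"
proof -
  have "measure (distr (oriented_percolation p) (P0 p) forget) {\<eta>. perc \<eta> 0 0} =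
    measure (oriented_percolation p) (forget -` {\<eta>. perc \<eta> 0 0} \<inter> space (oriented_percolation p))"
    by (rule measure_distr[OF measurable_forget]) (rule setsP, measurable)
  also have "forget -` {\<eta>. perc \<eta> 0 0} \<inter> space (oriented_percolation p) =
    {\<omega> \<in> space (oriented_percolation p). \<exists>r. open_oriented_path_from \<omega> (0, 0) r}"
    unfolding ex_open_oriented_iff by auto
  finally show ?thesis by (simp add: distr_forget percolation_probability_def)
qed

lemma supercriticalI:
  assumes "oriented_critical < p" "0 \<le> p" "p \<le> 1"
  shows "supercritical p"
proof
  have "percolation_probability p \<noteq> 0"
  proof
    assume "percolation_probability p = 0"
    then have "p \<le> oriented_critical" unfolding oriented_critical_def
      using assms by (intro cSup_upper) (auto intro: bdd_aboveI[of _ 1])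
    then show False using assms by simp
  qed
  then show "0 < measure (P0 p) {\<eta>. perc \<eta> 0 0}"
    unfolding percolation_probability_eq using zero_less_measure_iff by blast
qed

lemma rightmost_open_path_iff:
  "rightmost_open_path \<omega> r \<longleftrightarrow> perc (forget \<omega>) 0 0 \<and> r = (\<lambda>k. site k (rpath (forget \<omega>) 0 0 k))"
proof
  let ?r = "rpath (forget \<omega>) 0 0"
  assume R: "rightmost_open_path \<omega> r"
  then have "open_oriented_path_from \<omega> (0, 0) r" by (simp add: rightmost_open_path_def)
  then have p: "perc (forget \<omega>) 0 0" using ex_open_oriented_iff by blast
  obtain h where h: "opath (forget \<omega>) 0 h" "h 0 = 0" "r = (\<lambda>k. site k (h k))"
    using \<open>open_oriented_path_from \<omega> (0, 0) r\<close> unfolding open_oriented_iff by blast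
  have "open_oriented_path_from \<omega> (0, 0) (\<lambda>k. site k (?r k))"
    unfolding open_oriented_iff using rpath_opath[OF p] by (intro exI[of _ ?r]) simp
  then have "fst (site k (?r k)) - snd (site k (?r k)) \<le> fst (r k) - snd (r k)" for k
    using R unfolding rightmost_open_path_def by blast
  then have "?r k \<le> h k" for k using h(3) by (simp add: site_def)
  moreover have "h k \<le> ?r k" for k by (rule rpath_max[OF h(1)]) (use h in auto)
  ultimately have "h = ?r" by (intro ext antisym)
  then show "perc (forget \<omega>) 0 0 \<and> r = (\<lambda>k. site k (?r k))" using p h(3) by simp
next
  let ?r = "rpath (forget \<omega>) 0 0"
  assume R: "perc (forget \<omega>) 0 0 \<and> r = (\<lambda>k. site k (?r k))"
  show "rightmost_open_path \<omega> r"
    unfolding rightmost_open_path_def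
  proof (intro conjI allI impI)
    show "open_oriented_path_from \<omega> (0, 0) r"
      unfolding open_oriented_iff using rpath_opath R by (intro exI[of _ ?r]) simp
    fix s n assume "open_oriented_path_from \<omega> (0, 0) s"
    then obtain h where h: "opath (forget \<omega>) 0 h" "h 0 = 0" "s = (\<lambda>k. site k (h k))"
      unfolding open_oriented_iff by blast
    have "h n \<le> ?r n" by (rule rpath_max[OF h(1)]) (use h in auto)
    then show "fst (s n) - snd (s n) \<le> fst (r n) - snd (r n)" using h(3) R by (simp add: site_def)
  qed
qed

context supercritical
begin

text \<open>On level \<open>k\<close> the vertex \<open>(h k, k - h k)\<close> has coordinate
  difference \<open>2 h k - k\<close>; division by \<open>sqrt 2 * k\<close> gives the
  constant.\<close>

lemma is_speed: "is_rightmost_speed p ((2 * \<beta> - 1) / sqrt 2)"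
proof -
  have "AE \<eta> in P0 p. perc \<eta> 0 0 \<longrightarrow> (\<lambda>k. real_of_int (rpath \<eta> 0 0 k) / real k) \<longlonglongrightarrow> \<beta>"
    using rpath_speed unfolding AE_Q .
  then have "AE \<omega> in oriented_percolation p. perc (forget \<omega>) 0 0 \<longrightarrow>
    (\<lambda>k. real_of_int (rpath (forget \<omega>) 0 0 k) / real k) \<longlonglongrightarrow> \<beta>"
    by (intro AE_distrD[OF measurable_forget]) (simp only: distr_forget)
  then show ?thesis
    unfolding is_rightmost_speed_def
  proof eventually_elim
    case (elim \<omega>)
    show ?case
    proof (intro allI impI)
      fix r assume "rightmost_open_path \<omega> r"
      then have p: "perc (forget \<omega>) 0 0" and r: "r = (\<lambda>k. site k (rpath (forget \<omega>) 0 0 k))"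
        unfolding rightmost_open_path_iff by auto
      let ?h = "rpath (forget \<omega>) 0 0"
      have "(\<lambda>k. (2 * (real_of_int (?h k) / real k) - 1) / sqrt 2) \<longlonglongrightarrow> (2 * \<beta> - 1) / sqrt 2"
        using elim p by (intro tendsto_intros) auto
      moreover have "\<forall>\<^sub>F k in sequentially. (2 * (real_of_int (?h k) / real k) - 1) / sqrt 2 =
        real_of_int (fst (r k) - snd (r k)) / (sqrt 2 * real k)"
        using eventually_gt_at_top[of 0] by eventually_elim (simp add: r site_def field_simps)
      ultimately show "(\<lambda>n. real_of_int (fst (r n) - snd (r n)) / (sqrt 2 * real n)) \<longlonglongrightarrow> (2 * \<beta> - 1) / sqrt 2"
        by (rule Lim_transform_eventually)
    qed
  qed
qed

text \<open>Two different limits would almost surely exclude a rightmost path, and with it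
  percolation from the origin.\<close>

lemma speed_unique:
  assumes "is_rightmost_speed p a" "is_rightmost_speed p b"
  shows "a = b"
proof (rule ccontr)
  assume ab: "a \<noteq> b"
  interpret O: prob_space "oriented_percolation p" by (rule prob_space_oriented)
  have "AE \<omega> in oriented_percolation p. \<not> perc (forget \<omega>) 0 0"
    using assms unfolding is_rightmost_speed_def
  proof eventually_elim
    case (elim \<omega>)
    show ?case
    proof
      assume "perc (forget \<omega>) 0 0"
      then obtain r where r: "rightmost_open_path \<omega> r" unfolding rightmost_open_path_iff by blast
      show False using LIMSEQ_unique[OF elim(1)[rule_format, OF r] elim(2)[rule_format, OF r]] ab by simp
    qed
  qed
  moreover have S: "{\<omega> \<in> space (oriented_percolation p). perc (forget \<omega>) 0 0} \<in> sets (oriented_percolation p)"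
    by measurable
  ultimately have "O.prob {\<omega> \<in> space (oriented_percolation p). perc (forget \<omega>) 0 0} = 0"
    by (subst O.prob_eq_0) auto
  then have "percolation_probability p = 0"
    unfolding percolation_probability_def ex_open_oriented_iff .
  then show False using survival by (simp add: percolation_probability_eq)
qed

lemma rightmost_speed_eq: "rightmost_speed p = (2 * \<beta> - 1) / sqrt 2"
  unfolding rightmost_speed_def using is_speed speed_unique by (intro the_equality) auto

lemma cone_eq: "cone_M p = (\<beta>, 1 - \<beta>)" "cone_N p = (1 - \<beta>, \<beta>)"
proof -
  have "rightmost_speed p / sqrt 2 = (2 * \<beta> - 1) / 2" by (simp add: rightmost_speed_eq)
  then show "cone_M p = (\<beta>, 1 - \<beta>)" "cone_N p = (1 - \<beta>, \<beta>)"
    unfolding cone_M_def cone_N_def by (simp_all add: field_simps)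
qed

text \<open>The argument of \<open>(s, 1 - s)\<close> is continuous in \<open>s\<close>, with value
  \<open>theta_minus p\<close> at \<open>\<beta>\<close> and \<open>theta_plus p\<close> at
  \<open>1 - \<beta>\<close>; the intermediate value theorem supplies \<open>s\<close>.\<close>

lemma direction_in_cone:
  assumes b: "1 - \<beta> \<le> \<beta>" "\<beta> \<le> 1" and \<theta>: "\<theta> \<in> {theta_minus p..theta_plus p}"
  shows "\<exists>s. 1 - \<beta> \<le> s \<and> s \<le> \<beta> \<and> plane_arg (s, 1 - s) = \<theta>"
proof (rule IVT2')
  show "plane_arg (\<beta>, 1 - \<beta>) \<le> \<theta>" "\<theta> \<le> plane_arg (1 - \<beta>, 1 - (1 - \<beta>))"
    using \<theta> by (auto simp: theta_minus_def theta_plus_def cone_eq)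
  show "continuous_on {1 - \<beta>..\<beta>} (\<lambda>s. plane_arg (s, 1 - s))"
    unfolding plane_arg_def fst_conv snd_conv
  proof (rule continuous_on_Arg')
    show "continuous_on {1 - \<beta>..\<beta>} (\<lambda>s. Complex s (1 - s))"
      unfolding Complex_eq by (intro continuous_intros)
    show "Complex s (1 - s) \<notin> \<real>\<^sub>\<le>\<^sub>0" if "s \<in> {1 - \<beta>..\<beta>}" for s
      using that by (auto simp: complex_nonpos_Reals_iff)
  qed
qed (rule b)

end

text \<open>The infimum of the points where \<open>F\<close> is positive belongs to the support. The
  support is bounded below, as \<open>F\<close> vanishes on the negative axis, so its infimum 1 is a
  lower bound of that point.\<close>

lemma distribution_function_below_1:
  assumes F: "nonneg_distribution_function F" and I: "Inf (dist_supp F) = 1" and x: "x < 1"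
  shows "F x = 0"
proof (rule ccontr)
  have mono: "F a \<le> F b" if "a \<le> b" for a b using F that by (simp add: nonneg_distribution_function_def mono_def)
  have neg: "F a = 0" if "a < 0" for a using F that by (simp add: nonneg_distribution_function_def)
  assume "F x \<noteq> 0"
  have "0 \<le> F a" for a using mono[of "min a (-1)" a] neg[of "min a (-1)"] by simp
  then have x0: "0 < F x" using \<open>F x \<noteq> 0\<close> by (simp add: order_less_le)
  let ?S = "{y. 0 < F y}"
  have bdd: "bdd_below ?S" using neg by (intro bdd_belowI[of _ 0]) (metis less_irrefl mem_Collect_eq not_less)
  define c where "c = Inf ?S"
  have cx: "c \<le> x" unfolding c_def using x0 by (intro cInf_lower[OF _ bdd]) simp
  have "c \<in> dist_supp F"
    unfolding dist_supp_def
  proof (intro CollectI allI impI)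
    fix e :: real assume e: "e > 0"
    have "\<not> 0 < F (c - e)"
    proof
      assume "0 < F (c - e)"
      then have "c \<le> c - e" unfolding c_def by (intro cInf_lower[OF _ bdd]) simp
      then show False using e by simp
    qed
    moreover obtain y where "y \<in> ?S" "y < c + e"
      using cInf_lessD[of ?S "c + e"] x0 e unfolding c_def by auto
    then have "0 < F (c + e)" using mono[of y "c + e"] by simp
    ultimately show "F (c - e) < F (c + e)" by simp
  qed
  moreover have "bdd_below (dist_supp F)"
  proof (rule bdd_belowI[of _ 0])
    fix y assume y: "y \<in> dist_supp F"
    show "0 \<le> y"
    proof (rule ccontr)
      assume "\<not> 0 \<le> y"
      then have e: "0 < - y / 2" by simp
      have "\<forall>\<epsilon>>0. F (y - \<epsilon>) < F (y + \<epsilon>)" using y by (simp add: dist_supp_def)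
      from this[rule_format, OF e] have "F (y - (- y / 2)) < F (y + (- y / 2))" .
      moreover have "F (y + (- y / 2)) = 0" "F (y - (- y / 2)) = 0" using \<open>\<not> 0 \<le> y\<close> by (auto intro!: neg)
      ultimately show False by simp
    qed
  qed
  ultimately have "1 \<le> c" using cInf_lower I by metis
  then show False using cx x by simp
qed

text \<open>Almost surely no passage time is below 1, so the events "at most 1" and "equal to 1"
  have the same probability \<open>F 1\<close>.\<close>

lemma edge_time_law:
  assumes M: "prob_space M" and F: "nonneg_distribution_function F" "Inf (dist_supp F) = 1"
    and X[measurable]: "X \<in> borel_measurable M" and c: "cdf (distr M borel X) = F"
  shows "AE \<omega> in M. 1 \<le> X \<omega>" and "measure M {\<omega> \<in> space M. X \<omega> = 1} = F 1"
proof -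
  interpret prob_space M by fact
  have cdf: "F a = prob {\<omega> \<in> space M. X \<omega> \<le> a}" for a
  proof -
    have "F a = measure (distr M borel X) {..a}" by (simp add: c[symmetric] cdf_def)
    also have "\<dots> = prob (X -` {..a} \<inter> space M)" by (rule measure_distr) auto
    also have "X -` {..a} \<inter> space M = {\<omega> \<in> space M. X \<omega> \<le> a}" by auto
    finally show ?thesis .
  qed
  have "AE \<omega> in M. \<forall>n. \<not> X \<omega> \<le> 1 - 1 / real (Suc n)"
    unfolding AE_all_countable
  proof
    fix n
    have "prob {\<omega> \<in> space M. X \<omega> \<le> 1 - 1 / real (Suc n)} = 0"
      using distribution_function_below_1[OF F, of "1 - 1 / real (Suc n)"] cdf by simp
    then show "AE \<omega> in M. \<not> X \<omega> \<le> 1 - 1 / real (Suc n)" by (subst (asm) prob_eq_0) auto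
  qed
  then show ge: "AE \<omega> in M. 1 \<le> X \<omega>"
  proof eventually_elim
    case (elim \<omega>)
    show ?case
    proof (rule ccontr)
      assume "\<not> 1 \<le> X \<omega>"
      then obtain n where "1 / real (Suc n) < 1 - X \<omega>" using nat_approx_posE[of "1 - X \<omega>"] by auto
      then show False using elim[rule_format, of n] by simp
    qed
  qed
  have "prob {\<omega> \<in> space M. X \<omega> = 1} = prob {\<omega> \<in> space M. X \<omega> \<le> 1}"
    by (rule finite_measure_eq_AE) (use ge in auto)
  then show "measure M {\<omega> \<in> space M. X \<omega> = 1} = F 1" using cdf by simp
qed

lemma distr_open_edges:
  assumes M: "prob_space M" and F: "nonneg_distribution_function F" "Inf (dist_supp F) = 1" "F 1 = p"
    and ind: "prob_space.indep_vars M (\<lambda>_. borel) t lattice_edges"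
    and c: "\<And>e. e \<in> lattice_edges \<Longrightarrow> cdf (distr M borel (t e)) = F" and p: "0 \<le> p" "p \<le> 1"
  shows "(\<lambda>\<omega> e. t (dedge e) \<omega> = 1) \<in> measurable M (P0 p)"
    "distr M (P0 p) (\<lambda>\<omega> e. t (dedge e) \<omega> = 1) = P0 p"
proof -
  interpret prob_space M by fact
  let ?B = "measure_pmf (bernoulli_pmf p)"
  have t[measurable]: "t e \<in> borel_measurable M" if "e \<in> lattice_edges" for e
    using ind that by (simp add: indep_vars_def)
  have X: "(\<lambda>\<omega>. t e \<omega> = 1) \<in> measurable M ?B" if e: "e \<in> lattice_edges" for e
  proof -
    have "Measurable.pred M (\<lambda>\<omega>. t e \<omega> = 1)" using t[OF e] by measurable
    then show ?thesis by (simp cong: measurable_cong_sets)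
  qed
  have law: "distr M ?B (\<lambda>\<omega>. t e \<omega> = 1) = ?B" if e: "e \<in> lattice_edges" for e
  proof (rule measure_eqI_countable[of _ UNIV])
    fix b :: bool
    have S: "{\<omega> \<in> space M. t e \<omega> = 1} \<in> events" using t[OF e] by measurable
    have m1: "prob {\<omega> \<in> space M. t e \<omega> = 1} = p"
      using edge_time_law(2)[OF M F(1,2) t[OF e] c[OF e]] F(3) by simp
    have "(\<lambda>\<omega>. t e \<omega> = 1) -` {b} \<inter> space M =
      (if b then {\<omega> \<in> space M. t e \<omega> = 1} else space M - {\<omega> \<in> space M. t e \<omega> = 1})"
      by auto
    then have "emeasure (distr M ?B (\<lambda>\<omega>. t e \<omega> = 1)) {b} = ennreal (if b then p else 1 - p)"
      using m1 prob_compl[OF S] by (subst emeasure_distr[OF X[OF e]]) (auto simp: emeasure_eq_measure)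
    then show "emeasure (distr M ?B (\<lambda>\<omega>. t e \<omega> = 1)) {b} = emeasure ?B {b}"
      using p by (simp add: emeasure_pmf_single)
  qed auto
  \<comment> \<open>The law is first identified on the whole lattice, where independence is given,
    and then restricted by \<open>forget\<close>.\<close>
  define R where "R = (\<lambda>\<omega>. \<lambda>e\<in>lattice_edges. t e \<omega> = 1)"
  have R: "R \<in> measurable M (oriented_percolation p)"
    unfolding R_def oriented_percolation_def using X by (rule measurable_restrict)
  have ne: "lattice_edges \<noteq> {}" using dedge_lattice by blast
  have "indep_vars (\<lambda>_. ?B) (\<lambda>e \<omega>. (\<lambda>r. r = (1::real)) (t e \<omega>)) lattice_edges"
    by (rule indep_vars_compose2[OF ind]) (simp cong: measurable_cong_sets)
  then have "distr M (Pi\<^sub>M lattice_edges (\<lambda>_. ?B)) R =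
      (\<Pi>\<^sub>M e\<in>lattice_edges. distr M ?B (\<lambda>\<omega>. t e \<omega> = 1))"
    unfolding R_def using X by (subst (asm) indep_vars_iff_distr_eq_PiM'[OF ne]) auto
  also have "\<dots> = (\<Pi>\<^sub>M e\<in>lattice_edges. ?B)" using law by (intro PiM_cong) auto
  finally have dR: "distr M (oriented_percolation p) R = oriented_percolation p"
    by (simp only: oriented_percolation_def)
  have f: "forget \<circ> R = (\<lambda>\<omega> e. t (dedge e) \<omega> = 1)"
    by (simp add: fun_eq_iff forget_def R_def dedge_lattice)
  show "(\<lambda>\<omega> e. t (dedge e) \<omega> = 1) \<in> measurable M (P0 p)"
    unfolding f[symmetric] by (rule measurable_comp[OF R measurable_forget])
  show "distr M (P0 p) (\<lambda>\<omega> e. t (dedge e) \<omega> = 1) = P0 p"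
    unfolding f[symmetric] distr_distr[OF measurable_forget R, symmetric] dR by (rule distr_forget)
qed

lemma coalesce_if_common_tail:
  assumes "\<And>k. \<gamma> (N + k) = g (m + k)" "\<And>k. \<gamma>' (N' + k) = g (m' + k)"
  shows "coalesce \<gamma> \<gamma>'"
  unfolding coalesce_def
proof (intro exI allI)
  fix k
  have "\<gamma> (N + (m' + k)) = g (m + (m' + k))" "\<gamma>' (N' + (m + k)) = g (m' + (m + k))"
    by (rule assms)+
  then show "\<gamma> (N + m' + k) = \<gamma>' (N' + m + k)" by (simp only: add.assoc add.left_commute[of m m'])
qed

theorem theorem1p6:
  fixes M :: "'a measure"
    and t :: "edge \<Rightarrow> 'a \<Rightarrow> real"
    and F :: "real \<Rightarrow> real"
    and p :: real
  assumes "prob_space M"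
    and "nonneg_distribution_function F"
    and "Inf (dist_supp F) = 1"
    and "F 1 = p"
    and "p > oriented_critical"
    and "\<And>e \<omega>. e \<in> lattice_edges \<Longrightarrow> \<omega> \<in> space M \<Longrightarrow> 0 < t e \<omega>"
    and "prob_space.indep_vars M (\<lambda>_. borel) t lattice_edges"
    and "\<And>e. e \<in> lattice_edges \<Longrightarrow> cdf (distr M borel (t e)) = F"
  shows "AE \<omega> in M. \<forall>\<theta> \<in> {theta_minus p..theta_plus p}.
           \<exists>\<gamma> :: vertex \<Rightarrow> nat \<Rightarrow> vertex.
             (\<forall>x. infinite_geodesic (\<lambda>e. t e \<omega>) (\<gamma> x)) \<and>
             (\<forall>x. \<gamma> x 0 = x \<and> has_asymptotic_direction (\<gamma> x) \<theta>) \<and>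
             (\<forall>x y. coalesce (\<gamma> x) (\<gamma> y))"
proof -
  interpret M: prob_space M by fact
  have t: "t e \<in> borel_measurable M" if "e \<in> lattice_edges" for e
    using assms(7) that by (simp add: M.indep_vars_def)
  \<comment> \<open>\<open>p\<close> is the probability that a fixed edge is open.\<close>
  have p: "0 \<le> p" "p \<le> 1"
  proof -
    have "measure M {\<omega> \<in> space M. t (dedge (0, 0, True)) \<omega> = 1} = p"
      using edge_time_law(2)[OF assms(1-3) t[OF dedge_lattice] assms(8)[OF dedge_lattice]] assms(4) by simp
    then show "0 \<le> p" "p \<le> 1" by auto
  qed
  interpret S: supercritical p by (rule supercriticalI[OF assms(5) p])
  have "AE \<omega> in M. \<forall>e\<in>lattice_edges. 1 \<le> t e \<omega>"
    by (rule AE_ball_countable'[OF _ countable_lattice_edges])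
      (rule edge_time_law(1)[OF assms(1-3) t assms(8)])
  moreover have "AE \<omega> in M. good S.\<beta> (\<lambda>e. t (dedge e) \<omega> = 1) \<and> good S.\<beta> (mir (\<lambda>e. t (dedge e) \<omega> = 1))"
  proof -
    note X = distr_open_edges[OF assms(1-4,7) assms(8) p, simplified]
    show ?thesis by (rule AE_distrD[OF X(1)]) (simp only: X(2) S.AE_good[OF p])
  qed
  ultimately show ?thesis
  proof eventually_elim
    case (elim \<omega>)
    interpret passage_times "\<lambda>e. t e \<omega>" by unfold_locales (use elim(1) in blast)
    have cfg: "config_of = (\<lambda>e. t (dedge e) \<omega> = 1)" by (simp add: fun_eq_iff config_of_def)
    have g: "good S.\<beta> config_of" "good S.\<beta> (mir config_of)" using elim(2) unfolding cfg by auto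
    have far1: "\<forall>m. \<exists>j\<ge>m. perc config_of j (- int j)" using g(1) unfolding good_def by blast
    have "\<forall>m. \<exists>j\<ge>m. perc (mir config_of) j (- int j)" using g(2) unfolding good_def by blast
    \<comment> \<open>The reflection takes the site \<open>(j, - j)\<close> to
      \<open>(j, 2 j)\<close>, far to the right.\<close>
    then have far2: "\<forall>m. \<exists>j\<ge>m. perc config_of j (2 * int j)" by (simp add: perc_mir)
    show ?case
    proof
      \<comment> \<open>The event \<open>good\<close> does not refer to a direction, so the
        exceptional null set has been chosen before \<open>\<theta>\<close>.\<close>
      fix \<theta> assume "\<theta> \<in> {theta_minus p..theta_plus p}"
      then obtain s where s: "1 - S.\<beta> \<le> s" "s \<le> S.\<beta>" "plane_arg (s, 1 - s) = \<theta>"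
        using S.direction_in_cone[OF good_bounds[OF g]] by blast
      have s01: "0 \<le> s" "s \<le> 1" using s good_bounds[OF g] by auto
      obtain h n0 where h: "guarded config_of n0 h" "has_slope h s" using guarded_path[OF g s(1,2)] by blast
      obtain \<gamma> N m where \<gamma>: "\<And>x. \<gamma> x 0 = x" "\<And>x. infinite_geodesic (\<lambda>e. t e \<omega>) (\<gamma> x)"
        "\<And>x k. \<gamma> x (N x + k) = site (m x + k) (h (m x + k))"
        using geodesic_joining[OF h(1) far1 far2] by metis
      show "\<exists>\<gamma> :: vertex \<Rightarrow> nat \<Rightarrow> vertex.
             (\<forall>x. infinite_geodesic (\<lambda>e. t e \<omega>) (\<gamma> x)) \<and>
             (\<forall>x. \<gamma> x 0 = x \<and> has_asymptotic_direction (\<gamma> x) \<theta>) \<and>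
             (\<forall>x y. coalesce (\<gamma> x) (\<gamma> y))"
      proof (intro exI[of _ \<gamma>] conjI allI)
        fix x y
        show "infinite_geodesic (\<lambda>e. t e \<omega>) (\<gamma> x)" "\<gamma> x 0 = x" by (rule \<gamma>)+
        show "has_asymptotic_direction (\<gamma> x) \<theta>"
          using direction_of_slope[OF h(2) s01 \<gamma>(3)] s(3) by simp
        show "coalesce (\<gamma> x) (\<gamma> y)"
          by (rule coalesce_if_common_tail[where g="\<lambda>n. site n (h n)"]) (rule \<gamma>(3))+
      qed
    qed
  qed
qed

end
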